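(* Let $A,B$ be linear operators on $\mathbb{R}^n$ such that $\lambda A+B$ is a regular pencil of index not higher than $1$, with spectral projectors $P_1,P_2,Q_1,Q_2$, subspaces $X_j=P_j\mathbb{R}^n$, $Y_j=Q_j\mathbb{R}^n$ ($j=1,2$) and operator $G=A+BP_2$. Let $f\in C([0,\infty)\times\mathbb{R}^n,\mathbb{R}^n)$ with $\frac{\partial f}{\partial x}\in C([0,\infty)\times\mathbb{R}^n,L(\mathbb{R}^n))$ (no further smoothness of $f$ is required), and put $L_0=\{(t,x)\in[0,\infty)\times\mathbb{R}^n : Q_2[Bx-f(t,x)]=0\}$. Assume: (i) for any $t\ge 0$ and any $x_{p_1}\in X_1$ there exists $x_{p_2}\in X_2$ such that $(t,x_{p_1}+x_{p_2})\in L_0$; (ii) for any $t_*\ge 0$, $x_{p_1}^*\in X_1$ and any $x_{p_2}^1,x_{p_2}^2\in X_2$ such that $(t_*,x_{p_1}^*+x_{p_2}^i)\in L_0$, $i=1,2$, the operator function $\Phi\colon X_2\to L(X_2,Y_2)$, $\Phi(x_{p_2})=\left[\frac{\partial (Q_2f)}{\partial x}(t_*,x_{p_1}^*+x_{p_2})-B\right]P_2$, is basis invertible on $[x_{p_2}^1,x_{p_2}^2]$; (iii) at least one of the following holds: (a) there exists a self-adjoint positive operator $H\in L(X_1)$ and for each $T'>0$ there exists $R_{T'}>0$ such that $(HP_1x,G^{-1}Q_1f(t,x))\le 0$ for all $(t,x)\in L_0$ with $0\le t\le T'$ and $\|P_1x\|\ge R_{T'}$; (b) $Q_1f(t,x)=S_1(t)P_1x+\psi(t,x)+\Pi(x)e(t)$,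 where $S_1\in C([0,\infty),L(X_1,Y_1))$, $\psi\in C([0,\infty)\times\mathbb{R}^n,Y_1)$, $\frac{\partial\psi}{\partial x}\in C([0,\infty)\times\mathbb{R}^n,L(\mathbb{R}^n,Y_1))$, $e\in C([0,\infty),\mathbb{R}^n)$, $\Pi\in C^1(\mathbb{R}^n,L(\mathbb{R}^n,Y_1))$, there exist $C,r>0$ such that $\|\Pi(x)\|\le C$ for all $x$ with $\|P_1x\|\ge r$, and there exists a self-adjoint positive operator $H\in L(X_1)$ and for each $T'>0$ there exists $R_{T'}>0$ such that $(HP_1x,G^{-1}\psi(t,x))\le 0$ for all $(t,x)\in L_0$ with $0\le t\le T'$ and $\|P_1x\|\ge R_{T'}$; (c) for some self-adjoint positive operator $H\in L(X_1)$ and some number $R>0$ there exist functions $k\in C([0,\infty),\mathbb{R})$ and $U\in C((0,\infty),(0,\infty))$ such that $\int_c^{+\infty}\frac{dv}{U(v)}=+\infty$ ($c>0$) and $\big(HP_1x,G^{-1}[-BP_1x+Q_1f(t,x)]\big)\le k(t)\,U\big(\tfrac12(HP_1x,P_1x)\big)$ for all $(t,x)\in L_0$ with $\|P_1x\|\ge R$. Let $(t_0,x_0)\in L_0$ and $T>t_0$. Let, additionally, the operator $\left[\frac{\partial (Q_2f)}{\partial x}(t,z+u)-B\right]P_2\in L(X_2,Y_2)$ be invertible for all $t\in[t_0,T]$, $z\in X_1$, $u\in X_2$. Let $x(t)$ be the unique global solution (which exists under these hypotheses) of $$\frac{d}{dt}[Ax]+Bx=f(t,x),\qquad x(t_0)=x_0,$$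 and put $z(t)=P_1x(t)$, $u(t)=P_2x(t)$. For $N\in\mathbb{N}$ let $h=(T-t_0)/N$, $t_i=t_0+ih$ ($i=0,\dots,N$), $z_0=P_1x_0$, $u_0=P_2x_0$. Then the method $$x_0=z_0+u_0,$$ $$z_{i+1}=(I-hG^{-1}B)z_i+hG^{-1}Q_1f(t_i,z_i+u_i),$$ $$u_{i+1}=u_i-\Big[I-G^{-1}\tfrac{\partial (Q_2f)}{\partial x}(t_{i+1},z_{i+1}+u_i)\Big]^{-1}\big[u_i-G^{-1}Q_2f(t_{i+1},z_{i+1}+u_i)\big],$$ $$x_{i+1}=z_{i+1}+u_{i+1},\qquad i=0,\dots,N-1,$$ converges: $$\max_{0\le i\le N}\|z(t_i)-z_i\|\to 0,\qquad \max_{0\le i\le N}\|u(t_i)-u_i\|\to 0\qquad (h\to 0).$$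
   Context: $L(X,Y)$ is the space of (continuous) linear operators from $X$ to $Y$, $L(X)=L(X,X)$, and $I$ is the identity. $A$ and $B$ may be noninvertible. $(\cdot,\cdot)$ is the inner product on $\mathbb{R}^n$; a self-adjoint operator $H\in L(X_1)$ is positive if $(Hx,x)>0$ for all $x\in X_1$, $x\neq 0$. Pencil. The pencil $\lambda A+B$ ($\lambda$ a complex parameter) is regular if $\det(\lambda_0A+B)\ne 0$ for some $\lambda_0$. A regular pencil has index not higher than $1$ if there are constants $C_1,C_2>0$ with $\|(\lambda A+B)^{-1}\|\le C_1$ for all $|\lambda|\ge C_2$. In that case the spectral projectors are $$P_1=\frac{1}{2\pi i}\oint_{|\lambda|=C_2}(\lambda A+B)^{-1}A\,d\lambda,\quad P_2=I-P_1,\quad Q_1=\frac{1}{2\pi i}\oint_{|\lambda|=C_2}A(\lambda A+B)^{-1}d\lambda,\quad Q_2=I-Q_1.$$ They are real and give direct decompositions $\mathbb{R}^n=X_1\dot+X_2=Y_1\dot+Y_2$, with $X_j=P_j\mathbb{R}^n$, $Y_j=Q_j\mathbb{R}^n$. $A$ and $B$ map $X_j$ into $Y_j$, $A|_{X_2}=0$, and $A|_{X_1}\colon X_1\to Y_1$, $B|_{X_2}\colon X_2\to Y_2$ are invertible. The operator $G=A+BP_2=A+Q_2B\in L(\mathbb{R}^n)$ is invertible and $GX_j=Y_j$. If $A$ is invertible (index $0$), then $P_2=Q_2=0$, $P_1=Q_1=I$, and the conditions involving $X_2$ and $\Phi$ are vacuous. Solutions. A solution of the initial value problem on $[t_0,t_1)$,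 $t_1\le\infty$, is a function $x\in C([t_0,t_1),\mathbb{R}^n)$ with $Ax\in C^1([t_0,t_1),\mathbb{R}^n)$ satisfying the equation on $[t_0,t_1)$ and the initial condition. It is global if $t_1=\infty$. Basis invertibility. Let $W,Z$ be $s$-dimensional linear spaces, $D\subset W$, $\hat w,\tilde w\in D$, and $[\hat w,\tilde w]=\{\alpha\tilde w+(1-\alpha)\hat w:\alpha\in[0,1]\}$. An additive resolution of the identity in $Z$ is a family $\{\Theta_k\}_{k=1}^s$ of one-dimensional projectors in $Z$ with $\Theta_i\Theta_j=\delta_{ij}\Theta_i$ and $\sum_{k=1}^s\Theta_k=I_Z$. A mapping $\Phi\colon D\to L(W,Z)$ is basis invertible on $[\hat w,\tilde w]$ if for some additive resolution of the identity $\{\Theta_k\}_{k=1}^s$ in $Z$ and for any set of vectors $\{w^k\}_{k=1}^s\subset[\hat w,\tilde w]$ the operator $\Lambda=\sum_{k=1}^s\Theta_k\Phi(w^k)\in L(W,Z)$ has an inverse $\Lambda^{-1}\in L(Z,W)$. *)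

theory Defs
  imports "HOL-Complex_Analysis.Complex_Analysis"
begin

definition pencil :: "real^'n^'n \<Rightarrow> real^'n^'n \<Rightarrow> complex \<Rightarrow> complex^'n^'n" where
  "pencil A B \<mu> = (\<chi> i j. \<mu> * of_real (A $ i $ j) + of_real (B $ i $ j))"

definition regular_pencil :: "real^'n^'n \<Rightarrow> real^'n^'n \<Rightarrow> bool" where
  "regular_pencil A B \<longleftrightarrow> (\<exists>\<mu>. det (pencil A B \<mu>) \<noteq> 0)"

definition index_at_most_1 :: "real^'n^'n \<Rightarrow> real^'n^'n \<Rightarrow> real \<Rightarrow> real \<Rightarrow> bool" where
  "index_at_most_1 A B C1 C2 \<longleftrightarrow> C1 > 0 \<and> C2 > 0 \<and>
     (\<forall>\<mu>. cmod \<mu> \<ge> C2 \<longrightarrow>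
        invertible (pencil A B \<mu>) \<and> onorm ((*v) (matrix_inv (pencil A B \<mu>))) \<le> C1)"

text \<open>The contour integrals are taken entrywise. The resulting complex matrices have real entries;
  \<^const>\<open>Re\<close> only changes the type.\<close>

definition spectral_P :: "real^'n^'n \<Rightarrow> real^'n^'n \<Rightarrow> real \<Rightarrow> real^'n^'n" where
  "spectral_P A B r = (\<chi> i j. Re (1 / (2 * of_real pi * \<i>) *
     contour_integral (circlepath 0 r)
       (\<lambda>\<mu>. (matrix_inv (pencil A B \<mu>) ** map_matrix of_real A) $ i $ j)))"

definition spectral_Q :: "real^'n^'n \<Rightarrow> real^'n^'n \<Rightarrow> real \<Rightarrow> real^'n^'n" where
  "spectral_Q A B r = (\<chi> i j. Re (1 / (2 * of_real pi * \<i>) *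
     contour_integral (circlepath 0 r)
       (\<lambda>\<mu>. (map_matrix of_real A ** matrix_inv (pencil A B \<mu>)) $ i $ j)))"

text \<open>An operator between subspaces \<open>W\<close> and \<open>Z\<close> is represented by any matrix
  on the ambient spaces that extends it; only its values on \<open>W\<close> are ever used. Every
  linear map (and every continuous family of linear maps) from \<open>W\<close> to \<open>Z\<close> has such an extension,
  and restriction preserves continuity, so nothing is lost.\<close>

definition Lop :: "(real^'n) set \<Rightarrow> (real^'m) set \<Rightarrow> (real^'n^'m) set" where
  "Lop W Z = {M. \<forall>w\<in>W. M *v w \<in> Z}"

definition invertible_between :: "(real^'n) set \<Rightarrow> (real^'m) set \<Rightarrow> real^'n^'m \<Rightarrow> bool" where
  "invertible_between W Z M \<longleftrightarrow> M \<in> Lop W Z \<and>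
     (\<exists>N\<in>Lop Z W. (\<forall>w\<in>W. N *v (M *v w) = w) \<and> (\<forall>z\<in>Z. M *v (N *v z) = z))"

definition positive_selfadjoint_on :: "(real^'n) set \<Rightarrow> real^'n^'n \<Rightarrow> bool" where
  "positive_selfadjoint_on X H \<longleftrightarrow> H \<in> Lop X X \<and>
     (\<forall>x\<in>X. \<forall>y\<in>X. (H *v x) \<bullet> y = x \<bullet> (H *v y)) \<and>
     (\<forall>x\<in>X. x \<noteq> 0 \<longrightarrow> (H *v x) \<bullet> x > 0)"

definition additive_resolution :: "(real^'m) set \<Rightarrow> (nat \<Rightarrow> real^'m^'m) \<Rightarrow> bool" where
  "additive_resolution Z \<Theta> \<longleftrightarrow>
     (\<forall>k\<in>{1..dim Z}. \<Theta> k \<in> Lop Z Z \<and> dim ((*v) (\<Theta> k) ` Z) = 1) \<and>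
     (\<forall>i\<in>{1..dim Z}. \<forall>j\<in>{1..dim Z}. \<forall>z\<in>Z.
        \<Theta> i *v (\<Theta> j *v z) = (if i = j then \<Theta> i *v z else 0)) \<and>
     (\<forall>z\<in>Z. (\<Sum>k\<in>{1..dim Z}. \<Theta> k *v z) = z)"

definition basis_invertible ::
  "(real^'n) set \<Rightarrow> (real^'m) set \<Rightarrow> (real^'n \<Rightarrow> real^'n^'m) \<Rightarrow> real^'n \<Rightarrow> real^'n \<Rightarrow> bool" where
  "basis_invertible W Z \<Phi> w1 w2 \<longleftrightarrow>
     (\<exists>\<Theta>. additive_resolution Z \<Theta> \<and>
        (\<forall>w. (\<forall>k\<in>{1..dim Z}. w k \<in> closed_segment w1 w2) \<longrightarrow>
           invertible_between W Z (\<Sum>k\<in>{1..dim Z}. \<Theta> k ** \<Phi> (w k))))"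

text \<open>Continuity of a function on \<open>[0,\<infinity>) \<times> \<real>\<^sup>n\<close> and of its partial derivative in the space variable.\<close>

definition continuous_with_dx :: "(real \<Rightarrow> real^'n \<Rightarrow> real^'m) \<Rightarrow> bool" where
  "continuous_with_dx f \<longleftrightarrow>
     continuous_on ({0..} \<times> UNIV) (\<lambda>(t, x). f t x) \<and>
     (\<forall>t\<ge>0. \<forall>x. f t differentiable at x) \<and>
     continuous_on ({0..} \<times> UNIV) (\<lambda>(t, x). jacobian (f t) (at x))"

definition C1_map :: "('a::real_normed_vector \<Rightarrow> 'b::real_normed_vector) \<Rightarrow> bool" where
  "C1_map F \<longleftrightarrow> (\<exists>D :: 'a \<Rightarrow> 'a \<Rightarrow>\<^sub>L 'b.
     (\<forall>x. (F has_derivative blinfun_apply (D x)) (at x)) \<and> continuous_on UNIV D)"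

definition L0_set ::
  "real^'n^'n \<Rightarrow> real^'n^'n \<Rightarrow> (real \<Rightarrow> real^'n \<Rightarrow> real^'n) \<Rightarrow> (real \<times> (real^'n)) set" where
  "L0_set B Q2 f = {(t, x). 0 \<le> t \<and> Q2 *v (B *v x - f t x) = 0}"

text \<open>The derivative of \<open>A x\<close> is taken within \<open>[t\<^sub>0,t\<^sub>1)\<close>, hence one-sided at \<open>t\<^sub>0\<close>.\<close>

definition dae_solution ::
  "real^'n^'n \<Rightarrow> real^'n^'n \<Rightarrow> (real \<Rightarrow> real^'n \<Rightarrow> real^'n) \<Rightarrow> real \<Rightarrow> real^'n \<Rightarrow> ereal \<Rightarrow>
     (real \<Rightarrow> real^'n) \<Rightarrow> bool" where
  "dae_solution A B f t0 x0 t1 x \<longleftrightarrow>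
     (let J = {t. t0 \<le> t \<and> ereal t < t1} in
      continuous_on J x \<and>
      (\<exists>D. continuous_on J D \<and>
         (\<forall>t\<in>J. ((\<lambda>s. A *v x s) has_vector_derivative D t) (at t within J) \<and>
                 D t + B *v x t = f t (x t))) \<and>
      x t0 = x0)"

definition global_dae_solution ::
  "real^'n^'n \<Rightarrow> real^'n^'n \<Rightarrow> (real \<Rightarrow> real^'n \<Rightarrow> real^'n) \<Rightarrow> real \<Rightarrow> real^'n \<Rightarrow>
     (real \<Rightarrow> real^'n) \<Rightarrow> bool" where
  "global_dae_solution A B f t0 x0 x \<longleftrightarrow> dae_solution A B f t0 x0 \<infinity> x"

primrec scheme ::
  "real^'n^'n \<Rightarrow> real^'n^'n \<Rightarrow> real^'n^'n \<Rightarrow> real^'n^'n \<Rightarrow> (real \<Rightarrow> real^'n \<Rightarrow> real^'n) \<Rightarrow>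
     real \<Rightarrow> real^'n \<Rightarrow> real^'n \<Rightarrow> real \<Rightarrow> nat \<Rightarrow> (real^'n) \<times> (real^'n)" where
  "scheme B G Q1 Q2 f t0 z0 u0 h 0 = (z0, u0)"
| "scheme B G Q1 Q2 f t0 z0 u0 h (Suc i) =
     (let (z, u) = scheme B G Q1 Q2 f t0 z0 u0 h i;
          t = t0 + real i * h;
          t' = t0 + real (Suc i) * h;
          z' = (mat 1 - h *\<^sub>R (matrix_inv G ** B)) *v z
               + h *\<^sub>R (matrix_inv G *v (Q1 *v f t (z + u)));
          u' = u - matrix_inv (mat 1 - matrix_inv G ** jacobian (\<lambda>x. Q2 *v f t' x) (at (z' + u)))
                 *v (u - matrix_inv G *v (Q2 *v f t' (z' + u)))
      in (z', u'))"

end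

theory Submission
  imports Defs
begin

text \<open>
  Splitting. The resolvent \<open>(\<lambda>A + B)\<inverse>\<close> is bounded near infinity, so in the variable \<open>s = 1/\<lambda>\<close> it
  extends holomorphically to \<open>s = 0\<close>, with an expansion \<open>W\<^sub>0 + s W\<^sub>1 + s\<^sup>2 W\<^sub>2 + \<dots>\<close> whose coefficients
  satisfy a few matrix identities. The contour integrals pick out \<open>P\<^sub>1 = W\<^sub>1 A\<close> and \<open>Q\<^sub>1 = A W\<^sub>1\<close>, and
  all facts needed about the spectral projectors are algebra in these identities
  (\<open>resolvent_expansion\<close>, \<open>spectral_projectors\<close>).

  Reduction to an ordinary differential equation. Put \<open>E t x = x - G\<inverse> Q\<^sub>2 f(t,x)\<close>. A point lies on
  \<open>L\<^sub>0\<close> exactly when \<open>E t x\<close> lies in \<open>X\<^sub>1\<close>, and then \<open>E t x = P\<^sub>1 x\<close>. Condition (i) makes every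
  equation \<open>E t x = z\<close> with \<open>z \<in> X\<^sub>1\<close> solvable. Condition (ii) makes the solution unique: Rolle's
  theorem, applied separately to each one-dimensional component of the constraint, produces the points
  at which basis invertibility is used (\<open>basis_invertible_injective\<close>). On a degenerate segment
  condition (ii) says that the Jacobian of \<open>E t\<close> is invertible. So \<open>x = \<xi>(t,z)\<close> with \<open>\<xi>\<close> continuous
  and locally Lipschitz in \<open>z\<close> (\<open>continuous_on_\<xi>\<close>, \<open>\<xi>_Lipschitz\<close>), and the problem is
  equivalent to \<open>z' = \<Phi>(t, \<xi>(t,z))\<close> in \<open>X\<^sub>1\<close>, where \<open>\<Phi> t x = G\<inverse> Q\<^sub>1 (f(t,x) - B x)\<close>.

  Global solvability. The right-hand side is cut off outside a large ball, which makes it globally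
  Lipschitz, and Picard iteration solves the modified equation on a given interval. The energy
  \<open>(Hz,z)/2\<close> cannot reach a high level within this interval, because its growth is controlled by a
  function \<open>U\<close> with divergent integral of \<open>1/U\<close>; hence the cut-off is never felt
  (\<open>osgood_bound\<close>, \<open>energy_confinement\<close>, \<open>global_solution_in_subspace\<close>). Alternatives (a) and (b) of
  condition (iii) are the case \<open>U(v) = v\<close> (\<open>quadratic_confinement\<close>).

  Convergence. With \<open>w = z\<^sub>i\<^sub>+\<^sub>1 + u\<^sub>i\<close> the formula for \<open>u\<^sub>i\<^sub>+\<^sub>1\<close> is one Newton step from \<open>w\<close> for
  \<open>E t\<^sub>i\<^sub>+\<^sub>1 x = z\<^sub>i\<^sub>+\<^sub>1\<close>. Since \<open>f\<close> is only \<open>C\<^sup>1\<close> in \<open>x\<close>, a Newton step is not quadratically accurate, but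
  close to the solution it halves the error up to a multiple of the error in \<open>z\<close>
  (\<open>newton_step\<close>). The Euler step adds to the error in \<open>z\<close> at most \<open>h\<close> times a multiple of the error
  in \<open>x\<close> and a modulus of continuity of \<open>z'\<close>. The two coupled recursions keep both errors
  proportional to that modulus, which tends to zero with \<open>h\<close>
  (\<open>euler_newton_error_recursion\<close>, \<open>euler_newton_converges\<close>).
\<close>

section \<open>The resolvent at infinity and the spectral projectors\<close>

text \<open>The substitution \<open>\<mu> = 1/s\<close> turns the circle of radius \<open>r\<close> into the reversed circle of radius
  \<open>1/r\<close>, and \<open>d\<mu> = - ds/s\<^sup>2\<close> produces Cauchy's kernel for the first derivative.\<close>
lemma inverse_circle_integral:
  fixes w :: "complex \<Rightarrow> complex"
  assumes r: "0 < r" and c: "continuous_on (cball 0 (1/r)) w" and h: "w holomorphic_on ball 0 (1/r)"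
  shows "((\<lambda>\<mu>. w (1/\<mu>)) has_contour_integral 2 * of_real pi * \<i> * deriv w 0) (circlepath 0 r)"
proof -
  have I: "((\<lambda>u. w u / (u - 0) ^ Suc 1) has_contour_integral 2 * of_real pi * \<i> * deriv w 0)
     (circlepath 0 (1/r))"
    using Cauchy_has_contour_integral_higher_derivative_circlepath[OF c h, of 0 1] r by simp
  have I2: "((\<lambda>u. w u / (u - 0) ^ Suc 1) has_contour_integral - (2 * of_real pi * \<i> * deriv w 0))
     (reversepath (circlepath 0 (1/r)))"
    by (intro has_contour_integral_reversepath I valid_path_circlepath)
  let ?s = "\<lambda>x::real. of_real (1/r) * exp (2 * of_real pi * \<i> * of_real (1 - x))"
  have rp: "reversepath (circlepath 0 (1/r)) = ?s"
    by (auto simp: reversepath_def circlepath_def part_circlepath_def linepath_def algebra_simps)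
  have cp: "circlepath 0 r = (\<lambda>x. of_real r * exp (2 * of_real pi * \<i> * of_real x))"
    by (simp add: circlepath)
  have d1: "vector_derivative ?s (at x) = - (2 * of_real pi * \<i>) * ?s x" for x
  proof (rule vector_derivative_at)
    have "((\<lambda>z. of_real (1/r) * exp (2 * of_real pi * \<i> * (1 - z))) has_field_derivative
        - (2 * of_real pi * \<i>) * ?s x) (at (of_real x))"
      using r by (auto intro!: derivative_eq_intros)
    from has_vector_derivative_real_field[OF this]
    show "(?s has_vector_derivative - (2 * of_real pi * \<i>) * ?s x) (at x)" by simp
  qed
  have d2: "vector_derivative (circlepath 0 r) (at x) = (2 * of_real pi * \<i>) * circlepath 0 r x" for x
    unfolding vector_derivative_circlepath by (simp add: circlepath mult_ac)
  have sm: "?s x = 1 / circlepath 0 r x" for x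
  proof -
    have "exp (2 * of_real pi * \<i> * of_real (1 - x)) * exp (2 * of_real pi * \<i> * of_real x) = 1"
      by (simp flip: exp_add add: algebra_simps)
    then show ?thesis using r by (simp add: cp divide_simps mult_ac)
  qed
  have nz: "circlepath 0 r x \<noteq> 0" for x using r by (simp add: cp)
  have neg: "- (w (?s x) / (?s x - 0) ^ Suc 1 * (- (2 * of_real pi * \<i>) * ?s x)) =
      w (1 / circlepath 0 r x) * (2 * of_real pi * \<i> * circlepath 0 r x)" for x
  proof -
    have "- (w (1/c) / (1/c - 0) ^ Suc 1 * (- k * (1/c))) = w (1/c) * (k * c)"
      if "c \<noteq> 0" for c k :: complex
      using that by (simp add: power2_eq_square)
    from this[OF nz[of x]] show ?thesis unfolding sm .
  qed
  have "((\<lambda>x. w (?s x) / (?s x - 0) ^ Suc 1 * (- (2 * of_real pi * \<i>) * ?s x)) has_integral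
     - (2 * of_real pi * \<i> * deriv w 0)) {0..1}"
    using I2 unfolding rp has_contour_integral d1 .
  from has_integral_neg[OF this] show ?thesis
    unfolding neg has_contour_integral d2 by simp
qed

lemma matrix_inv_inverse:
  fixes M :: "'a::semiring_1^'n^'n"
  assumes "invertible M"
  shows matrix_inv_right: "M ** matrix_inv M = mat 1" and matrix_inv_left: "matrix_inv M ** M = mat 1"
  using assms someI_ex[of "\<lambda>N. M ** N = mat 1 \<and> N ** M = mat 1"]
  by (auto simp: invertible_def matrix_inv_def)

lemma matrix_vector_axis_nth:
  fixes M :: "'a::semiring_1^'n^'m"
  shows "(M *v axis j 1) $ k = M $ k $ j"
  by (simp add: matrix_vector_mult_def axis_def if_distrib cong: if_cong)

text \<open>Cramer's rule shows that the entries of a resolvent are rational in the parameter; this is where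
  their holomorphy comes from.\<close>
lemma matrix_inv_entry:
  fixes M :: "'a::field^'n^'n"
  assumes "det M \<noteq> 0"
  shows "matrix_inv M $ k $ j =
    det (\<chi> i l. if l = k then axis j 1 $ i else M $ i $ l) / det M"
proof -
  have inv: "invertible M" using assms by (simp add: invertible_det_nz)
  have sol: "M *v (matrix_inv M *v axis j 1) = axis j 1"
    by (simp add: matrix_vector_mul_assoc matrix_inv_right[OF inv])
  have
    "matrix_inv M *v axis j 1 = (\<chi> k. det (\<chi> i l. if l = k then axis j 1 $ i else M $ i $ l) / det M)"
    by (rule iffD1[OF cramer[OF assms] sol])
  moreover have "(matrix_inv M *v axis j 1) $ k = matrix_inv M $ k $ j"
    by (rule matrix_vector_axis_nth)
  ultimately show ?thesis by simp
qed

lemma holomorphic_on_det: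
  fixes M :: "complex \<Rightarrow> complex^'n^'n"
  assumes "\<And>i j. (\<lambda>s. M s $ i $ j) holomorphic_on S"
  shows "(\<lambda>s. det (M s)) holomorphic_on S"
  unfolding det_def by (intro holomorphic_intros assms)

text \<open>The bound on the resolvent near infinity makes the point \<open>s = 0\<close> a removable singularity.
  On the closed disc the pencil stays invertible, so the extension is holomorphic in a
  neighbourhood of it and continuous up to the boundary circle, where the contour integral lives.\<close>
lemma resolvent_extends_holomorphically:
  fixes A B :: "real^'n^'n"
  assumes ind: "index_at_most_1 A B C1 C2"
  obtains w where "w holomorphic_on ball 0 (1/C2)" "continuous_on (cball 0 (1/C2)) w"
    "\<And>s. s \<noteq> 0 \<Longrightarrow> cmod s \<le> 1/C2 \<Longrightarrow> w s = matrix_inv (pencil A B (1/s)) $ i $ j"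
proof -
  have C: "C1 > 0" "C2 > 0"
    and inv: "\<And>\<mu>. cmod \<mu> \<ge> C2 \<Longrightarrow> invertible (pencil A B \<mu>)"
    and bd: "\<And>\<mu>. cmod \<mu> \<ge> C2 \<Longrightarrow> onorm ((*v) (matrix_inv (pencil A B \<mu>))) \<le> C1"
    using ind by (auto simp: index_at_most_1_def)
  define d where "d = (\<lambda>s. det (pencil A B (1/s)))"
  define R where "R = (\<lambda>s. det (\<chi> k l. if l = i then axis j 1 $ k else pencil A B (1/s) $ k $ l) / d s)"
  define Om where "Om = {s \<in> - {0}. d s \<noteq> 0}"
  have hd: "d holomorphic_on -{0}"
    unfolding d_def pencil_def by (intro holomorphic_on_det) (auto intro!: holomorphic_intros)
  have hn: "(\<lambda>s. det (\<chi> k l. if l = i then axis j 1 $ k else pencil A B (1/s) $ k $ l)) holomorphic_on -{0}"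
  proof (intro holomorphic_on_det)
    fix k l
    show "(\<lambda>s. (\<chi> k l. if l = i then axis j 1 $ k else pencil A B (1/s) $ k $ l) $ k $ l) holomorphic_on -{0}"
      by (cases "l = i") (auto simp: pencil_def intro!: holomorphic_intros)
  qed
  have hR: "R holomorphic_on Om"
    unfolding R_def by (rule holomorphic_on_divide[OF holomorphic_on_subset[OF hn] holomorphic_on_subset[OF hd]])
      (auto simp: Om_def)
  have inOm: "s \<in> Om" and Rs: "R s = matrix_inv (pencil A B (1/s)) $ i $ j"
    if "s \<noteq> 0" "cmod s \<le> 1/C2" for s
  proof -
    have "C2 \<le> cmod (1/s)" using that C by (simp add: norm_divide field_simps)
    then have "det (pencil A B (1/s)) \<noteq> 0" using inv by (simp add: invertible_det_nz)
    then show "s \<in> Om" and "R s = matrix_inv (pencil A B (1/s)) $ i $ j" using that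
      by (auto simp: Om_def d_def R_def matrix_inv_entry)
  qed
  have bR: "cmod (R s) \<le> C1" if "s \<noteq> 0" "cmod s \<le> 1/C2" for s
  proof -
    let ?M = "matrix_inv (pencil A B (1/s))"
    have "cmod (?M $ i $ j) = cmod ((?M *v axis j 1) $ i)"
      by (simp add: matrix_vector_axis_nth)
    also have "\<dots> \<le> norm (?M *v axis j 1)" by (rule Finite_Cartesian_Product.norm_nth_le)
    also have "\<dots> \<le> onorm ((*v) ?M) * norm (axis j 1 :: complex^'n)"
      by (rule onorm) simp
    also have "\<dots> = onorm ((*v) ?M)" by (simp add: norm_axis_1)
    also have "\<dots> \<le> C1" using bd[of "1/s"] that C by (simp add: norm_divide field_simps)
    finally show ?thesis using Rs[OF that] by simp
  qed
  define S where "S = insert 0 Om"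
  have sub: "cball 0 (1/C2) \<subseteq> S" 
  proof
    fix s :: complex assume "s \<in> cball 0 (1/C2)"
    then show "s \<in> S" using inOm[of s] by (cases "s = 0") (auto simp: S_def)
  qed
  have int0: "0 \<in> interior S"
    by (rule interiorI[of "ball 0 (1/C2)"]) (use C sub ball_subset_cball[of 0 "1/C2"] in auto)
  have ev: "eventually (\<lambda>s. cmod (R s) \<le> C1) (at 0)"
    unfolding eventually_at by (rule exI[of _ "1/C2"]) (use C bR in \<open>auto simp: dist_norm\<close>)
  have hRS: "R holomorphic_on S - {0}" using hR by (rule holomorphic_on_subset) (auto simp: S_def)
  have "\<exists>w. w holomorphic_on S \<and> (\<forall>z\<in>S - {0}. w z = R z)"
    by (rule iffD2[OF holomorphic_on_extend_bounded[OF hRS int0]]) (rule exI, rule ev)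
  then obtain w where w: "w holomorphic_on S" "\<forall>z\<in>S - {0}. w z = R z" by (elim exE conjE)
  show ?thesis
  proof
    show "w holomorphic_on ball 0 (1/C2)"
      by (rule holomorphic_on_subset[OF w(1)]) (use sub ball_subset_cball[of 0 "1/C2"] in blast)
    show "continuous_on (cball 0 (1/C2)) w"
      using holomorphic_on_imp_continuous_on[OF w(1)] sub by (rule continuous_on_subset)
    show "w s = matrix_inv (pencil A B (1/s)) $ i $ j" if "s \<noteq> 0" "cmod s \<le> 1/C2" for s
      using bspec[OF w(2), of s] inOm[OF that] Rs[OF that] that by (simp add: S_def)
  qed
qed

text \<open>Comparison of the coefficients of \<open>s\<^sup>0\<close>, \<open>s\<^sup>1\<close>, \<open>s\<^sup>2\<close> in \<open>(a + s b) W(s) = s c\<close>. Two bounded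
  linear maps instead of matrix products let one lemma serve for multiplication from either side.\<close>
lemma expansion_coefficients:
  fixes a b :: "'v::real_normed_vector \<Rightarrow> 'w::real_normed_vector" and W1 W2 :: "real \<Rightarrow> 'v"
  assumes a: "bounded_linear a" and b: "bounded_linear b" and rho: "\<rho> > 0"
    and eq: "\<And>s. s \<noteq> 0 \<Longrightarrow> \<bar>s\<bar> < \<rho> \<Longrightarrow>
        a (W0 + s *\<^sub>R W1 s) + s *\<^sub>R b (W0 + s *\<^sub>R W1 s) = s *\<^sub>R c"
    and W1: "\<And>s. s \<noteq> 0 \<Longrightarrow> \<bar>s\<bar> < \<rho> \<Longrightarrow> W1 s = W1 0 + s *\<^sub>R W2 s"
    and cont: "(W1 \<longlongrightarrow> W1 0) (at 0)" "(W2 \<longlongrightarrow> W2 0) (at 0)"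
  shows "a W0 = 0" and "a (W1 0) + b W0 = c" and "a (W2 0) + b (W1 0) = 0"
proof -
  interpret a: bounded_linear a by fact
  interpret b: bounded_linear b by fact
  have ev: "\<forall>\<^sub>F s in at 0. s \<noteq> 0 \<and> \<bar>s\<bar> < \<rho>"
    unfolding eventually_at using rho by (auto simp: dist_norm)
  have z: "x = y" if "(h \<longlongrightarrow> x) (at (0::real))" "\<And>s. s \<noteq> 0 \<Longrightarrow> \<bar>s\<bar> < \<rho> \<Longrightarrow> h s = y" for h and x y :: 'w
  proof -
    have "(h \<longlongrightarrow> y) (at 0)"
      by (rule tendsto_eventually, rule eventually_mono[OF ev]) (use that in auto)
    then show ?thesis using that(1) tendsto_unique by (metis at_neq_bot)
  qed
  have eq0: "a W0 + s *\<^sub>R (a (W1 s) + b W0 + s *\<^sub>R b (W1 s) - c) = 0" if "s \<noteq> 0" "\<bar>s\<bar> < \<rho>" for s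
    using eq[OF that] by (simp add: a.add b.add a.scaleR b.scaleR algebra_simps)
  have "((\<lambda>s. a W0 + s *\<^sub>R (a (W1 s) + b W0 + s *\<^sub>R b (W1 s) - c)) \<longlongrightarrow>
      a W0 + 0 *\<^sub>R (a (W1 0) + b W0 + 0 *\<^sub>R b (W1 0) - c)) (at 0)"
    by (intro tendsto_intros a.tendsto b.tendsto cont)
  from z[OF this eq0] show a0: "a W0 = 0" by simp
  have eq1: "a (W1 s) + b W0 + s *\<^sub>R b (W1 s) = c" if "s \<noteq> 0" "\<bar>s\<bar> < \<rho>" for s
    using eq0[OF that] that a0 by simp
  have "((\<lambda>s. a (W1 s) + b W0 + s *\<^sub>R b (W1 s)) \<longlongrightarrow> a (W1 0) + b W0 + 0 *\<^sub>R b (W1 0)) (at 0)"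
    by (intro tendsto_intros a.tendsto b.tendsto cont)
  from z[OF this eq1] show a1: "a (W1 0) + b W0 = c" by simp
  have eq2: "a (W2 s) + b (W1 s) = 0" if "s \<noteq> 0" "\<bar>s\<bar> < \<rho>" for s
  proof -
    have "a (W1 0) + s *\<^sub>R a (W2 s) + b W0 + s *\<^sub>R b (W1 s) = a (W1 0) + b W0"
      using eq1[OF that] a1 arg_cong[OF W1[OF that], of a] by (simp add: a.add a.scaleR)
    then have "s *\<^sub>R (a (W2 s) + b (W1 s)) = 0" by (simp add: algebra_simps)
    then show ?thesis using that by simp
  qed
  have "((\<lambda>s. a (W2 s) + b (W1 s)) \<longlongrightarrow> a (W2 0) + b (W1 0)) (at 0)"
    by (intro tendsto_intros a.tendsto b.tendsto cont)
  from z[OF this eq2] show "a (W2 0) + b (W1 0) = 0" by simp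
qed

lemma bounded_linear_matrix_mult:
  fixes A :: "real^'n^'n"
  shows "bounded_linear (\<lambda>X. A ** X)" "bounded_linear (\<lambda>X. X ** A)"
  by (auto intro!: linearI simp: linear_conv_bounded_linear[symmetric] vec_eq_iff matrix_matrix_mult_def sum_distrib_left sum.distrib algebra_simps)

lemma matrix_inv_unique:
  fixes M :: "'a::semiring_1^'n^'n"
  assumes "M ** N = mat 1" "N ** M = mat 1"
  shows "matrix_inv M = N"
proof -
  have "invertible M" using assms by (auto simp: invertible_def)
  then have "matrix_inv M = matrix_inv M ** (M ** N)" "matrix_inv M ** M = mat 1"
    using assms by (simp_all add: matrix_inv_left)
  then show ?thesis by (metis matrix_mul_assoc matrix_mul_lid)
qed

lemma pencil_of_real:
  "pencil A B (of_real m) = map_matrix of_real (m *\<^sub>R A + B)"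
  by (simp add: pencil_def vec_eq_iff map_matrix_def)

lemma map_matrix_of_real_mult:
  fixes A :: "real^'n^'m" and B :: "real^'k^'n"
  shows "(map_matrix of_real (A ** B) :: complex^'k^'m) = map_matrix of_real A ** map_matrix of_real B"
  by (simp add: vec_eq_iff map_matrix_def matrix_matrix_mult_def)

lemma map_matrix_of_real_mat: "(map_matrix of_real (mat 1) :: complex^'n^'n) = mat 1"
  by (simp add: vec_eq_iff map_matrix_def mat_def)

lemma det_map_matrix_of_real:
  fixes A :: "real^'n^'n"
  shows "det (map_matrix of_real A :: complex^'n^'n) = of_real (det A)"
  by (simp add: det_def map_matrix_def)

text \<open>For real parameters everything can be read off in real matrices, so the expansion of the resolvent
  is carried out along the real axis.\<close>
lemma real_resolvent:
  fixes A B :: "real^'n^'n"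
  assumes "invertible (pencil A B (of_real m))"
  shows "invertible (m *\<^sub>R A + B)"
    and "matrix_inv (pencil A B (of_real m)) = map_matrix of_real (matrix_inv (m *\<^sub>R A + B))"
proof -
  show inv: "invertible (m *\<^sub>R A + B)"
    using assms by (simp add: pencil_of_real invertible_det_nz det_map_matrix_of_real)
  show "matrix_inv (pencil A B (of_real m)) = map_matrix of_real (matrix_inv (m *\<^sub>R A + B))"
    by (rule matrix_inv_unique)
      (simp_all add: pencil_of_real map_matrix_of_real_mult[symmetric] matrix_inv_left[OF inv] matrix_inv_right[OF inv] map_matrix_of_real_mat)
qed

lemma holomorphic_difference_quotient:
  assumes "w holomorphic_on ball 0 \<rho>" "\<rho> > 0"
  obtains v where "v holomorphic_on ball 0 \<rho>" "v 0 = deriv w 0" "\<And>s. w s = w 0 + s * v s"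
proof
  let ?v = "\<lambda>s. if s = 0 then deriv w 0 else (w s - w 0) / (s - 0)"
  show "?v holomorphic_on ball 0 \<rho>" by (rule pole_lemma) (use assms in auto)
qed auto

text \<open>The identities are the coefficients of \<open>s\<^sup>0\<close>, \<open>s\<^sup>1\<close>, \<open>s\<^sup>2\<close> in \<open>(A + s B) W(s) = s I\<close> and
  \<open>W(s) (A + s B) = s I\<close>, where \<open>W(s) = W\<^sub>0 + s W\<^sub>1 + s\<^sup>2 W\<^sub>2 + \<dots>\<close> is the resolvent at
  \<open>1/s\<close>. The contour integrals in the projectors extract \<open>W\<^sub>1\<close>.\<close>
lemma resolvent_expansion:
  fixes A B :: "real^'n^'n"
  assumes ind: "index_at_most_1 A B C1 C2"
  obtains W0 W1 W2 :: "real^'n^'n" where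
    "A ** W0 = 0" "A ** W1 + B ** W0 = mat 1" "A ** W2 + B ** W1 = 0"
    "W0 ** A = 0" "W1 ** A + W0 ** B = mat 1" "W2 ** A + W1 ** B = 0"
    "spectral_P A B C2 = W1 ** A" "spectral_Q A B C2 = A ** W1"
proof -
  define \<rho> where "\<rho> = 1/C2"
  have C: "C2 > 0" "\<rho> > 0"
    and inv: "\<And>\<mu>. cmod \<mu> \<ge> C2 \<Longrightarrow> invertible (pencil A B \<mu>)"
    using ind by (auto simp: index_at_most_1_def \<rho>_def)
  have "\<exists>w. w holomorphic_on ball 0 \<rho> \<and> continuous_on (cball 0 \<rho>) w \<and>
     (\<forall>s. s \<noteq> 0 \<longrightarrow> cmod s \<le> \<rho> \<longrightarrow> w s = matrix_inv (pencil A B (1/s)) $ i $ j)" for i j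
    unfolding \<rho>_def by (rule resolvent_extends_holomorphically[OF ind]) blast
  then obtain w where hw: "\<And>i j. w i j holomorphic_on ball 0 \<rho>"
    and cw: "\<And>i j. continuous_on (cball 0 \<rho>) (w i j)"
    and w: "\<And>i j s. s \<noteq> 0 \<Longrightarrow> cmod s \<le> \<rho> \<Longrightarrow> w i j s = matrix_inv (pencil A B (1/s)) $ i $ j"
    by metis
  have "\<exists>v. v holomorphic_on ball 0 \<rho> \<and> v 0 = deriv (w i j) 0 \<and> (\<forall>s. w i j s = w i j 0 + s * v s)" for i j
    by (rule holomorphic_difference_quotient[OF hw C(2)]) blast
  then obtain v where hv: "\<And>i j. v i j holomorphic_on ball 0 \<rho>" and v0: "\<And>i j. v i j 0 = deriv (w i j) 0"
    and v: "\<And>i j s. w i j s = w i j 0 + s * v i j s" by metis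
  have "\<exists>u. u holomorphic_on ball 0 \<rho> \<and> (\<forall>s. v i j s = v i j 0 + s * u s)" for i j
    by (rule holomorphic_difference_quotient[OF hv C(2)]) blast
  then obtain u where hu: "\<And>i j. u i j holomorphic_on ball 0 \<rho>"
    and u: "\<And>i j s. v i j s = v i j 0 + s * u i j s" by metis
  define W0 :: "real^'n^'n" where "W0 = (\<chi> i j. Re (w i j 0))"
  define W1 :: "real \<Rightarrow> real^'n^'n" where "W1 = (\<lambda>s. \<chi> i j. Re (v i j (of_real s)))"
  define W2 :: "real \<Rightarrow> real^'n^'n" where "W2 = (\<lambda>s. \<chi> i j. Re (u i j (of_real s)))"
  have tend: "((\<lambda>s. \<chi> i j. Re (q i j (of_real s))) \<longlongrightarrow> (\<chi> i j. Re (q i j (of_real 0)))) (at 0)"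
    if "\<And>i j. q i j holomorphic_on ball 0 \<rho>" for q :: "'n \<Rightarrow> 'n \<Rightarrow> complex \<Rightarrow> complex"
  proof -
    have "isCont (q i j) (of_real 0)" for i j
      using holomorphic_on_imp_continuous_on[OF that[of i j]] C
      by (simp add: continuous_on_eq_continuous_at)
    then have "isCont (\<lambda>s. q i j (of_real s)) 0" for i j
      by (intro isCont_o2[where f = of_real and g = "q i j"]) auto
    then show ?thesis by (intro tendsto_intros) (simp add: isCont_def)
  qed
  have W1_lim: "(W1 \<longlongrightarrow> W1 0) (at 0)" and W2_lim: "(W2 \<longlongrightarrow> W2 0) (at 0)"
    unfolding W1_def W2_def by (intro tend hv hu)+
  have W1_eq: "W1 s = W1 0 + s *\<^sub>R W2 s" for s
    using u[of _ _ "of_real s"] by (simp add: W1_def W2_def vec_eq_iff complex_eq_iff)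
  have res: "W0 + s *\<^sub>R W1 s = matrix_inv ((1/s) *\<^sub>R A + B)" "invertible ((1/s) *\<^sub>R A + B)"
    if s: "s \<noteq> 0" "\<bar>s\<bar> < \<rho>" for s
  proof -
    have "C2 \<le> cmod (of_real (1/s))" using s C by (simp add: \<rho>_def norm_divide field_simps)
    note r = real_resolvent[OF inv[OF this]]
    show "invertible ((1/s) *\<^sub>R A + B)" by (rule r)
    have "w i j (of_real s) = of_real (matrix_inv ((1/s) *\<^sub>R A + B) $ i $ j)" for i j
      using w[of "of_real s" i j] s r(2) by (simp add: map_matrix_def)
    then show "W0 + s *\<^sub>R W1 s = matrix_inv ((1/s) *\<^sub>R A + B)"
      using v[of _ _ "of_real s"] by (simp add: W1_def W0_def vec_eq_iff complex_eq_iff)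
  qed
  have sA: "s *\<^sub>R ((1/s) *\<^sub>R A + B) = A + s *\<^sub>R B" if "s \<noteq> 0" for s
    using that by (simp add: algebra_simps)
  interpret L: bounded_linear "\<lambda>Z. Z ** X" for X :: "real^'n^'n" by (rule bounded_linear_matrix_mult)
  interpret R: bounded_linear "\<lambda>Z. X ** Z" for X :: "real^'n^'n" by (rule bounded_linear_matrix_mult)
  have eqR: "A ** (W0 + s *\<^sub>R W1 s) + s *\<^sub>R (B ** (W0 + s *\<^sub>R W1 s)) = s *\<^sub>R mat 1"
    if s: "s \<noteq> 0" "\<bar>s\<bar> < \<rho>" for s
  proof -
    have "((1/s) *\<^sub>R A + B) ** (W0 + s *\<^sub>R W1 s) = mat 1"
      unfolding res(1)[OF s] by (rule matrix_inv_right[OF res(2)[OF s]])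
    then have "s *\<^sub>R mat 1 = (s *\<^sub>R ((1/s) *\<^sub>R A + B)) ** (W0 + s *\<^sub>R W1 s)"
      by (simp only: L.scaleR)
    also have "\<dots> = A ** (W0 + s *\<^sub>R W1 s) + s *\<^sub>R (B ** (W0 + s *\<^sub>R W1 s))"
      by (simp only: sA[OF s(1)] L.add L.scaleR)
    finally show ?thesis ..
  qed
  have eqL: "(W0 + s *\<^sub>R W1 s) ** A + s *\<^sub>R ((W0 + s *\<^sub>R W1 s) ** B) = s *\<^sub>R mat 1"
    if s: "s \<noteq> 0" "\<bar>s\<bar> < \<rho>" for s
  proof -
    have "(W0 + s *\<^sub>R W1 s) ** ((1/s) *\<^sub>R A + B) = mat 1"
      unfolding res(1)[OF s] by (rule matrix_inv_left[OF res(2)[OF s]])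
    then have "s *\<^sub>R mat 1 = (W0 + s *\<^sub>R W1 s) ** (s *\<^sub>R ((1/s) *\<^sub>R A + B))"
      by (simp only: R.scaleR)
    also have "\<dots> = (W0 + s *\<^sub>R W1 s) ** A + s *\<^sub>R ((W0 + s *\<^sub>R W1 s) ** B)"
      by (simp only: sA[OF s(1)] R.add R.scaleR)
    finally show ?thesis ..
  qed
  note cR = expansion_coefficients[OF bounded_linear_matrix_mult(1) bounded_linear_matrix_mult(1) C(2) eqR W1_eq W1_lim W2_lim]
  note cL = expansion_coefficients[OF bounded_linear_matrix_mult(2) bounded_linear_matrix_mult(2) C(2) eqL W1_eq W1_lim W2_lim]
  have res_int: "((\<lambda>\<mu>. matrix_inv (pencil A B \<mu>) $ i $ j) has_contour_integral
      2 * of_real pi * \<i> * v i j 0) (circlepath 0 C2)" for i j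
  proof (rule has_contour_integral_eq)
    show "((\<lambda>\<mu>. w i j (1/\<mu>)) has_contour_integral 2 * of_real pi * \<i> * v i j 0) (circlepath 0 C2)"
      unfolding v0 using inverse_circle_integral[OF C(1)] cw hw by (simp add: \<rho>_def)
    fix \<mu> assume "\<mu> \<in> path_image (circlepath 0 C2)"
    then have "cmod \<mu> = C2" using C by (simp add: sphere_def)
    then show "w i j (1/\<mu>) = matrix_inv (pencil A B \<mu>) $ i $ j"
      using w[of "1/\<mu>" i j] C by (auto simp: \<rho>_def norm_divide)
  qed
  have P: "spectral_P A B C2 = W1 0 ** A"
  proof -
    have "((\<lambda>\<mu>. (matrix_inv (pencil A B \<mu>) ** map_matrix of_real A) $ i $ j) has_contour_integral
       (\<Sum>k\<in>UNIV. 2 * of_real pi * \<i> * v i k 0 * of_real (A $ k $ j))) (circlepath 0 C2)" for i j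
      unfolding matrix_matrix_mult_def map_matrix_def
      by (simp, intro has_contour_integral_sum has_contour_integral_rmul res_int) simp
    from contour_integral_unique[OF this] show ?thesis
      by (simp add: spectral_P_def vec_eq_iff matrix_matrix_mult_def W1_def mult.assoc flip: sum_distrib_left)
  qed
  have Q: "spectral_Q A B C2 = A ** W1 0"
  proof -
    have "((\<lambda>\<mu>. (map_matrix of_real A ** matrix_inv (pencil A B \<mu>)) $ i $ j) has_contour_integral
       (\<Sum>k\<in>UNIV. of_real (A $ i $ k) * (2 * of_real pi * \<i> * v k j 0))) (circlepath 0 C2)" for i j
      unfolding matrix_matrix_mult_def map_matrix_def
      by (simp, intro has_contour_integral_sum has_contour_integral_lmul res_int) simp
    from contour_integral_unique[OF this] show ?thesis
      by (simp add: spectral_Q_def vec_eq_iff matrix_matrix_mult_def W1_def mult.left_commute[of "complex_of_real _"] flip: sum_distrib_left)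
  qed
  show ?thesis by (rule that[OF cR cL P Q])
qed

text \<open>In terms of the coefficients, \<open>I - P = W\<^sub>0 B\<close> and \<open>I - Q = B W\<^sub>0\<close>; everything else is
  substitution.\<close>
lemma spectral_projectors:
  fixes A B :: "real^'n^'n"
  assumes ind: "index_at_most_1 A B C1 C2"
    and P: "P = spectral_P A B C2" and Q: "Q = spectral_Q A B C2"
    and G: "G = A + B ** (mat 1 - P)"
  shows "P ** P = P" "Q ** Q = Q" "A ** P = A" "Q ** A = A" "B ** P = Q ** B"
    "invertible G" "G ** P = A" "Q ** G = A"
proof -
  obtain W0 W1 W2 where W: "A ** W0 = 0" "A ** W1 + B ** W0 = mat 1" "A ** W2 + B ** W1 = 0"
    "W0 ** A = 0" "W1 ** A + W0 ** B = mat 1" "W2 ** A + W1 ** B = 0"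
    and PW: "P = W1 ** A" and QW: "Q = A ** W1"
    unfolding P Q by (rule resolvent_expansion[OF ind])
  interpret L: bounded_linear "\<lambda>Z. Z ** X" for X :: "real^'n^'n" by (rule bounded_linear_matrix_mult)
  interpret R: bounded_linear "\<lambda>Z. X ** Z" for X :: "real^'n^'n" by (rule bounded_linear_matrix_mult)
  have P': "mat 1 - P = W0 ** B" and Q': "mat 1 - Q = B ** W0"
    using W(2,5) by (auto simp: PW QW algebra_simps)
  have AP': "A ** (mat 1 - P) = 0" unfolding P' by (simp add: matrix_mul_assoc W)
  have Q'A: "(mat 1 - Q) ** A = 0" unfolding Q' by (simp add: matrix_mul_assoc[symmetric] W)
  show AP: "A ** P = A" using AP' by (simp add: R.diff)
  show QA: "Q ** A = A" using Q'A by (simp add: L.diff)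
  show PP: "P ** P = P" by (metis AP PW matrix_mul_assoc)
  show QQ: "Q ** Q = Q" by (metis QA QW matrix_mul_assoc)
  show BP: "B ** P = Q ** B"
  proof -
    have BW: "B ** W1 = - (A ** W2)" and WB: "W1 ** B = - (W2 ** A)"
      using W(3,6) by (simp_all add: eq_neg_iff_add_eq_0 add.commute)
    have "B ** P = - (A ** W2 ** A)" by (simp add: PW matrix_mul_assoc BW L.neg)
    moreover have "Q ** B = - (A ** W2 ** A)"
      by (simp add: QW matrix_mul_assoc[symmetric] WB R.neg)
    ultimately show ?thesis by simp
  qed
  have P'P: "(mat 1 - P) ** P = 0" and PP': "P ** (mat 1 - P) = 0" using PP by (simp_all add: L.diff R.diff)
  show GP: "G ** P = A" unfolding G by (simp add: L.add AP matrix_mul_assoc[symmetric] P'P)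
  show QG: "Q ** G = A" unfolding G by (simp add: R.add QA matrix_mul_assoc BP[symmetric])
    (simp add: matrix_mul_assoc[symmetric] PP')
  show "invertible G"
    unfolding invertible_left_inverse matrix_left_invertible_ker
  proof (intro allI impI)
    fix x assume Gx: "G *v x = 0"
    then have Ax: "A *v x = 0" using QG by (metis matrix_vector_mul_assoc matrix_vector_mult_0_right)
    then have Px: "P *v x = 0" using PW by (metis matrix_vector_mul_assoc matrix_vector_mult_0_right)
    have "B *v x = 0" using Gx Ax Px
      by (simp add: G matrix_vector_mult_add_rdistrib matrix_vector_mul_assoc[symmetric] matrix_vector_mult_diff_rdistrib)
    then have "(mat 1 - P) *v x = 0" unfolding P' by (simp add: matrix_vector_mul_assoc[symmetric])
    then show "x = 0" using Px by (simp add: matrix_vector_mult_diff_rdistrib)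
  qed
qed

section \<open>Uniform linearization\<close>

lemma bounded_bilinear_matrix_vector_mult:
  "bounded_bilinear ((*v) :: real^'n^'m \<Rightarrow> real^'n \<Rightarrow> real^'m)"
  unfolding bilinear_conv_bounded_bilinear[symmetric] bilinear_def
  by (auto intro!: linearI simp: matrix_vector_mult_add_rdistrib matrix_vector_right_distrib
      matrix_vector_mult_scaleR scaleR_matrix_vector_assoc)

lemma matrix_norm_bound:
  fixes M :: "real^'n^'m"
  obtains c where "c > 0" "\<And>v. norm (M *v v) \<le> c * norm v"
proof -
  obtain c where "c > 0" "\<And>v. norm (M *v v) \<le> norm v * c"
    using bounded_linear.pos_bounded[OF matrix_vector_mul_bounded_linear] by metis
  then show ?thesis using that by (simp add: mult.commute)
qed

lemma continuous_with_dx_derivative: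
  assumes "continuous_with_dx f" "t \<ge> 0"
  shows "(f t has_derivative (\<lambda>v. jacobian (f t) (at x) *v v)) (at x)"
  using assms by (simp add: continuous_with_dx_def jacobian_works[symmetric])

lemma jacobian_eqI:
  fixes g :: "real^'n \<Rightarrow> real^'m"
  assumes "(g has_derivative (\<lambda>v. M *v v)) (at x)"
  shows "jacobian g (at x) = M" and "g differentiable at x"
proof -
  have "frechet_derivative g (at x) = (\<lambda>v. M *v v)" using frechet_derivative_at[OF assms] by simp
  then show "jacobian g (at x) = M" by (simp add: jacobian_def)
  show "g differentiable at x" using assms by (rule differentiableI)
qed

lemma continuous_with_dx_compose:
  assumes f: "continuous_with_dx f" and x: "continuous_on S x" and \<tau>: "continuous_on S \<tau>"
    and nn: "\<And>s. s \<in> S \<Longrightarrow> \<tau> s \<ge> 0"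
  shows "continuous_on S (\<lambda>s. f (\<tau> s) (x s))"
    and "continuous_on S (\<lambda>s. jacobian (f (\<tau> s)) (at (x s)))"
proof -
  have c: "continuous_on S (\<lambda>s. (\<tau> s, x s))" by (intro continuous_intros x \<tau>)
  have i: "(\<lambda>s. (\<tau> s, x s)) ` S \<subseteq> {0..} \<times> UNIV" using nn by auto
  show "continuous_on S (\<lambda>s. f (\<tau> s) (x s))"
    using continuous_on_compose2[OF _ c i, of "\<lambda>(t, x). f t x"] f by (simp add: continuous_with_dx_def)
  show "continuous_on S (\<lambda>s. jacobian (f (\<tau> s)) (at (x s)))"
    using continuous_on_compose2[OF _ c i, of "\<lambda>(t, x). jacobian (f t) (at x)"] f
    by (simp add: continuous_with_dx_def)
qed

text \<open>The derivative is uniformly continuous on compact cylinders, hence the linearization at \<open>x\<close> is accurate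
  for differences of values at two nearby points, even at a slightly different time.
  This one estimate gives the contraction for \<open>\<xi>\<close>, its Lipschitz bound and the accuracy of a
  Newton step.\<close>
lemma uniform_strict_derivative:
  fixes g :: "real \<Rightarrow> real^'n \<Rightarrow> real^'m"
  assumes g: "continuous_with_dx g" and e: "\<epsilon> > 0"
  obtains \<delta> where "\<delta> > 0"
    "\<And>t s x y y'. \<lbrakk>0 \<le> t; t \<le> a; 0 \<le> s; \<bar>s - t\<bar> \<le> \<delta>; norm x \<le> r; norm (y - x) \<le> \<delta>; norm (y' - x) \<le> \<delta>\<rbrakk>
      \<Longrightarrow> norm (g s y - g s y' - jacobian (g t) (at x) *v (y - y')) \<le> \<epsilon> * norm (y - y')"
proof -
  interpret bb: bounded_bilinear "(*v) :: real^'n^'m \<Rightarrow> real^'n \<Rightarrow> real^'m"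
    by (rule bounded_bilinear_matrix_vector_mult)
  obtain K where K: "K > 0" "\<And>(M::real^'n^'m) v. norm (M *v v) \<le> norm M * norm v * K"
    using bb.pos_bounded by blast
  define C where "C = {0..a+1} \<times> cball (0::real^'n) (r+1)"
  have "compact C" unfolding C_def by (intro compact_Times) auto
  moreover have "continuous_on C (\<lambda>(t, x). jacobian (g t) (at x))"
    using g by (rule_tac continuous_on_subset[of "{0..} \<times> UNIV"]) (auto simp: C_def continuous_with_dx_def)
  ultimately have "uniformly_continuous_on C (\<lambda>(t, x). jacobian (g t) (at x))"
    by (rule compact_uniformly_continuous[rotated])
  then obtain d where d: "d > 0" "\<And>p q. p \<in> C \<Longrightarrow> q \<in> C \<Longrightarrow> dist q p < d \<Longrightarrow>
     dist ((\<lambda>(t, x). jacobian (g t) (at x)) q) ((\<lambda>(t, x). jacobian (g t) (at x)) p) < \<epsilon> / K"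
    unfolding uniformly_continuous_on_def using e K by (metis divide_pos_pos)
  define \<delta> where "\<delta> = min 1 (d/3)"
  have \<delta>: "\<delta> > 0" "\<delta> \<le> 1" "\<delta> \<le> d/3" using d by (auto simp: \<delta>_def)
  show ?thesis
  proof (rule that[OF \<delta>(1)])
    fix t s :: real and x y y' :: "real^'n"
    assume A: "0 \<le> t" "t \<le> a" "0 \<le> s" "\<bar>s - t\<bar> \<le> \<delta>" "norm x \<le> r" "norm (y - x) \<le> \<delta>" "norm (y' - x) \<le> \<delta>"
    let ?J = "jacobian (g t) (at x)"
    have close: "norm (jacobian (g s) (at w) - ?J) \<le> \<epsilon> / K" if "w \<in> cball x \<delta>" for w
    proof -
      have w: "norm (w - x) \<le> \<delta>" using that by (simp add: dist_norm norm_minus_commute)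
      have "norm w \<le> r + 1" using w A(5) \<delta>(2) norm_triangle_sub[of w x] by linarith
      then have "(s, w) \<in> C" "(t, x) \<in> C" using A \<delta> by (auto simp: C_def)
      moreover have "dist (s, w) (t, x) < d"
      proof -
        have "dist (s, w) (t, x) \<le> dist s t + dist w x"
          unfolding dist_prod_def by (simp add: sqrt_sum_squares_le_sum)
        also have "\<dots> \<le> \<delta> + \<delta>" using A w by (simp add: dist_norm)
        finally show ?thesis using \<delta> d by simp
      qed
      ultimately show ?thesis using d(2)[of "(t, x)" "(s, w)"] by (simp add: dist_norm)
    qed
    have "norm ((g s y - ?J *v y) - (g s y' - ?J *v y')) \<le> \<epsilon> * norm (y - y')"
    proof (rule differentiable_bound)
      show "convex (cball x \<delta>)" by simp
      show "y \<in> cball x \<delta>" "y' \<in> cball x \<delta>" using A by (auto simp: dist_norm norm_minus_commute)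
      fix w :: "real^'n" assume w: "w \<in> cball x \<delta>"
      show "((\<lambda>y. g s y - ?J *v y) has_derivative (\<lambda>v. (jacobian (g s) (at w) - ?J) *v v)) (at w within cball x \<delta>)"
        by (rule has_derivative_at_withinI)
          (auto intro!: derivative_eq_intros continuous_with_dx_derivative[OF g A(3)]
            bounded_linear_imp_has_derivative simp: matrix_vector_mult_diff_rdistrib)
      show "onorm ((*v) (jacobian (g s) (at w) - ?J)) \<le> \<epsilon>"
      proof (rule onorm_le)
        fix v
        have "norm ((jacobian (g s) (at w) - ?J) *v v) \<le> norm (jacobian (g s) (at w) - ?J) * norm v * K"
          by (rule K)
        also have "\<dots> \<le> (\<epsilon> / K) * norm v * K"
          using close[OF w] K by (intro mult_right_mono) auto
        finally show "norm ((jacobian (g s) (at w) - ?J) *v v) \<le> \<epsilon> * norm v" using K by simp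
      qed
    qed
    then show "norm (g s y - g s y' - ?J *v (y - y')) \<le> \<epsilon> * norm (y - y')"
      by (simp add: matrix_vector_mult_diff_distrib algebra_simps)
  qed
qed

lemma continuous_with_dx_Lipschitz:
  fixes g :: "real \<Rightarrow> real^'n \<Rightarrow> real^'m"
  assumes g: "continuous_with_dx g"
  obtains L where "L \<ge> 0"
    "\<And>t x y. \<lbrakk>0 \<le> t; t \<le> a; norm x \<le> r; norm y \<le> r\<rbrakk> \<Longrightarrow> norm (g t x - g t y) \<le> L * norm (x - y)"
proof -
  interpret bb: bounded_bilinear "(*v) :: real^'n^'m \<Rightarrow> real^'n \<Rightarrow> real^'m"
    by (rule bounded_bilinear_matrix_vector_mult)
  obtain K where K: "K > 0" "\<And>(M::real^'n^'m) v. norm (M *v v) \<le> norm M * norm v * K"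
    using bb.pos_bounded by blast
  define C where "C = {0..a} \<times> cball (0::real^'n) r"
  have "compact C" unfolding C_def by (intro compact_Times) auto
  moreover have "continuous_on C (\<lambda>(t, x). jacobian (g t) (at x))"
    using g by (rule_tac continuous_on_subset[of "{0..} \<times> UNIV"]) (auto simp: C_def continuous_with_dx_def)
  ultimately have "bounded ((\<lambda>(t, x). jacobian (g t) (at x)) ` C)"
    by (intro compact_imp_bounded compact_continuous_image)
  then obtain b where b: "b > 0" "\<And>t x. (t, x) \<in> C \<Longrightarrow> norm (jacobian (g t) (at x)) \<le> b"
    unfolding bounded_pos by force
  show ?thesis
  proof (rule that[of "b * K"])
    show "b * K \<ge> 0" using b K by simp
    fix t :: real and x y :: "real^'n" assume A: "0 \<le> t" "t \<le> a" "norm x \<le> r" "norm y \<le> r"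
    show "norm (g t x - g t y) \<le> b * K * norm (x - y)"
    proof (rule differentiable_bound[of "cball 0 r"])
      show "x \<in> cball 0 r" "y \<in> cball 0 r" using A by auto
      fix w :: "real^'n" assume w: "w \<in> cball 0 r"
      show "(g t has_derivative (*v) (jacobian (g t) (at w))) (at w within cball 0 r)"
        by (rule has_derivative_at_withinI[OF continuous_with_dx_derivative[OF g A(1)]])
      show "onorm ((*v) (jacobian (g t) (at w))) \<le> b * K"
      proof (rule onorm_le)
        fix v
        have "norm (jacobian (g t) (at w) *v v) \<le> norm (jacobian (g t) (at w)) * norm v * K" by (rule K)
        also have "\<dots> \<le> b * norm v * K"
          using b(2)[of t w] w A K by (intro mult_right_mono) (auto simp: C_def)
        finally show "norm (jacobian (g t) (at w) *v v) \<le> b * K * norm v" by (simp add: mult_ac)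
      qed
    qed simp
  qed
qed

text \<open>A lower bound for \<open>D k v\<close> on the compact set of unit vectors replaces a uniform bound for the
  inverse matrices, and avoids their continuity.\<close>
lemma compact_invertible_lower_bound:
  fixes D :: "'a::metric_space \<Rightarrow> real^'n^'n"
  assumes K: "compact K" and D: "continuous_on K D" and inv: "\<And>k. k \<in> K \<Longrightarrow> invertible (D k)"
  obtains M where "M > 0" "\<And>k v. k \<in> K \<Longrightarrow> norm v \<le> M * norm (D k *v v)"
proof (cases "K = {}")
  case True then show ?thesis using that[of 1] by simp
next
  case False
  let ?S = "sphere (0::real^'n) 1"
  have ne: "K \<times> ?S \<noteq> {}" using False by auto
  have "continuous_on (K \<times> ?S) (\<lambda>p. norm (D (fst p) *v snd p))"
    by (intro continuous_intros bounded_bilinear.continuous_on[OF bounded_bilinear_matrix_vector_mult]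
        continuous_on_compose2[OF D]) auto
  from continuous_attains_inf[OF compact_Times[OF K compact_sphere] ne this]
  obtain k0 v0 where kv: "k0 \<in> K" "norm v0 = 1"
    and min: "\<And>k v. k \<in> K \<Longrightarrow> norm v = 1 \<Longrightarrow> norm (D k0 *v v0) \<le> norm (D k *v v)" by auto
  define m where "m = norm (D k0 *v v0)"
  have "D k0 *v v0 \<noteq> 0"
  proof
    assume "D k0 *v v0 = 0"
    then have "v0 = 0" using inv[OF kv(1)] by (metis invertible_left_inverse matrix_left_invertible_ker)
    then show False using kv by simp
  qed
  then have m: "m > 0" by (simp add: m_def)
  show ?thesis
  proof (rule that[of "1/m"])
    show "1/m > 0" using m by simp
    fix k v assume k: "k \<in> K"
    show "norm v \<le> 1/m * norm (D k *v v)"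
    proof (cases "v = 0")
      case False
      then have "m \<le> norm (D k *v ((1 / norm v) *\<^sub>R v))" unfolding m_def by (intro min k) simp
      also have "\<dots> = norm (D k *v v) / norm v" by (simp add: matrix_vector_mult_scaleR)
      finally show ?thesis using m False by (simp add: field_simps)
    qed simp
  qed
qed

section \<open>Level points of a time-dependent map\<close>

locale unique_level_points =
  fixes E :: "real \<Rightarrow> real^'n \<Rightarrow> real^'n" and S :: "(real^'n) set"
  assumes E: "continuous_with_dx E" and S: "closed S"
    and ex1: "\<And>t z. t \<ge> 0 \<Longrightarrow> z \<in> S \<Longrightarrow> \<exists>!x. E t x = z"
    and nondeg: "\<And>t x. t \<ge> 0 \<Longrightarrow> E t x \<in> S \<Longrightarrow> invertible (jacobian (E t) (at x))"
begin

definition \<xi> :: "real \<Rightarrow> real^'n \<Rightarrow> real^'n" where "\<xi> t z = (THE x. E t x = z)"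

lemma E_\<xi>: "t \<ge> 0 \<Longrightarrow> z \<in> S \<Longrightarrow> E t (\<xi> t z) = z"
  unfolding \<xi>_def by (rule theI'[OF ex1])

lemma \<xi>_eqI: "t \<ge> 0 \<Longrightarrow> E t x = z \<Longrightarrow> z \<in> S \<Longrightarrow> \<xi> t z = x"
  using E_\<xi> ex1 by blast

text \<open>Near a level point the simplified Newton map \<open>x \<mapsto> x - J\<inverse> (E t x - z)\<close>, with \<open>J\<close> frozen at
  that point, contracts a small ball into itself. Its fixed point solves \<open>E t x = z\<close>, and by
  global uniqueness it is \<open>\<xi> t z\<close>. Uniqueness is essential: it excludes that the solution jumps away
  to another branch.\<close>
lemma \<xi>_close:
  assumes t0: "t0 \<ge> 0" and z0: "z0 \<in> S" and e: "e > 0"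
  obtains d where "d > 0"
    "\<And>t z. \<lbrakk>t \<ge> 0; z \<in> S; \<bar>t - t0\<bar> < d; norm (z - z0) < d\<rbrakk> \<Longrightarrow> norm (\<xi> t z - \<xi> t0 z0) \<le> e"
proof -
  define x0 where "x0 = \<xi> t0 z0"
  have Ex0: "E t0 x0 = z0" using E_\<xi>[OF t0 z0] by (simp add: x0_def)
  define J where "J = jacobian (E t0) (at x0)"
  define N where "N = matrix_inv J"
  have inv: "invertible J" using nondeg[of t0 x0] t0 z0 Ex0 by (simp add: J_def)
  have NJ: "N ** J = mat 1" "J ** N = mat 1"
    unfolding N_def by (rule matrix_inv_left[OF inv], rule matrix_inv_right[OF inv])
  obtain c where c: "c > 0" "\<And>v. norm (N *v v) \<le> c * norm v" by (rule matrix_norm_bound[of N]) blast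
  obtain \<delta> where \<delta>: "\<delta> > 0" and str: "\<And>s y y'. \<lbrakk>0 \<le> s; \<bar>s - t0\<bar> \<le> \<delta>; norm (y - x0) \<le> \<delta>; norm (y' - x0) \<le> \<delta>\<rbrakk>
      \<Longrightarrow> norm (E s y - E s y' - J *v (y - y')) \<le> 1 / (2*c) * norm (y - y')"
    by (rule uniform_strict_derivative[OF E, of "1/(2*c)" t0 "norm x0"]) (use c t0 in \<open>auto simp: J_def\<close>)
  define \<eta> where "\<eta> = min e \<delta>"
  have \<eta>: "\<eta> > 0" "\<eta> \<le> e" "\<eta> \<le> \<delta>" using e \<delta> by (auto simp: \<eta>_def)
  have "continuous_on {0..} (\<lambda>s. E s x0)"
    by (rule continuous_with_dx_compose[OF E]) (auto intro!: continuous_intros)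
  then obtain d1 where d1: "d1 > 0" "\<And>t. t \<ge> 0 \<Longrightarrow> \<bar>t - t0\<bar> < d1 \<Longrightarrow> norm (E t x0 - z0) < \<eta> / (4*c)"
    using t0 \<eta> c unfolding continuous_on_iff dist_norm Ex0[symmetric] real_norm_def
    by (metis atLeast_iff divide_pos_pos mult_pos_pos zero_less_numeral)
  define d where "d = min (min d1 \<delta>) (\<eta> / (4*c))"
  have d: "d > 0" "d \<le> d1" "d \<le> \<delta>" "d \<le> \<eta> / (4*c)" using d1 \<delta> \<eta> c by (auto simp: d_def)
  show ?thesis
  proof (rule that[OF d(1)])
    fix t z assume A: "t \<ge> 0" "z \<in> S" "\<bar>t - t0\<bar> < d" "norm (z - z0) < d"
    define \<T> where "\<T> = (\<lambda>x. x - N *v (E t x - z))"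
    have contr: "norm (\<T> x - \<T> y) \<le> 1/2 * norm (x - y)" if "x \<in> cball x0 \<eta>" "y \<in> cball x0 \<eta>" for x y
    proof -
      have xy: "norm (x - x0) \<le> \<delta>" "norm (y - x0) \<le> \<delta>"
        using that \<eta> by (auto simp: dist_norm norm_minus_commute)
      have "\<T> x - \<T> y = (N ** J) *v (x - y) - N *v (E t x - E t y)"
        by (simp add: \<T>_def NJ matrix_vector_mult_diff_distrib)
      also have "\<dots> = - (N *v (E t x - E t y - J *v (x - y)))"
        by (simp add: matrix_vector_mul_assoc matrix_vector_mult_diff_distrib)
      finally have "norm (\<T> x - \<T> y) \<le> c * norm (E t x - E t y - J *v (x - y))" using c by simp
      also have "\<dots> \<le> c * (1 / (2*c) * norm (x - y))"
        using A d xy c by (intro mult_left_mono str) auto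
      finally show ?thesis using c by simp
    qed
    have base: "norm (\<T> x0 - x0) \<le> \<eta> / 2"
    proof -
      have "norm (E t x0 - z) \<le> norm (E t x0 - z0) + norm (z - z0)"
        by (metis norm_minus_commute norm_triangle_sub add.commute diff_diff_eq2 diff_add_cancel norm_triangle_ineq4 norm_diff_triangle_le order_refl)
      also have "\<dots> \<le> \<eta> / (4*c) + \<eta> / (4*c)" using d1(2)[OF A(1)] A d by auto
      finally have "c * norm (E t x0 - z) \<le> c * (\<eta> / (4*c) + \<eta> / (4*c))" using c by (intro mult_left_mono) auto
      then have "c * norm (E t x0 - z) \<le> \<eta> / 2" using c by (simp add: field_simps)
      then show ?thesis using c(2)[of "E t x0 - z"] by (simp add: \<T>_def)
    qed
    have "\<exists>!x\<in>cball x0 \<eta>. \<T> x = x"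
    proof (rule Banach_fix[of _ "1/2"])
      show "complete (cball x0 \<eta>)" by (simp add: complete_eq_closed)
      show "cball x0 \<eta> \<noteq> {}" using \<eta> by simp
      show "\<T> ` cball x0 \<eta> \<subseteq> cball x0 \<eta>"
      proof safe
        fix x assume x: "x \<in> cball x0 \<eta>"
        have "norm (\<T> x - x0) \<le> norm (\<T> x - \<T> x0) + norm (\<T> x0 - x0)"
          using norm_triangle_ineq[of "\<T> x - \<T> x0" "\<T> x0 - x0"] by simp
        also have "\<dots> \<le> 1/2 * norm (x - x0) + \<eta>/2" using contr[OF x, of x0] base \<eta> by auto
        also have "\<dots> \<le> \<eta>" using x by (simp add: dist_norm norm_minus_commute)
        finally show "\<T> x \<in> cball x0 \<eta>" by (simp add: dist_norm norm_minus_commute)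
      qed
      show "dist (\<T> x) (\<T> y) \<le> 1/2 * dist x y" if "x \<in> cball x0 \<eta>" "y \<in> cball x0 \<eta>" for x y
        using contr[OF that] by (simp add: dist_norm)
    qed auto
    then obtain x where x: "x \<in> cball x0 \<eta>" "\<T> x = x" by blast
    then have "N *v (E t x - z) = 0" by (simp add: \<T>_def)
    then have "(J ** N) *v (E t x - z) = 0" by (simp flip: matrix_vector_mul_assoc)
    then have "E t x = z" by (simp add: NJ)
    then have "\<xi> t z = x" using A by (intro \<xi>_eqI)
    then show "norm (\<xi> t z - \<xi> t0 z0) \<le> e" using x \<eta> by (simp add: x0_def dist_norm norm_minus_commute)
  qed
qed

lemma continuous_on_\<xi>: "continuous_on ({0..} \<times> S) (\<lambda>(t, z). \<xi> t z)"
  unfolding continuous_on_iff split_def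
proof (intro ballI allI impI)
  fix p0 :: "real \<times> (real^'n)" and e :: real assume A: "p0 \<in> {0..} \<times> S" "0 < e"
  obtain d where d: "d > 0" "\<And>t z. \<lbrakk>t \<ge> 0; z \<in> S; \<bar>t - fst p0\<bar> < d; norm (z - snd p0) < d\<rbrakk>
      \<Longrightarrow> norm (\<xi> t z - \<xi> (fst p0) (snd p0)) \<le> e/2"
    by (rule \<xi>_close[of "fst p0" "snd p0" "e/2"]) (use A in auto)
  have "dist (\<xi> (fst p) (snd p)) (\<xi> (fst p0) (snd p0)) < e" if p: "p \<in> {0..} \<times> S" "dist p p0 < d" for p
  proof -
    have "\<bar>fst p - fst p0\<bar> < d" "norm (snd p - snd p0) < d"
      using dist_fst_le[of p p0] dist_snd_le[of p p0] p(2) by (auto simp: dist_norm)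
    then have "norm (\<xi> (fst p) (snd p) - \<xi> (fst p0) (snd p0)) \<le> e/2" using d(2) p(1) by auto
    then show ?thesis using A by (simp add: dist_norm)
  qed
  then show "\<exists>d>0. \<forall>p\<in>{0..} \<times> S. dist p p0 < d \<longrightarrow>
      dist (\<xi> (fst p) (snd p)) (\<xi> (fst p0) (snd p0)) < e"
    using d(1) by blast
qed

text \<open>For close \<open>z, z'\<close> the linearization of \<open>E t\<close> at \<open>\<xi> t z'\<close> is invertible with a uniform bound;
  for distant ones boundedness of \<open>\<xi>\<close> on the compact cylinder is enough.\<close>
lemma \<xi>_Lipschitz:
  obtains L where "L \<ge> 0"
    "\<And>t z z'. \<lbrakk>0 \<le> t; t \<le> a; z \<in> S; z' \<in> S; norm z \<le> r; norm z' \<le> r\<rbrakk> \<Longrightarrow> norm (\<xi> t z - \<xi> t z') \<le> L * norm (z - z')"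
proof -
  define C where "C = {0..a} \<times> (S \<inter> cball 0 r)"
  have C: "compact C" unfolding C_def by (intro compact_Times closed_Int_compact S) auto
  have cont: "continuous_on C (\<lambda>(t, z). \<xi> t z)"
    by (rule continuous_on_subset[OF continuous_on_\<xi>]) (auto simp: C_def)
  have "bounded ((\<lambda>(t, z). \<xi> t z) ` C)"
    by (intro compact_imp_bounded compact_continuous_image cont C)
  then obtain b where b: "b > 0" "\<And>t z. (t, z) \<in> C \<Longrightarrow> norm (\<xi> t z) \<le> b"
    unfolding bounded_pos by force
  have "continuous_on C (\<lambda>p. jacobian (E (fst p)) (at (\<xi> (fst p) (snd p))))"
    using cont by (intro continuous_with_dx_compose[OF E] continuous_intros) (auto simp: C_def split_def)
  then obtain M where M: "M > 0" "\<And>p v. p \<in> C \<Longrightarrow> norm v \<le> M * norm (jacobian (E (fst p)) (at (\<xi> (fst p) (snd p))) *v v)"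
    by (rule compact_invertible_lower_bound[OF C]) (use nondeg E_\<xi> in \<open>auto simp: C_def\<close>)
  obtain \<delta> where \<delta>: "\<delta> > 0" and str: "\<And>t x y. \<lbrakk>0 \<le> t; t \<le> a; norm x \<le> b; norm (y - x) \<le> \<delta>\<rbrakk>
      \<Longrightarrow> norm (E t y - E t x - jacobian (E t) (at x) *v (y - x)) \<le> 1 / (2*M) * norm (y - x)"
    by (rule uniform_strict_derivative[OF E, of "1/(2*M)" a b]) (use M in auto)
  obtain \<eta> where \<eta>: "\<eta> > 0" "\<And>p q. p \<in> C \<Longrightarrow> q \<in> C \<Longrightarrow> dist q p < \<eta> \<Longrightarrow>
      dist ((\<lambda>(t, z). \<xi> t z) q) ((\<lambda>(t, z). \<xi> t z) p) < \<delta>"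
    using compact_uniformly_continuous[OF cont C] \<delta> unfolding uniformly_continuous_on_def by metis
  define L where "L = max (2*M) (2*b/\<eta>)"
  show ?thesis
  proof (rule that[of L])
    show "L \<ge> 0" using M by (auto simp: L_def)
    fix t z z' assume A: "0 \<le> t" "t \<le> a" "z \<in> S" "z' \<in> S" "norm z \<le> r" "norm z' \<le> r"
    then have inC: "(t, z) \<in> C" "(t, z') \<in> C" by (auto simp: C_def)
    show "norm (\<xi> t z - \<xi> t z') \<le> L * norm (z - z')"
    proof (cases "norm (z - z') < \<eta>")
      case True
      let ?x = "\<xi> t z'" and ?y = "\<xi> t z"
      let ?J = "jacobian (E t) (at ?x)"
      have near: "norm (?y - ?x) \<le> \<delta>"
        using \<eta>(2)[OF inC(2) inC(1)] True by (simp add: dist_Pair_Pair dist_norm)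
      have "norm (?y - ?x) \<le> M * norm (?J *v (?y - ?x))" using M(2)[OF inC(2)] by simp
      also have "\<dots> \<le> M * (norm (E t ?y - E t ?x) + 1/(2*M) * norm (?y - ?x))"
      proof (rule mult_left_mono)
        have "norm (?J *v (?y - ?x)) \<le> norm (E t ?y - E t ?x) + norm (E t ?y - E t ?x - ?J *v (?y - ?x))"
          by (metis norm_triangle_sub norm_minus_commute)
        then show "norm (?J *v (?y - ?x)) \<le> norm (E t ?y - E t ?x) + 1/(2*M) * norm (?y - ?x)"
          using str[OF A(1,2) b(2)[OF inC(2)] near] by linarith
      qed (use M in simp)
      also have "\<dots> = M * norm (z - z') + norm (?y - ?x) / 2"
        using M A by (simp add: E_\<xi> distrib_left)
      finally have "norm (?y - ?x) \<le> 2 * M * norm (z - z')" by simp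
      also have "\<dots> \<le> L * norm (z - z')" by (intro mult_right_mono) (auto simp: L_def)
      finally show ?thesis .
    next
      case False
      have "norm (\<xi> t z - \<xi> t z') \<le> 2*b" using b(2)[OF inC(1)] b(2)[OF inC(2)] norm_triangle_ineq4[of "\<xi> t z" "\<xi> t z'"] by linarith
      also have "\<dots> = 2*b/\<eta> * \<eta>" using \<eta> by simp
      also have "\<dots> \<le> L * norm (z - z')"
        using False \<eta> b M by (intro mult_mono) (auto simp: L_def)
      finally show ?thesis .
    qed
  qed
qed

text \<open>Only continuity of the Jacobian is used, so the factor in front of the old error is a fixed small
  number, here \<open>1/2\<close>, instead of the old error itself. The last term accounts for a right-hand side
  \<open>z\<close> that differs from the exact one, which is the situation in the numerical scheme.\<close>
lemma newton_step:
  assumes t0: "0 \<le> t0" and inv: "\<And>t x. t0 \<le> t \<Longrightarrow> t \<le> T \<Longrightarrow> invertible (jacobian (E t) (at x))"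
  obtains M \<delta> where "M > 0" "\<delta> > 0"
    "\<And>t x w z. \<lbrakk>t0 \<le> t; t \<le> T; norm x \<le> r; norm (w - x) \<le> \<delta>\<rbrakk> \<Longrightarrow>
      norm (w - matrix_inv (jacobian (E t) (at w)) *v (E t w - z) - x) \<le> 1/2 * norm (w - x) + M * norm (E t x - z)"
proof -
  let ?K = "{t0..T} \<times> cball (0::real^'n) (r+1)"
  have "continuous_on ?K (\<lambda>p. jacobian (E (fst p)) (at (snd p)))"
    using t0 by (intro continuous_with_dx_compose[OF E] continuous_intros) auto
  then obtain M where M: "M > 0" "\<And>p v. p \<in> ?K \<Longrightarrow> norm v \<le> M * norm (jacobian (E (fst p)) (at (snd p)) *v v)"
    by (rule compact_invertible_lower_bound[rotated]) (use inv in \<open>auto intro!: compact_Times\<close>)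
  obtain \<delta> where \<delta>: "\<delta> > 0" and str: "\<And>t x y. \<lbrakk>0 \<le> t; t \<le> T; norm x \<le> r + 1; norm (y - x) \<le> \<delta>\<rbrakk>
      \<Longrightarrow> norm (E t x - E t y - jacobian (E t) (at x) *v (x - y)) \<le> 1 / (2*M) * norm (x - y)"
    by (rule uniform_strict_derivative[OF E, of "1/(2*M)" T "r+1"]) (use M in auto)
  show ?thesis
  proof (rule that[of M "min 1 \<delta>"])
    show "M > 0" "min 1 \<delta> > 0" using M \<delta> by auto
    fix t :: real and x w z :: "real^'n" assume A: "t0 \<le> t" "t \<le> T" "norm x \<le> r" "norm (w - x) \<le> min 1 \<delta>"
    let ?J = "jacobian (E t) (at w)"
    let ?n = "w - matrix_inv ?J *v (E t w - z)"
    have w: "norm w \<le> r + 1" using A norm_triangle_sub[of w x] by auto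
    have inv_J: "?J ** matrix_inv ?J = mat 1"
      by (rule matrix_inv_right[OF inv[OF A(1,2)]])
    have "?J *v (?n - x) = ?J *v (w - x) - (?J ** matrix_inv ?J) *v (E t w - z)"
      by (simp add: matrix_vector_mult_diff_distrib matrix_vector_mul_assoc)
    also have "\<dots> = - (E t w - E t x - ?J *v (w - x)) - (E t x - z)"
      unfolding inv_J by simp
    finally have J: "norm (?J *v (?n - x)) \<le> norm (E t w - E t x - ?J *v (w - x)) + norm (E t x - z)"
      by (metis norm_minus_cancel norm_triangle_ineq4)
    have "norm (?n - x) \<le> M * norm (?J *v (?n - x))" using M(2)[of "(t, w)"] A w by simp
    also have "\<dots> \<le> M * (1/(2*M) * norm (w - x) + norm (E t x - z))"
      using J str[of t w x] A w t0 M by (intro mult_left_mono) (auto simp: norm_minus_commute)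
    also have "\<dots> = 1/2 * norm (w - x) + M * norm (E t x - z)" using M by (simp add: distrib_left)
    finally show "norm (?n - x) \<le> 1/2 * norm (w - x) + M * norm (E t x - z)" .
  qed
qed

end

section \<open>Ordinary differential equations in a subspace\<close>

text \<open>Weighting the supremum norm by \<open>exp (-2 M (t - a))\<close> makes the Picard operator a contraction on the
  whole interval at once. The functions are extended constantly beyond \<open>{a..b}\<close> so that they live in
  the complete space of bounded continuous functions.\<close>
lemma picard_lindelof_interval:
  fixes F :: "real \<Rightarrow> 'a::euclidean_space \<Rightarrow> 'a"
  assumes ab: "a \<le> b"
    and cont: "continuous_on ({a..b} \<times> UNIV) (\<lambda>(t, z). F t z)"
    and lip: "\<And>t z z'. t \<in> {a..b} \<Longrightarrow> norm (F t z - F t z') \<le> L * norm (z - z')"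
  obtains z where "z a = z0"
    "\<And>t. t \<in> {a..b} \<Longrightarrow> (z has_vector_derivative F t (z t)) (at t within {a..b})"
proof -
  define M where "M = max L 1"
  have M: "M > 0" by (simp add: M_def)
  have lipM: "norm (F t z - F t z') \<le> M * norm (z - z')" if "t \<in> {a..b}" for t z z'
    using lip[OF that, of z z'] by (rule order_trans) (auto intro!: mult_right_mono simp: M_def)
  define ex where "ex = (\<lambda>t. exp (2 * M * (t - a)))"
  have ex: "ex t > 0" "continuous_on A ex" for t A by (auto simp: ex_def intro!: continuous_intros)
  define cl where "cl = (\<lambda>t. max a (min b t))"
  have cl: "cl t \<in> {a..b}" "continuous_on A cl" for t A
    using ab by (auto simp: cl_def intro!: continuous_intros)
  define q where "q = (\<lambda>\<psi> t. (1 / ex t) *\<^sub>R (z0 + integral {a..t} (\<lambda>s. F s (ex s *\<^sub>R \<psi> s))))"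
  have Fcont: "continuous_on {a..b} (\<lambda>s. F s (y s))" if "continuous_on {a..b} y" for y
  proof -
    have c: "continuous_on {a..b} (\<lambda>s. (s, y s))" by (intro continuous_intros that)
    have i: "(\<lambda>s. (s, y s)) ` {a..b} \<subseteq> {a..b} \<times> UNIV" by auto
    show ?thesis using continuous_on_compose2[OF cont c i] by simp
  qed
  have Pcont: "continuous_on {a..b} (\<lambda>s. F s (ex s *\<^sub>R apply_bcontfun \<psi> s))" for \<psi>
    by (intro Fcont continuous_intros ex continuous_on_apply_bcontfun)
  have qcont: "continuous_on {a..b} (q (apply_bcontfun \<psi>))" for \<psi>
    unfolding q_def using ex(1)
    by (intro continuous_intros ex indefinite_integral_continuous_1 integrable_continuous_real Pcont)
      (auto simp: less_imp_neq[symmetric])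
  have qb: "(\<lambda>t. q (apply_bcontfun \<psi>) (cl t)) \<in> bcontfun" for \<psi>
  proof -
    have "continuous_on UNIV (\<lambda>t. q (apply_bcontfun \<psi>) (cl t))"
      by (rule continuous_on_compose2[OF qcont cl(2)]) (use cl(1) in auto)
    moreover have "bounded (q (apply_bcontfun \<psi>) ` {a..b})"
      by (intro compact_imp_bounded compact_continuous_image qcont) simp
    then have "bounded (range (\<lambda>t. q (apply_bcontfun \<psi>) (cl t)))"
      by (rule bounded_subset) (use cl in auto)
    ultimately show ?thesis by (simp add: bcontfun_def)
  qed
  define \<Q> where "\<Q> = (\<lambda>\<psi>. Bcontfun (\<lambda>t. q (apply_bcontfun \<psi>) (cl t)))"
  have \<Q>: "apply_bcontfun (\<Q> \<psi>) t = q (apply_bcontfun \<psi>) (cl t)" for \<psi> t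
    using qb by (simp add: \<Q>_def Bcontfun_inverse)
  have contr: "dist (\<Q> \<psi>) (\<Q> \<phi>) \<le> 1/2 * dist \<psi> \<phi>" for \<psi> \<phi>
  proof (rule dist_bound)
    fix t
    let ?u = "cl t" and ?d = "dist \<psi> \<phi>"
    let ?f = "\<lambda>\<psi> s. F s (ex s *\<^sub>R apply_bcontfun \<psi> s)"
    have sub: "{a..?u} \<subseteq> {a..b}" and au: "a \<le> ?u" using cl(1)[of t] by auto
    have int: "?f \<psi> integrable_on {a..?u}" for \<psi>
      by (intro integrable_continuous_real continuous_on_subset[OF Pcont sub])
    have "((\<lambda>s. M * ex s * ?d) has_integral (ex ?u * ?d / 2 - ex a * ?d / 2)) {a..?u}"
    proof (rule fundamental_theorem_of_calculus[OF au])
      fix s assume "s \<in> {a..?u}"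
      have "((\<lambda>s. ex s * ?d / 2) has_real_derivative M * ex s * ?d) (at s within {a..?u})"
        unfolding ex_def by (auto intro!: derivative_eq_intros)
      then show "((\<lambda>s. ex s * ?d / 2) has_vector_derivative M * ex s * ?d) (at s within {a..?u})"
        by (simp add: has_real_derivative_iff_has_vector_derivative)
    qed
    note bnd = this
    have "norm (integral {a..?u} (\<lambda>s. ?f \<psi> s - ?f \<phi> s)) \<le> integral {a..?u} (\<lambda>s. M * ex s * ?d)"
    proof (rule Henstock_Kurzweil_Integration.integral_norm_bound_integral)
      show "(\<lambda>s. ?f \<psi> s - ?f \<phi> s) integrable_on {a..?u}" by (intro integrable_diff int)
      show "(\<lambda>s. M * ex s * ?d) integrable_on {a..?u}" using bnd by blast
      fix s assume "s \<in> {a..?u}"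
      then have s: "s \<in> {a..b}" using sub by auto
      have "norm (?f \<psi> s - ?f \<phi> s) \<le> M * norm (ex s *\<^sub>R apply_bcontfun \<psi> s - ex s *\<^sub>R apply_bcontfun \<phi> s)"
        by (rule lipM[OF s])
      also have "\<dots> = M * ex s * dist (apply_bcontfun \<psi> s) (apply_bcontfun \<phi> s)"
        using ex(1)[of s] by (simp add: dist_norm flip: scaleR_diff_right)
      also have "\<dots> \<le> M * ex s * ?d"
        using M ex(1)[of s] dist_bounded[of \<psi> s \<phi>] by (intro mult_left_mono) auto
      finally show "norm (?f \<psi> s - ?f \<phi> s) \<le> M * ex s * ?d" .
    qed
    also have "\<dots> = ex ?u * ?d / 2 - ex a * ?d / 2" by (rule integral_unique[OF bnd])
    also have "\<dots> \<le> ex ?u * ?d / 2" using ex(1)[of a] by simp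
    finally have I: "norm (integral {a..?u} (\<lambda>s. ?f \<psi> s - ?f \<phi> s)) \<le> ex ?u * ?d / 2" .
    have "apply_bcontfun (\<Q> \<psi>) t - apply_bcontfun (\<Q> \<phi>) t =
        (1 / ex ?u) *\<^sub>R integral {a..?u} (\<lambda>s. ?f \<psi> s - ?f \<phi> s)"
      by (simp add: \<Q> q_def integral_diff int flip: scaleR_diff_right)
    then have "dist (apply_bcontfun (\<Q> \<psi>) t) (apply_bcontfun (\<Q> \<phi>) t) =
        norm (integral {a..?u} (\<lambda>s. ?f \<psi> s - ?f \<phi> s)) / ex ?u"
      using ex(1)[of ?u] by (simp add: dist_norm)
    also have "\<dots> \<le> (ex ?u * ?d / 2) / ex ?u" using I ex(1)[of ?u] by (intro divide_right_mono) auto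
    finally show "dist (apply_bcontfun (\<Q> \<psi>) t) (apply_bcontfun (\<Q> \<phi>) t) \<le> 1/2 * ?d"
      using ex(1)[of ?u] by simp
  qed
  have "\<exists>!\<psi>. \<Q> \<psi> = \<psi>" by (rule banach_fix_type[of "1/2"]) (use contr in auto)
  then obtain \<psi> where \<psi>: "\<Q> \<psi> = \<psi>" by blast
  define y where "y = (\<lambda>t. ex t *\<^sub>R apply_bcontfun \<psi> t)"
  define z where "z = (\<lambda>t. z0 + integral {a..t} (\<lambda>s. F s (y s)))"
  have zy: "z t = y t" if "t \<in> {a..b}" for t
  proof -
    have "apply_bcontfun \<psi> t = q (apply_bcontfun \<psi>) t"
      using \<Q>[of \<psi> t] that by (simp add: \<psi> cl_def)
    then show ?thesis using ex(1)[of t] by (simp add: y_def z_def q_def)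
  qed
  show ?thesis
  proof (rule that)
    show "z a = z0" by (simp add: z_def)
    fix t assume t: "t \<in> {a..b}"
    have "((\<lambda>u. integral {a..u} (\<lambda>s. F s (y s))) has_vector_derivative F t (y t)) (at t within {a..b})"
      using Pcont[of \<psi>] by (intro integral_has_vector_derivative t) (simp add: y_def)
    then show "(z has_vector_derivative F t (z t)) (at t within {a..b})"
      unfolding zy[OF t] unfolding z_def by (auto intro!: derivative_eq_intros)
  qed
qed

text \<open>The function \<open>exp (-2 L (t - a)) * norm (z1 t - z2 t) ^ 2\<close> is nonincreasing and starts at zero.\<close>
lemma gronwall_unique:
  fixes z1 z2 :: "real \<Rightarrow> 'a::real_inner"
  assumes z1: "\<And>t. t \<in> {a..b} \<Longrightarrow> (z1 has_vector_derivative D1 t) (at t within {a..b})"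
    and z2: "\<And>t. t \<in> {a..b} \<Longrightarrow> (z2 has_vector_derivative D2 t) (at t within {a..b})"
    and lip: "\<And>t. t \<in> {a..b} \<Longrightarrow> norm (D1 t - D2 t) \<le> L * norm (z1 t - z2 t)"
    and init: "z1 a = z2 a" and t: "t \<in> {a..b}"
  shows "z1 t = z2 t"
proof (cases "t = a")
  case False
  then have at: "a < t" using t by auto
  define w where "w = (\<lambda>t. z1 t - z2 t)"
  define \<phi> where "\<phi> = (\<lambda>t. exp (- (2 * L * (t - a))) * (w t \<bullet> w t))"
  define \<phi>' where "\<phi>' = (\<lambda>t. exp (- (2 * L * (t - a))) * (2 * (w t \<bullet> (D1 t - D2 t)) - 2 * L * (w t \<bullet> w t)))"
  have d: "(\<phi> has_derivative (\<lambda>h. h * \<phi>' s)) (at s within {a..t})" if s: "s \<in> {a..t}" for s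
  proof -
    have "(w has_vector_derivative (D1 s - D2 s)) (at s within {a..t})" unfolding w_def
      by (intro has_vector_derivative_diff has_vector_derivative_within_subset[OF z1]
          has_vector_derivative_within_subset[OF z2]) (use s t in auto)
    then have w: "(w has_derivative (\<lambda>h. h *\<^sub>R (D1 s - D2 s))) (at s within {a..t})"
      by (simp add: has_vector_derivative_def)
    show ?thesis unfolding \<phi>_def \<phi>'_def
      by (rule derivative_eq_intros w refl | simp)+
        (auto simp: algebra_simps inner_commute fun_eq_iff)
  qed
  obtain s where s: "s \<in> {a<..<t}" "\<phi> t - \<phi> a = (t - a) * \<phi>' s"
    using mvt_simple[OF at, of \<phi> "\<lambda>s h. h * \<phi>' s"] d by auto
  have "w s \<bullet> (D1 s - D2 s) \<le> norm (w s) * (L * norm (w s))"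
    using s t unfolding w_def
    by (intro order_trans[OF norm_cauchy_schwarz] mult_left_mono lip) auto
  also have "\<dots> = L * (w s \<bullet> w s)" by (simp add: dot_square_norm power2_eq_square)
  finally have "\<phi>' s \<le> 0" by (simp add: \<phi>'_def mult_le_0_iff)
  then have "(t - a) * \<phi>' s \<le> 0" using at by (simp add: mult_le_0_iff)
  then have "\<phi> t \<le> 0" using s init by (simp add: \<phi>_def w_def)
  then have "w t \<bullet> w t \<le> 0" by (simp add: \<phi>_def mult_le_0_iff)
  then have "w t \<bullet> w t = 0" using inner_ge_zero[of "w t"] by (rule antisym)
  then show ?thesis by (simp add: w_def)
qed (use init in simp)

lemma continuous_on_reciprocal:
  fixes U :: "real \<Rightarrow> real"
  assumes U: "continuous_on {0<..} U" "\<And>v. v > 0 \<Longrightarrow> U v > 0" and x: "x > 0"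
  shows "continuous_on {x..y} (\<lambda>v. 1 / U v)"
proof (rule continuous_on_divide)
  show "continuous_on {x..y} U" by (rule continuous_on_subset[OF U(1)]) (use x in auto)
  show "\<forall>v\<in>{x..y}. U v \<noteq> 0"
  proof
    fix v assume "v \<in> {x..y}"
    then have "U v > 0" using x by (intro U(2)) auto
    then show "U v \<noteq> 0" by simp
  qed
qed simp

text \<open>To climb from \<open>V0\<close> to \<open>V1\<close> the function \<open>V\<close> must pass through a time interval \<open>[s, r]\<close> on which it
  stays between these values: \<open>s\<close> is the last time at level \<open>V0\<close> and \<open>r\<close> the first time after \<open>s\<close>
  at level \<open>V1\<close>. There the primitive of \<open>1/U\<close>, evaluated along \<open>V\<close>, grows at most at rate \<open>K\<close>.
  The growth condition is thus needed only between the two levels, which is what makes the lemma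
  applicable to an equation that has been modified far away.\<close>
lemma osgood_bound:
  fixes V V' U :: "real \<Rightarrow> real"
  assumes dV: "\<And>t. t \<in> {a..b} \<Longrightarrow> (V has_real_derivative V' t) (at t within {a..b})"
    and U: "continuous_on {0<..} U" "\<And>v. v > 0 \<Longrightarrow> U v > 0"
    and V0: "0 < V0" "V a \<le> V0" "V0 \<le> V1" and K: "K \<ge> 0"
    and long: "K * (b - a) < integral {V0..V1} (\<lambda>v. 1 / U v)"
    and growth: "\<And>t. t \<in> {a..b} \<Longrightarrow> V0 \<le> V t \<Longrightarrow> V t \<le> V1 \<Longrightarrow> V' t \<le> K * U (V t)"
    and t: "t \<in> {a..b}"
  shows "V t < V1"
proof (rule ccontr)
  assume "\<not> V t < V1"
  then have Vt: "V t \<ge> V1" by simp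
  have cV: "continuous_on {a..b} V"
    unfolding continuous_on_eq_continuous_within using dV by (blast intro: DERIV_continuous)
  have cVt: "continuous_on A V" if "A \<subseteq> {a..t}" for A
    by (rule continuous_on_subset[OF cV]) (use that t in auto)
  have "V0 < V1"
  proof (rule ccontr)
    assume "\<not> V0 < V1"
    then have "V0 = V1" using V0 by simp
    then have "K * (b - a) < 0" using long by simp
    then show False using K t by (auto simp: mult_less_0_iff)
  qed
  have at: "a \<le> t" using t by simp
  have ivt: "\<exists>s. p \<le> s \<and> s \<le> q \<and> V s = y" if "V p \<le> y" "y \<le> V q" "a \<le> p" "p \<le> q" "q \<le> t" for p q y
    using that by (intro IVT' cVt) auto
  define A where "A = {s \<in> {a..t}. V s = V0}"
  have "compact A" unfolding A_def
    using continuous_closed_preimage_constant[OF cVt, of "{a..t}" V0]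
    by (auto simp: compact_eq_bounded_closed intro: bounded_subset[of "{a..t}"])
  moreover have "A \<noteq> {}" using ivt[of a V0 t] V0 Vt at by (auto simp: A_def)
  ultimately obtain s where s: "s \<in> A" "\<And>r. r \<in> A \<Longrightarrow> r \<le> s" using compact_attains_sup[of A] by blast
  have sV: "V s = V0" "a \<le> s" "s \<le> t" using s by (auto simp: A_def)
  define B where "B = {r \<in> {s..t}. V r = V1}"
  have "compact B" unfolding B_def
    using continuous_closed_preimage_constant[OF cVt, of "{s..t}" V1] sV
    by (auto simp: compact_eq_bounded_closed intro: bounded_subset[of "{s..t}"])
  moreover have "B \<noteq> {}" using ivt[of s V1 t] V0 Vt sV by (auto simp: B_def)
  ultimately obtain r where r: "r \<in> B" "\<And>r'. r' \<in> B \<Longrightarrow> r \<le> r'" using compact_attains_inf[of B] by blast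
  have rV: "V r = V1" "s \<le> r" "r \<le> t" using r by (auto simp: B_def)
  have sr: "s < r" using rV sV \<open>V0 < V1\<close> by (cases "s = r") auto
  have range: "V0 \<le> V u \<and> V u \<le> V1" if u: "u \<in> {s..r}" for u
  proof
    show "V0 \<le> V u"
    proof (rule ccontr)
      assume "\<not> V0 \<le> V u"
      then obtain u' where "u \<le> u'" "u' \<le> r" "V u' = V0" using ivt[of u V0 r] u sV rV V0 by auto
      then have "u' \<in> A" using u sV rV by (auto simp: A_def)
      with s(2) u \<open>u \<le> u'\<close> have "u = s" by force
      then show False using \<open>\<not> V0 \<le> V u\<close> sV by simp
    qed
    show "V u \<le> V1"
    proof (rule ccontr)
      assume "\<not> V u \<le> V1"
      then obtain u' where "s \<le> u'" "u' \<le> u" "V u' = V1" using ivt[of s V1 u] u sV rV V0 by auto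
      then have "u' \<in> B" using u sV rV by (auto simp: B_def)
      with r(2) u \<open>u' \<le> u\<close> have "u = r" by force
      then show False using \<open>\<not> V u \<le> V1\<close> rV by simp
    qed
  qed
  define \<Theta> where "\<Theta> = (\<lambda>v. integral {V0..v} (\<lambda>v. 1 / U v))"
  have cU: "continuous_on {V0..V1} (\<lambda>v. 1 / U v)"
    by (rule continuous_on_reciprocal[OF U V0(1)])
  define W where "W = (\<lambda>u. \<Theta> (V u) - K * u)"
  have dW: "(W has_derivative (\<lambda>h. h * (V' u / U (V u) - K))) (at u within {s..r})" if u: "u \<in> {s..r}" for u
  proof -
    have Vu: "V u \<in> {V0..V1}" using range[OF u] by simp
    have "(\<Theta> has_real_derivative 1 / U (V u)) (at (V u) within V ` {s..r})"
      unfolding \<Theta>_def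
      by (rule has_field_derivative_subset[OF integral_has_real_derivative[OF cU Vu]]) (use range in auto)
    moreover have "(V has_real_derivative V' u) (at u within {s..r})"
      by (rule has_field_derivative_subset[OF dV]) (use u sV rV t in auto)
    ultimately have "((\<Theta> \<circ> V) has_real_derivative 1 / U (V u) * V' u) (at u within {s..r})"
      by (rule DERIV_image_chain)
    then have "(W has_real_derivative V' u / U (V u) - K) (at u within {s..r})"
      unfolding W_def o_def by (auto intro!: derivative_eq_intros)
    then show ?thesis unfolding has_field_derivative_def
      by (rule has_derivative_eq_rhs) (auto simp: fun_eq_iff)
  qed
  obtain u where u: "u \<in> {s<..<r}" "W r - W s = (r - s) * (V' u / U (V u) - K)"
    using mvt_simple[OF sr, of W "\<lambda>u h. h * (V' u / U (V u) - K)"] dW by auto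
  have "V' u \<le> K * U (V u)" "U (V u) > 0"
    using growth[of u] range[of u] u sV rV t U(2)[of "V u"] V0 by auto
  then have "V' u / U (V u) - K \<le> 0" by (simp add: field_simps)
  then have "(r - s) * (V' u / U (V u) - K) \<le> 0" using sr by (simp add: mult_le_0_iff)
  then have "\<Theta> V1 \<le> K * (r - s)" using u(2) sV rV by (simp add: W_def \<Theta>_def algebra_simps)
  also have "\<dots> \<le> K * (b - a)" using K sV rV t by (intro mult_left_mono) auto
  finally show False using long by (simp add: \<Theta>_def)
qed

text \<open>The component orthogonal to the subspace has zero derivative.\<close>
lemma derivative_in_subspace:
  fixes z :: "real \<Rightarrow> 'a::euclidean_space"
  assumes S: "subspace S" and z: "\<And>t. t \<in> {a..b} \<Longrightarrow> (z has_vector_derivative D t) (at t within {a..b})"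
    and D: "\<And>t. t \<in> {a..b} \<Longrightarrow> D t \<in> S" and init: "z a \<in> S" and t: "t \<in> {a..b}"
  shows "z t \<in> S"
proof -
  have sp: "span S = S" using S by (simp add: span_eq_iff)
  obtain p q where p: "p \<in> S" and q: "\<And>w. w \<in> S \<Longrightarrow> q \<bullet> w = 0" and zt: "z t = p + q"
    by (rule orthogonal_subspace_decomp_exists[of S "z t", unfolded sp orthogonal_def]) blast
  have "((\<lambda>s. q \<bullet> z s) has_vector_derivative 0) (at s within {a..b})" if s: "s \<in> {a..b}" for s
    using bounded_linear.has_vector_derivative[OF bounded_linear_inner_right z[OF s], of q] q[OF D[OF s]] by simp
  then obtain c where c: "\<And>s. s \<in> {a..b} \<Longrightarrow> q \<bullet> z s = c"
    by (rule has_vector_derivative_zero_constant[rotated]) auto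
  have "q \<bullet> z t = q \<bullet> z a" using c t by simp
  then have "q \<bullet> q = 0" using q init p by (simp add: zt inner_add_right)
  then show ?thesis using p zt by simp
qed

lemma subspace_solution_unique:
  fixes F :: "real \<Rightarrow> 'a::euclidean_space \<Rightarrow> 'a"
  assumes lip: "\<And>r. \<exists>L. \<forall>t\<in>{a..b}. \<forall>z\<in>S. \<forall>z'\<in>S. norm z \<le> r \<longrightarrow> norm z' \<le> r \<longrightarrow>
        norm (F t z - F t z') \<le> L * norm (z - z')"
    and z1: "\<And>t. t \<in> {a..b} \<Longrightarrow> (z1 has_vector_derivative F t (z1 t)) (at t within {a..b})"
    and z2: "\<And>t. t \<in> {a..b} \<Longrightarrow> (z2 has_vector_derivative F t (z2 t)) (at t within {a..b})"
    and S: "\<And>t. t \<in> {a..b} \<Longrightarrow> z1 t \<in> S" "\<And>t. t \<in> {a..b} \<Longrightarrow> z2 t \<in> S"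
    and init: "z1 a = z2 a" and t: "t \<in> {a..b}"
  shows "z1 t = z2 t"
proof -
  have "continuous_on {a..b} z1" "continuous_on {a..b} z2"
    by (rule continuous_on_vector_derivative, fact)+
  then have "bounded (z1 ` {a..b})" "bounded (z2 ` {a..b})"
    by (auto intro!: compact_imp_bounded compact_continuous_image)
  then have "bounded (z1 ` {a..b} \<union> z2 ` {a..b})" by simp
  then obtain r where "\<forall>x \<in> z1 ` {a..b} \<union> z2 ` {a..b}. norm x \<le> r"
    unfolding bounded_iff by blast
  then have r: "norm (z1 s) \<le> r \<and> norm (z2 s) \<le> r" if "s \<in> {a..b}" for s
    using that by auto
  obtain L where L: "\<forall>t\<in>{a..b}. \<forall>z\<in>S. \<forall>z'\<in>S. norm z \<le> r \<longrightarrow> norm z' \<le> r \<longrightarrow>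
        norm (F t z - F t z') \<le> L * norm (z - z')" using lip by blast
  show ?thesis
    by (rule gronwall_unique[OF z1 z2 _ init t, of L]) (use L r S in auto)
qed

text \<open>The hypothesis \<open>confined\<close> is an a priori bound for curves that solve the equation only while they
  stay in the ball of radius \<open>\<rho>\<close>. Composing \<open>F t\<close> with the nearest-point projection onto
  \<open>S \<inter> cball 0 \<rho>\<close>, which is nonexpansive and the identity on that set, yields a globally Lipschitz
  equation; its solution is confined and therefore solves the original equation. The solutions on
  the intervals \<open>{t0..b}\<close> agree by uniqueness and are glued.\<close>
lemma global_solution_in_subspace:
  fixes F :: "real \<Rightarrow> 'a::euclidean_space \<Rightarrow> 'a"
  assumes S: "subspace S" and z0: "z0 \<in> S"
    and cont: "continuous_on ({t0..} \<times> S) (\<lambda>(t, z). F t z)"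
    and FS: "\<And>t z. t \<ge> t0 \<Longrightarrow> z \<in> S \<Longrightarrow> F t z \<in> S"
    and lip: "\<And>b r. \<exists>L. \<forall>t\<in>{t0..b}. \<forall>z\<in>S. \<forall>z'\<in>S. norm z \<le> r \<longrightarrow> norm z' \<le> r \<longrightarrow>
        norm (F t z - F t z') \<le> L * norm (z - z')"
    and confined: "\<And>b. b > t0 \<Longrightarrow> \<exists>\<rho>\<ge>0. \<forall>z D. z t0 = z0 \<longrightarrow>
        (\<forall>t\<in>{t0..b}. z t \<in> S \<and> D t \<in> S \<and> (z has_vector_derivative D t) (at t within {t0..b}) \<and>
            (norm (z t) \<le> \<rho> \<longrightarrow> D t = F t (z t))) \<longrightarrow>
        (\<forall>t\<in>{t0..b}. norm (z t) \<le> \<rho>)"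
  obtains z where "z t0 = z0" "\<And>t. t \<ge> t0 \<Longrightarrow> z t \<in> S"
    "\<And>t. t \<ge> t0 \<Longrightarrow> (z has_vector_derivative F t (z t)) (at t within {t0..})"
proof -
  have local: "\<exists>z. z t0 = z0 \<and> (\<forall>t\<in>{t0..b}. z t \<in> S \<and> (z has_vector_derivative F t (z t)) (at t within {t0..b}))"
    if b: "b > t0" for b
  proof -
    obtain \<rho> where \<rho>: "\<rho> \<ge> 0" and conf: "\<forall>z D. z t0 = z0 \<longrightarrow>
        (\<forall>t\<in>{t0..b}. z t \<in> S \<and> D t \<in> S \<and> (z has_vector_derivative D t) (at t within {t0..b}) \<and>
            (norm (z t) \<le> \<rho> \<longrightarrow> D t = F t (z t))) \<longrightarrow> (\<forall>t\<in>{t0..b}. norm (z t) \<le> \<rho>)"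
      using confined[OF b] by (elim exE conjE)
    define C where "C = S \<inter> cball 0 \<rho>"
    have C: "convex C" "closed C" "C \<noteq> {}"
    proof -
      show "convex C" unfolding C_def by (rule convex_Int[OF subspace_imp_convex[OF S] convex_cball])
      show "closed C" unfolding C_def by (rule closed_Int[OF closed_subspace[OF S] closed_cball])
      show "C \<noteq> {}" using \<rho> subspace_0[OF S] by (auto simp: C_def)
    qed
    define cp where "cp = closest_point C"
    have cpC: "cp z \<in> S" "norm (cp z) \<le> \<rho>" for z
      using closest_point_in_set[OF C(2,3), of z] by (auto simp: cp_def C_def)
    have cp_self: "cp z = z" if "z \<in> S" "norm z \<le> \<rho>" for z
      using that by (simp add: cp_def closest_point_self C_def)
    obtain L where L: "\<And>t z z'. t \<in> {t0..b} \<Longrightarrow> z \<in> S \<Longrightarrow> z' \<in> S \<Longrightarrow> norm z \<le> \<rho> \<Longrightarrow> norm z' \<le> \<rho> \<Longrightarrow>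
        norm (F t z - F t z') \<le> L * norm (z - z')" using lip[of b \<rho>] by blast
    obtain z where z: "z t0 = z0"
      "\<And>t. t \<in> {t0..b} \<Longrightarrow> (z has_vector_derivative F t (cp (z t))) (at t within {t0..b})"
    proof (rule picard_lindelof_interval[of t0 b "\<lambda>t z. F t (cp z)" "max L 0" z0])
      have "continuous_on ({t0..b} \<times> UNIV) (\<lambda>p. (fst p, cp (snd p)))" unfolding cp_def
        by (intro continuous_intros continuous_on_compose2[OF continuous_on_closest_point[OF C]]) auto
      moreover have "(\<lambda>p. (fst p, cp (snd p))) ` ({t0..b} \<times> UNIV) \<subseteq> {t0..} \<times> S" using cpC by auto
      ultimately show "continuous_on ({t0..b} \<times> UNIV) (\<lambda>(t, z). F t (cp z))"
        using continuous_on_compose2[OF cont] by (fastforce simp: split_def)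
      fix t z z' assume t: "t \<in> {t0..b}"
      have "norm (F t (cp z) - F t (cp z')) \<le> L * norm (cp z - cp z')" by (intro L t cpC)
      also have "\<dots> \<le> max L 0 * norm (z - z')"
        using closest_point_lipschitz[OF C, of z z'] by (intro mult_mono) (auto simp: cp_def dist_norm)
      finally show "norm (F t (cp z) - F t (cp z')) \<le> max L 0 * norm (z - z')" .
    qed (use b in auto)
    have DS: "F t (cp (z t)) \<in> S" if "t \<in> {t0..b}" for t using that by (intro FS cpC) auto
    have zS: "z t \<in> S" if "t \<in> {t0..b}" for t
      by (rule derivative_in_subspace[OF S z(2) DS _ that]) (use z z0 in auto)
    have "\<forall>t\<in>{t0..b}. norm (z t) \<le> \<rho>"
      by (rule conf[rule_format, of z "\<lambda>t. F t (cp (z t))", THEN ballI]) (use z zS DS cp_self in auto)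
    then show ?thesis using z zS cp_self by (intro exI[of _ z]) auto
  qed
  define is_sol where "is_sol b z \<longleftrightarrow> z t0 = z0 \<and> (\<forall>t\<in>{t0..b}. z t \<in> S \<and>
      (z has_vector_derivative F t (z t)) (at t within {t0..b}))" for b z
  define sol where "sol = (\<lambda>b. SOME z. is_sol b z)"
  have is_sol: "is_sol b (sol b)" if "b > t0" for b
    unfolding sol_def using local[OF that] unfolding is_sol_def[symmetric] by (rule someI_ex)
  have sol: "sol b t0 = z0" "\<And>t. t \<in> {t0..b} \<Longrightarrow> sol b t \<in> S"
    "\<And>t. t \<in> {t0..b} \<Longrightarrow> (sol b has_vector_derivative F t (sol b t)) (at t within {t0..b})"
    if "b > t0" for b
    using is_sol[OF that] unfolding is_sol_def by blast+
  have agree: "sol b t = sol b' t" if b: "t0 < b" "b \<le> b'" and t: "t \<in> {t0..b}" for b b' t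
  proof (rule subspace_solution_unique[OF lip _ _ _ _ _ t])
    have b': "t0 < b'" using b by simp
    show "sol b t0 = sol b' t0" by (simp only: sol(1)[OF b(1)] sol(1)[OF b'])
    fix s assume s: "s \<in> {t0..b}"
    then have s': "s \<in> {t0..b'}" using b by auto
    show "(sol b has_vector_derivative F s (sol b s)) (at s within {t0..b})" by (rule sol(3)[OF b(1) s])
    show "(sol b' has_vector_derivative F s (sol b' s)) (at s within {t0..b})"
      by (rule has_vector_derivative_within_subset[OF sol(3)[OF b' s']]) (use b in auto)
    show "sol b s \<in> S" by (rule sol(2)[OF b(1) s])
    show "sol b' s \<in> S" by (rule sol(2)[OF b' s'])
  qed
  define z where "z = (\<lambda>t. sol (t + 1) t)"
  have zsol: "z t = sol b t" if "t0 < b" "t \<in> {t0..b}" for b t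
  proof (cases "b \<le> t + 1")
    case True
    show ?thesis unfolding z_def by (rule agree[OF that(1) True that(2), symmetric])
  next
    case False
    show ?thesis unfolding z_def by (rule agree) (use False that in auto)
  qed
  show ?thesis
  proof (rule that[of z])
    show "z t0 = z0" unfolding z_def by (rule sol(1)) simp
    fix t assume t: "t \<ge> t0"
    show "z t \<in> S" using sol(2)[of "t+1" t] t by (simp add: z_def)
    have "(sol (t+1) has_vector_derivative F t (z t)) (at t within {t0..t+1})"
      using sol(3)[of "t+1" t] t by (simp add: z_def)
    then have "(z has_vector_derivative F t (z t)) (at t within {t0..t+1})"
      by (rule has_vector_derivative_transform[rotated 2]) (use t in \<open>auto intro!: zsol\<close>)
    moreover have "at t within {t0..t+1} = at t within {t0..}"
      by (rule at_within_nhd[of _ "{..<t+1}"]) auto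
    ultimately show "(z has_vector_derivative F t (z t)) (at t within {t0..})" by simp
  qed
qed

lemma positive_selfadjoint_coercive:
  fixes H :: "real^'n^'n"
  assumes S: "subspace S" and H: "positive_selfadjoint_on S H"
  obtains m where "m > 0" "\<And>z. z \<in> S \<Longrightarrow> m * (norm z)\<^sup>2 \<le> (H *v z) \<bullet> z"
proof (cases "S \<inter> sphere 0 1 = {}")
  case True
  have triv: "z = 0" if "z \<in> S" for z
  proof (rule ccontr)
    assume "z \<noteq> 0"
    then have "(1 / norm z) *\<^sub>R z \<in> S \<inter> sphere 0 1" using that S by (auto simp: subspace_scale)
    then show False using True by blast
  qed
  show ?thesis
  proof (rule that[of 1])
    show "1 * (norm z)\<^sup>2 \<le> (H *v z) \<bullet> z" if "z \<in> S" for z using triv[OF that] by simp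
  qed simp
next
  case False
  have "compact (S \<inter> sphere 0 1)" by (intro closed_Int_compact closed_subspace S compact_sphere)
  moreover have "continuous_on (S \<inter> sphere 0 1) (\<lambda>z. (H *v z) \<bullet> z)" by (intro continuous_intros)
  ultimately obtain z0 where z0': "z0 \<in> S \<inter> sphere 0 1"
    and min': "\<forall>z \<in> S \<inter> sphere 0 1. (H *v z0) \<bullet> z0 \<le> (H *v z) \<bullet> z"
    using continuous_attains_inf[of "S \<inter> sphere 0 1" "\<lambda>z. (H *v z) \<bullet> z"] False by blast
  have z0: "z0 \<in> S" "norm z0 = 1" using z0' by auto
  have min: "(H *v z0) \<bullet> z0 \<le> (H *v z) \<bullet> z" if "z \<in> S" "norm z = 1" for z
    using min' that by auto
  show ?thesis
  proof (rule that[of "(H *v z0) \<bullet> z0"])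
    show "(H *v z0) \<bullet> z0 > 0" using H z0 by (auto simp: positive_selfadjoint_on_def)
    fix z assume z: "z \<in> S"
    show "(H *v z0) \<bullet> z0 * (norm z)\<^sup>2 \<le> (H *v z) \<bullet> z"
    proof (cases "z = 0")
      case False
      then have "(H *v z0) \<bullet> z0 \<le> (H *v ((1 / norm z) *\<^sub>R z)) \<bullet> ((1 / norm z) *\<^sub>R z)"
        by (intro min) (use z S in \<open>auto simp: subspace_scale\<close>)
      also have "\<dots> = (H *v z) \<bullet> z / (norm z)\<^sup>2"
        by (simp add: matrix_vector_mult_scaleR power2_eq_square)
      finally show ?thesis using False by (simp add: field_simps)
    qed simp
  qed
qed

text \<open>The level \<open>V0\<close> exceeds the energy of all vectors of norm at most \<open>R\<close>, so above it the growth condition is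
  in force; \<open>V1\<close> is a level that cannot be reached from \<open>V0\<close> in time \<open>b - t0\<close>, and \<open>\<rho>\<close> is the
  radius of a ball containing all vectors of energy at most \<open>V1\<close>.\<close>
lemma energy_confinement:
  fixes F :: "real \<Rightarrow> real^'n \<Rightarrow> real^'n" and H :: "real^'n^'n"
  assumes S: "subspace S" and H: "positive_selfadjoint_on S H" and z0: "z0 \<in> S" and b: "b > t0"
    and U: "continuous_on {0<..} U" "\<And>v. v > 0 \<Longrightarrow> U v > 0"
    and c: "c > 0" "filterlim (\<lambda>b. integral {c..b} (\<lambda>v. 1 / U v)) at_top at_top"
    and K: "K \<ge> 0" and R: "R > 0"
    and growth: "\<And>t z. t \<in> {t0..b} \<Longrightarrow> z \<in> S \<Longrightarrow> norm z \<ge> R \<Longrightarrow>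
        (H *v z) \<bullet> F t z \<le> K * U (((H *v z) \<bullet> z) / 2)"
  shows "\<exists>\<rho>\<ge>0. \<forall>z D. z t0 = z0 \<longrightarrow>
        (\<forall>t\<in>{t0..b}. z t \<in> S \<and> D t \<in> S \<and> (z has_vector_derivative D t) (at t within {t0..b}) \<and>
            (norm (z t) \<le> \<rho> \<longrightarrow> D t = F t (z t))) \<longrightarrow>
        (\<forall>t\<in>{t0..b}. norm (z t) \<le> \<rho>)"
proof -
  define V where "V = (\<lambda>z. ((H *v z) \<bullet> z) / 2)"
  obtain m where m: "m > 0" "\<And>z. z \<in> S \<Longrightarrow> m * (norm z)\<^sup>2 \<le> (H *v z) \<bullet> z"
    by (rule positive_selfadjoint_coercive[OF S H]) blast
  have "continuous_on (cball 0 R) V" unfolding V_def by (intro continuous_intros) auto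
  then have "bounded (V ` cball 0 R)" by (intro compact_imp_bounded compact_continuous_image) auto
  then obtain vR where "\<forall>y \<in> V ` cball 0 R. norm y \<le> vR" unfolding bounded_iff by blast
  then have vR: "V z \<le> vR" if "norm z \<le> R" for z using that by (auto simp: abs_le_iff)
  define V0 where "V0 = Max {c, V z0, vR + 1}"
  have V0: "V0 \<ge> c" "V0 \<ge> V z0" "V0 > vR" "V0 > 0" using c by (auto simp: V0_def less_max_iff_disj)
  have cU: "(\<lambda>v. 1 / U v) integrable_on {x..y}" if "x > 0" for x y
    by (rule integrable_continuous_real[OF continuous_on_reciprocal[OF U that]])
  have "eventually (\<lambda>x. integral {c..x} (\<lambda>v. 1 / U v) > K * (b - t0) + integral {c..V0} (\<lambda>v. 1 / U v)) at_top"
    using c(2) by (simp add: filterlim_at_top_dense)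
  then obtain x0 where x0: "\<forall>x\<ge>x0. integral {c..x} (\<lambda>v. 1 / U v) > K * (b - t0) + integral {c..V0} (\<lambda>v. 1 / U v)"
    unfolding eventually_at_top_linorder by blast
  define V1 where "V1 = max x0 V0"
  have V1: "V1 \<ge> V0" "integral {c..V1} (\<lambda>v. 1 / U v) > K * (b - t0) + integral {c..V0} (\<lambda>v. 1 / U v)"
    using x0 by (auto simp: V1_def)
  have long: "K * (b - t0) < integral {V0..V1} (\<lambda>v. 1 / U v)"
    using V1 Henstock_Kurzweil_Integration.integral_combine[of c V0 V1 "\<lambda>v. 1 / U v"] V0 cU[OF c(1)] by simp
  define \<rho> where "\<rho> = sqrt (2 * V1 / m)"
  have bound: "norm z \<le> \<rho>" if "z \<in> S" "V z \<le> V1" for z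
    unfolding \<rho>_def using m(2)[OF that(1)] that(2) m(1)
    by (intro real_le_rsqrt) (simp add: V_def field_simps)
  show ?thesis
  proof (intro exI[of _ \<rho>] conjI allI impI)
    show "\<rho> \<ge> 0" using V1 V0 m by (simp add: \<rho>_def)
    fix z D
    assume init: "z t0 = z0" and z: "\<forall>t\<in>{t0..b}. z t \<in> S \<and> D t \<in> S \<and>
        (z has_vector_derivative D t) (at t within {t0..b}) \<and> (norm (z t) \<le> \<rho> \<longrightarrow> D t = F t (z t))"
    have dV: "((\<lambda>t. V (z t)) has_real_derivative (H *v z t) \<bullet> D t) (at t within {t0..b})" if t: "t \<in> {t0..b}" for t
    proof -
      have zt: "(z has_derivative (\<lambda>h. h *\<^sub>R D t)) (at t within {t0..b})"
        using z t by (simp add: has_vector_derivative_def)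
      have Hz: "((\<lambda>t. H *v z t) has_derivative (\<lambda>h. H *v (h *\<^sub>R D t))) (at t within {t0..b})"
        by (rule bounded_linear.has_derivative[OF matrix_vector_mul_bounded_linear zt])
      have "((\<lambda>t. V (z t)) has_derivative (\<lambda>h. ((H *v z t) \<bullet> (h *\<^sub>R D t) + (H *v (h *\<^sub>R D t)) \<bullet> z t) / 2)) (at t within {t0..b})"
        unfolding V_def by (auto intro!: derivative_eq_intros zt Hz)
      moreover have "(H *v D t) \<bullet> z t = (H *v z t) \<bullet> D t"
        using H z t by (simp add: positive_selfadjoint_on_def inner_commute)
      ultimately have "((\<lambda>t. V (z t)) has_derivative (\<lambda>h. h * ((H *v z t) \<bullet> D t))) (at t within {t0..b})"
        by (simp add: matrix_vector_mult_scaleR flip: mult_2)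
      then show ?thesis unfolding has_field_derivative_def
        by (rule has_derivative_eq_rhs) (auto simp: fun_eq_iff)
    qed
    show "\<forall>t\<in>{t0..b}. norm (z t) \<le> \<rho>"
    proof
      fix t assume t: "t \<in> {t0..b}"
      have "V (z t) < V1"
      proof (rule osgood_bound[OF dV U _ _ V1(1) K long _ t])
        show "0 < V0" "V (z t0) \<le> V0" using V0 init by auto
        fix s assume s: "s \<in> {t0..b}" "V0 \<le> V (z s)" "V (z s) \<le> V1"
        have "norm (z s) \<ge> R" using vR[of "z s"] s V0 by linarith
        then show "(H *v z s) \<bullet> D s \<le> K * U (V (z s))"
          using growth[OF s(1), of "z s"] z s bound[of "z s"] by (auto simp: V_def)
      qed
      then show "norm (z t) \<le> \<rho>" using bound z t by auto
    qed
  qed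
qed

text \<open>A dissipative part plus a part of linear growth makes the energy grow at most exponentially: this is the
  Osgood condition with \<open>U(v) = v\<close>.\<close>
lemma quadratic_confinement:
  fixes F :: "real \<Rightarrow> real^'n \<Rightarrow> real^'n" and H :: "real^'n^'n"
  assumes S: "subspace S" and H: "positive_selfadjoint_on S H" and z0: "z0 \<in> S" and b: "b > t0"
    and R: "R > 0" and c: "c \<ge> 0"
    and split: "\<And>t z. t \<in> {t0..b} \<Longrightarrow> z \<in> S \<Longrightarrow> norm z \<ge> R \<Longrightarrow>
        \<exists>p y. F t z = p + y \<and> (H *v z) \<bullet> p \<le> 0 \<and> norm y \<le> c * norm z"
  shows "\<exists>\<rho>\<ge>0. \<forall>z D. z t0 = z0 \<longrightarrow>
        (\<forall>t\<in>{t0..b}. z t \<in> S \<and> D t \<in> S \<and> (z has_vector_derivative D t) (at t within {t0..b}) \<and>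
            (norm (z t) \<le> \<rho> \<longrightarrow> D t = F t (z t))) \<longrightarrow>
        (\<forall>t\<in>{t0..b}. norm (z t) \<le> \<rho>)"
proof -
  obtain m where m: "m > 0" "\<And>z. z \<in> S \<Longrightarrow> m * (norm z)\<^sup>2 \<le> (H *v z) \<bullet> z"
    by (rule positive_selfadjoint_coercive[OF S H]) blast
  obtain k where k: "k > 0" "\<And>v. norm (H *v v) \<le> k * norm v" by (rule matrix_norm_bound[of H]) blast
  show ?thesis
  proof (rule energy_confinement[OF S H z0 b, of "\<lambda>v. v" 1 "2 * k * c / m" R])
    have "integral {1..x} (\<lambda>v. 1 / v) = ln x" if "x \<ge> 1" for x :: real
    proof (rule integral_unique)
      have "((\<lambda>v. 1 / v) has_integral (ln x - ln 1)) {1..x}"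
        by (rule fundamental_theorem_of_calculus[OF that])
          (auto intro!: derivative_eq_intros simp: has_real_derivative_iff_has_vector_derivative[symmetric] divide_inverse)
      then show "((\<lambda>v. 1 / v) has_integral ln x) {1..x}" by simp
    qed
    then have ev: "eventually (\<lambda>x::real. ln x = integral {1..x} (\<lambda>v. 1 / v)) at_top"
      unfolding eventually_at_top_linorder by (intro exI[of _ 1]) auto
    show "filterlim (\<lambda>b. integral {1..b} (\<lambda>v. 1 / v)) at_top (at_top :: real filter)"
      by (rule iffD1[OF filterlim_cong[OF refl refl ev] ln_at_top])
    show "2 * k * c / m \<ge> 0" using k c m by simp
    fix t z assume tz: "t \<in> {t0..b}" "z \<in> S" "norm z \<ge> R"
    obtain p y where py: "F t z = p + y" "(H *v z) \<bullet> p \<le> 0" "norm y \<le> c * norm z"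
      using split[OF tz] by blast
    have "(H *v z) \<bullet> F t z \<le> (H *v z) \<bullet> y" using py by (simp add: inner_add_right)
    also have "\<dots> \<le> norm (H *v z) * norm y" by (rule norm_cauchy_schwarz)
    also have "\<dots> \<le> (k * norm z) * (c * norm z)" using k c py by (intro mult_mono) auto
    also have "\<dots> = k * c / m * (m * (norm z)\<^sup>2)" using m by (simp add: power2_eq_square)
    also have "\<dots> \<le> k * c / m * ((H *v z) \<bullet> z)" using m k c tz by (intro mult_left_mono) auto
    finally show "(H *v z) \<bullet> F t z \<le> 2 * k * c / m * (((H *v z) \<bullet> z) / 2)" by simp
  qed (use R in \<open>auto intro!: continuous_intros\<close>)
qed

section \<open>Error propagation of the Euler-Newton scheme\<close>

text \<open>Here \<open>a\<close> and \<open>b\<close> stand for the errors in the differential and in the full variable, and \<open>\<omega>\<close> for the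
  local inaccuracy. With \<open>s i\<close> the growing majorant of the Euler recursion, the invariant is
  \<open>a i \<le> s i\<close> and \<open>b i \<le> 4 D s i + 2 \<omega>\<close>: halving in each step absorbs the accumulated Newton error, so
  that \<open>b\<close> is slaved to \<open>a\<close>. The one-step estimates are available only within distance \<open>\<delta>\<close> of the exact
  solution; the smallness assumptions keep the invariant inside this range.\<close>
lemma euler_newton_error_recursion:
  fixes a b :: "nat \<Rightarrow> real"
  assumes nonneg: "h \<ge> 0" "L \<ge> 0" "D \<ge> 0" "\<omega> \<ge> 0"
    and init: "a 0 = 0" "b 0 = 0"
    and step_a: "\<And>i. i < N \<Longrightarrow> b i \<le> \<delta> \<Longrightarrow> a (Suc i) \<le> a i + h * L * b i + h * \<omega>"
    and step_b: "\<And>i. i < N \<Longrightarrow> a i \<le> \<delta> \<Longrightarrow> b i \<le> \<delta> \<Longrightarrow> a (Suc i) \<le> \<delta> \<Longrightarrow>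
        b (Suc i) \<le> b i / 2 + D * (a i + a (Suc i)) + \<omega>"
    and \<kappa>: "\<kappa> = (2 * L + 1) * (real N * h) * exp (4 * L * D * (real N * h))"
    and small: "\<kappa> * \<omega> \<le> \<delta>" "(4 * D * \<kappa> + 2) * \<omega> \<le> \<delta>"
    and i: "i \<le> N"
  shows "a i \<le> \<kappa> * \<omega>" and "b i \<le> (4 * D * \<kappa> + 2) * \<omega>"
proof -
  define s where "s = (\<lambda>i. (2 * L + 1) * \<omega> * (real i * h) * exp (4 * L * D * (real i * h)))"
  have s\<kappa>: "s i \<le> \<kappa> * \<omega>" if "i \<le> N" for i
  proof -
    have ih: "real i * h \<le> real N * h" using that nonneg by (intro mult_right_mono) auto
    have "s i \<le> (2 * L + 1) * \<omega> * (real N * h) * exp (4 * L * D * (real N * h))"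
      unfolding s_def using nonneg
      by (intro mult_mono[OF mult_left_mono[OF ih]] iffD2[OF exp_le_cancel_iff] mult_left_mono[OF ih]) auto
    then show ?thesis by (simp add: \<kappa> mult_ac)
  qed
  have sb: "4 * D * s i + 2 * \<omega> \<le> (4 * D * \<kappa> + 2) * \<omega>" if "i \<le> N" for i
    using mult_left_mono[OF s\<kappa>[OF that], of "4 * D"] nonneg by (simp add: algebra_simps)
  have grow: "s i * (1 + 4 * L * D * h) + h * (2 * L + 1) * \<omega> \<le> s (Suc i)" for i
  proof -
    define X where "X = exp (4 * L * D * (real i * h))"
    define y where "y = 4 * L * D * h"
    have X: "X \<ge> 1" and y: "y \<ge> 0" unfolding X_def y_def using nonneg by auto
    have ey: "1 + y \<le> exp y" by (rule exp_ge_add_one_self)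
    have S: "s (Suc i) = (2 * L + 1) * \<omega> * (real i * h) * X * exp y + (2 * L + 1) * \<omega> * h * (X * exp y)"
      unfolding s_def X_def y_def by (simp add: algebra_simps exp_add[symmetric])
    have "s i * (1 + y) \<le> (2 * L + 1) * \<omega> * (real i * h) * X * exp y"
      unfolding s_def X_def[symmetric] using nonneg X ey by (intro mult_left_mono) auto
    moreover have "1 \<le> X * exp y" using X ey y mult_mono[of 1 X 1 "exp y"] by simp
    then have "(2 * L + 1) * \<omega> * h * 1 \<le> (2 * L + 1) * \<omega> * h * (X * exp y)"
      using nonneg by (intro mult_left_mono) auto
    ultimately show ?thesis unfolding S y_def by (simp add: algebra_simps)
  qed
  have "a i \<le> s i \<and> b i \<le> 4 * D * s i + 2 * \<omega>" using i
  proof (induction i)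
    case 0
    then show ?case using init nonneg by (simp add: s_def)
  next
    case (Suc i)
    then have IH: "a i \<le> s i" "b i \<le> 4 * D * s i + 2 * \<omega>" and iN: "i < N" "i \<le> N" by auto
    have ai: "a i \<le> \<delta>" using IH(1) s\<kappa>[OF iN(2)] small(1) by linarith
    have bi: "b i \<le> \<delta>" using IH(2) sb[OF iN(2)] small(2) by linarith
    have "a (Suc i) \<le> a i + h * L * b i + h * \<omega>" by (rule step_a[OF iN(1) bi])
    also have "\<dots> \<le> s i + h * L * (4 * D * s i + 2 * \<omega>) + h * \<omega>"
      using IH nonneg by (intro add_mono mult_left_mono) auto
    also have "\<dots> = s i * (1 + 4 * L * D * h) + h * (2 * L + 1) * \<omega>" by (simp add: algebra_simps)
    also have "\<dots> \<le> s (Suc i)" by (rule grow)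
    finally have aS: "a (Suc i) \<le> s (Suc i)" .
    have ss: "s i \<le> s (Suc i)"
    proof -
      have "s i \<ge> 0" using nonneg by (simp add: s_def)
      then have "s i * 1 + 0 \<le> s i * (1 + 4 * L * D * h) + h * (2 * L + 1) * \<omega>"
        using nonneg by (intro add_mono mult_left_mono) auto
      then show ?thesis using grow[of i] by simp
    qed
    have aS\<delta>: "a (Suc i) \<le> \<delta>" using aS s\<kappa>[OF Suc.prems] small(1) by linarith
    have "b (Suc i) \<le> b i / 2 + D * (a i + a (Suc i)) + \<omega>" by (rule step_b[OF iN(1) ai bi aS\<delta>])
    also have "\<dots> \<le> (4 * D * s (Suc i) + 2 * \<omega>) / 2 + D * (s (Suc i) + s (Suc i)) + \<omega>"
      using IH aS ss nonneg mult_left_mono[OF ss, of "4 * D"]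
      by (intro add_mono mult_left_mono divide_right_mono) auto
    also have "\<dots> = 4 * D * s (Suc i) + 2 * \<omega>" by (simp add: algebra_simps)
    finally show ?case using aS by simp
  qed
  then show "a i \<le> \<kappa> * \<omega>" "b i \<le> (4 * D * \<kappa> + 2) * \<omega>" using s\<kappa>[OF i] sb[OF i] by auto
qed

locale semi_explicit_dae = unique_level_points E S for E :: "real \<Rightarrow> real^'n \<Rightarrow> real^'n" and S +
  fixes \<Phi> :: "real \<Rightarrow> real^'n \<Rightarrow> real^'n"
  assumes \<Phi>: "continuous_with_dx \<Phi>"
begin

text \<open>The quantity \<open>\<omega>\<close> is chosen first, small enough for the bounds of the recursion to stay below
  \<open>min \<delta> e\<close>; the step size is then taken so small that the solution and its derivative vary by at most
  \<open>\<omega>\<close> over one step. The point \<open>w\<close> differs from the exact solution at the new time by at most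
  \<open>3 \<delta> + 2 \<omega> \<le> 5 \<delta>\<close>, whence the choice of \<open>\<delta>\<close>.\<close>
lemma euler_newton_converges:
  fixes z :: "real \<Rightarrow> real^'n" and zs xs :: "nat \<Rightarrow> nat \<Rightarrow> real^'n" and t0 T :: real
  defines "h \<equiv> \<lambda>N. (T - t0) / real N"
  defines "\<tau> \<equiv> \<lambda>N i. t0 + real i * h N"
  assumes t0: "0 \<le> t0" "t0 < T"
    and inv: "\<And>t x. t0 \<le> t \<Longrightarrow> t \<le> T \<Longrightarrow> invertible (jacobian (E t) (at x))"
    and zS: "\<And>t. t \<in> {t0..T} \<Longrightarrow> z t \<in> S"
    and ode: "\<And>t. t \<in> {t0..T} \<Longrightarrow> (z has_vector_derivative \<Phi> t (\<xi> t (z t))) (at t within {t0..T})"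
    and init: "\<And>N. zs N 0 = z t0" "\<And>N. xs N 0 = \<xi> t0 (z t0)"
    and euler: "\<And>N i. i < N \<Longrightarrow> zs N (Suc i) = zs N i + h N *\<^sub>R \<Phi> (\<tau> N i) (xs N i)"
    and newton: "\<And>N i. i < N \<Longrightarrow> xs N (Suc i) =
        (let w = xs N i + (zs N (Suc i) - zs N i); t = \<tau> N (Suc i)
         in w - matrix_inv (jacobian (E t) (at w)) *v (E t w - zs N (Suc i)))"
    and e: "e > 0"
  obtains N0 where "\<And>N i. N \<ge> N0 \<Longrightarrow> i \<le> N \<Longrightarrow> norm (z (\<tau> N i) - zs N i) \<le> e"
    "\<And>N i. N \<ge> N0 \<Longrightarrow> i \<le> N \<Longrightarrow> norm (\<xi> (\<tau> N i) (z (\<tau> N i)) - xs N i) \<le> e"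
proof -
  define x where "x = (\<lambda>t. \<xi> t (z t))"
  define d where "d = (\<lambda>t. \<Phi> t (x t))"
  have cz: "continuous_on {t0..T} z"
    by (rule continuous_on_vector_derivative[OF ode])
  have cx: "continuous_on {t0..T} x"
  proof -
    have c: "continuous_on {t0..T} (\<lambda>t. (t, z t))" by (intro continuous_intros cz)
    have i: "(\<lambda>t. (t, z t)) ` {t0..T} \<subseteq> {0..} \<times> S" using zS t0 by auto
    show ?thesis using continuous_on_compose2[OF continuous_on_\<xi> c i] by (simp add: x_def)
  qed
  have cd: "continuous_on {t0..T} d"
    unfolding d_def by (rule continuous_with_dx_compose[OF \<Phi> cx]) (use t0 in \<open>auto intro!: continuous_intros\<close>)
  have "bounded (x ` {t0..T})" by (intro compact_imp_bounded compact_continuous_image cx) auto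
  then obtain r where "\<forall>y\<in>x ` {t0..T}. norm y \<le> r" unfolding bounded_iff by blast
  then have r: "norm (x t) \<le> r" if "t \<in> {t0..T}" for t using that by auto
  obtain L where L: "L \<ge> 0" "\<And>t x y. \<lbrakk>0 \<le> t; t \<le> T; norm x \<le> r + 1; norm y \<le> r + 1\<rbrakk> \<Longrightarrow> norm (\<Phi> t x - \<Phi> t y) \<le> L * norm (x - y)"
    by (rule continuous_with_dx_Lipschitz[OF \<Phi>, of T "r + 1"]) blast
  obtain M \<delta>0 where M: "M > 0" "\<delta>0 > 0" and nt:
    "\<forall>t x w z. t0 \<le> t \<longrightarrow> t \<le> T \<longrightarrow> norm x \<le> r \<longrightarrow> norm (w - x) \<le> \<delta>0 \<longrightarrow>
      norm (w - matrix_inv (jacobian (E t) (at w)) *v (E t w - z) - x) \<le> 1/2 * norm (w - x) + M * norm (E t x - z)"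
  proof (rule newton_step[OF t0(1) inv, of T r])
    fix M \<delta>0 :: real
    assume "M > 0" "\<delta>0 > 0" and "\<And>t x w z. \<lbrakk>t0 \<le> t; t \<le> T; norm x \<le> r; norm (w - x) \<le> \<delta>0\<rbrakk> \<Longrightarrow>
      norm (w - matrix_inv (jacobian (E t) (at w)) *v (E t w - z) - x) \<le> 1/2 * norm (w - x) + M * norm (E t x - z)"
    then show thesis by (intro that[of M \<delta>0] allI impI)
  qed
  define \<delta> where "\<delta> = min 1 (\<delta>0 / 5)"
  have \<delta>: "\<delta> > 0" "\<delta> \<le> 1" "5 * \<delta> \<le> \<delta>0" using M by (auto simp: \<delta>_def)
  define D where "D = M + 1/2"
  define \<kappa> where "\<kappa> = (2 * L + 1) * (T - t0) * exp (4 * L * D * (T - t0))"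
  have D: "D \<ge> 0" and \<kappa>: "\<kappa> \<ge> 0" using M L t0 by (auto simp: D_def \<kappa>_def)
  define \<omega> where "\<omega> = min \<delta> e / (\<kappa> + 4 * D * \<kappa> + 2)"
  have den: "\<kappa> + 4 * D * \<kappa> + 2 > 0" using D \<kappa> by (simp add: add_nonneg_pos)
  have \<omega>: "\<omega> > 0" using \<delta> e den by (simp add: \<omega>_def)
  have tot: "(\<kappa> + 4 * D * \<kappa> + 2) * \<omega> = min \<delta> e" using den by (simp add: \<omega>_def)
  have b1: "\<kappa> * \<omega> \<le> min \<delta> e"
    unfolding tot[symmetric] using D \<kappa> \<omega> by (intro mult_right_mono) auto
  have b2: "(4 * D * \<kappa> + 2) * \<omega> \<le> min \<delta> e"
    unfolding tot[symmetric] using D \<kappa> \<omega> by (intro mult_right_mono) auto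
  have b3: "2 * \<omega> \<le> \<delta>" 
  proof -
    have "2 * \<omega> \<le> (4 * D * \<kappa> + 2) * \<omega>" using D \<kappa> \<omega> by (intro mult_right_mono) auto
    then show ?thesis using b2 by auto
  qed
  have "uniformly_continuous_on {t0..T} (\<lambda>t. (x t, z t, d t))"
    by (intro compact_uniformly_continuous continuous_intros cx cz cd) auto
  then obtain \<eta> where \<eta>: "\<eta> > 0" "\<forall>s\<in>{t0..T}. \<forall>t\<in>{t0..T}. dist t s < \<eta> \<longrightarrow> dist (x t, z t, d t) (x s, z s, d s) < \<omega>"
    unfolding uniformly_continuous_on_def using \<omega> by blast
  have close: "norm (x t - x s) \<le> \<omega>" "norm (z t - z s) \<le> \<omega>" "norm (d t - d s) \<le> \<omega>"
    if "s \<in> {t0..T}" "t \<in> {t0..T}" "\<bar>t - s\<bar> < \<eta>" for s t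
  proof -
    have "dist (x t, z t, d t) (x s, z s, d s) \<le> \<omega>" using \<eta>(2) that by (auto simp: dist_norm intro: less_imp_le)
    then show "norm (x t - x s) \<le> \<omega>" "norm (z t - z s) \<le> \<omega>" "norm (d t - d s) \<le> \<omega>"
      using dist_fst_le[of "(x t, z t, d t)" "(x s, z s, d s)"] dist_snd_le[of "(x t, z t, d t)" "(x s, z s, d s)"]
        dist_fst_le[of "(z t, d t)" "(z s, d s)"] dist_snd_le[of "(z t, d t)" "(z s, d s)"]
      by (auto simp: dist_norm)
  qed
  obtain N0 where N0: "real N0 > (T - t0) / \<eta>" using reals_Archimedean2 by blast
  have main: "norm (z (\<tau> N i) - zs N i) \<le> \<kappa> * \<omega> \<and> norm (x (\<tau> N i) - xs N i) \<le> (4 * D * \<kappa> + 2) * \<omega>"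
    if N: "N \<ge> Suc N0" and i: "i \<le> N" for N i
  proof -
    have Npos: "real N > 0" using N by simp
    have h: "h N > 0" "real N * h N = T - t0" using t0 Npos by (auto simp: h_def)
    have h\<eta>: "h N < \<eta>"
    proof -
      have "(T - t0) / \<eta> < real N" using N0 N by linarith
      then show ?thesis using \<eta> Npos by (simp add: h_def field_simps)
    qed
    have \<tau>: "\<tau> N j \<in> {t0..T}" if "j \<le> N" for j
    proof -
      have "real j * h N \<le> real N * h N" using that h by (intro mult_right_mono) auto
      then show ?thesis using h by (auto simp: \<tau>_def)
    qed
    have \<tau>S: "\<tau> N (Suc j) = \<tau> N j + h N" for j by (simp add: \<tau>_def algebra_simps)
    define a where "a = (\<lambda>j. norm (z (\<tau> N j) - zs N j))"
    define b where "b = (\<lambda>j. norm (x (\<tau> N j) - xs N j))"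
    have init0: "a 0 = 0" "b 0 = 0" by (auto simp: a_def b_def \<tau>_def init x_def)
    have step_a: "a (Suc j) \<le> a j + h N * L * b j + h N * \<omega>" if j: "j < N" and bj: "b j \<le> \<delta>" for j
    proof -
      let ?s = "\<tau> N j" and ?t = "\<tau> N (Suc j)"
      have st: "?s \<in> {t0..T}" "?t \<in> {t0..T}" using \<tau>[of j] \<tau>[of "Suc j"] j by auto
      have consist: "norm (z ?t - ?t *\<^sub>R d ?s - (z ?s - ?s *\<^sub>R d ?s)) \<le> \<omega> * norm (?t - ?s)"
      proof (rule differentiable_bound[of "{?s..?t}"])
        fix u assume u: "u \<in> {?s..?t}"
        then have uT: "u \<in> {t0..T}" using st by auto
        have "(z has_vector_derivative d u) (at u within {?s..?t})"
          unfolding d_def x_def by (rule has_vector_derivative_within_subset[OF ode[OF uT]]) (use st in auto)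
        then have zd: "(z has_derivative (\<lambda>k. k *\<^sub>R d u)) (at u within {?s..?t})"
          by (simp add: has_vector_derivative_def)
        show "((\<lambda>u. z u - u *\<^sub>R d ?s) has_derivative (\<lambda>k. k *\<^sub>R (d u - d ?s))) (at u within {?s..?t})"
          by (rule has_derivative_eq_rhs, (rule derivative_intros zd)+) (auto simp: scaleR_diff_right)
        have "norm (d u - d ?s) \<le> \<omega>" using u st uT h\<eta> \<tau>S[of j] by (intro close) auto
        then have "\<bar>k\<bar> * norm (d u - d ?s) \<le> \<omega> * \<bar>k\<bar>" for k
          by (metis abs_ge_zero mult.commute mult_left_mono)
        then show "onorm (\<lambda>k. k *\<^sub>R (d u - d ?s)) \<le> \<omega>" by (intro onorm_le) simp
      qed (use \<tau>S[of j] h in auto)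
      have lip: "norm (d ?s - \<Phi> ?s (xs N j)) \<le> L * b j"
        unfolding d_def b_def
      proof (rule L(2))
        show "norm (x ?s) \<le> r + 1" using r[OF st(1)] by simp
        have "norm (xs N j) \<le> norm (x ?s) + norm (x ?s - xs N j)"
          by (metis norm_minus_commute norm_triangle_sub)
        then show "norm (xs N j) \<le> r + 1" using r[OF st(1)] bj \<delta> by (simp add: b_def)
      qed (use st t0 in auto)
      have "z ?t - zs N (Suc j) = (z ?t - ?t *\<^sub>R d ?s - (z ?s - ?s *\<^sub>R d ?s)) + (z ?s - zs N j)
          + h N *\<^sub>R (d ?s - \<Phi> ?s (xs N j))"
        unfolding euler[OF j] \<tau>S by (simp add: algebra_simps)
      then have "a (Suc j) \<le> norm (z ?t - ?t *\<^sub>R d ?s - (z ?s - ?s *\<^sub>R d ?s)) + a j + norm (h N *\<^sub>R (d ?s - \<Phi> ?s (xs N j)))"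
        unfolding a_def by (metis norm_triangle_le norm_triangle_ineq add_right_mono)
      also have "\<dots> \<le> \<omega> * h N + a j + h N * (L * b j)"
        using consist lip h(1) \<tau>S[of j] by (intro add_mono) (auto intro: mult_left_mono)
      finally show ?thesis by (simp add: algebra_simps)
    qed
    have step_b: "b (Suc j) \<le> b j / 2 + D * (a j + a (Suc j)) + \<omega>"
      if j: "j < N" and aj: "a j \<le> \<delta>" and bj: "b j \<le> \<delta>" and aj': "a (Suc j) \<le> \<delta>" for j
    proof -
      let ?s = "\<tau> N j" and ?t = "\<tau> N (Suc j)"
      have st: "?s \<in> {t0..T}" "?t \<in> {t0..T}" using \<tau>[of j] \<tau>[of "Suc j"] j by auto
      have "\<bar>?t - ?s\<bar> < \<eta>" using h\<eta> h(1) \<tau>S[of j] by auto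
      note cl = close[OF st this]
      define w where "w = xs N j + (zs N (Suc j) - zs N j)"
      have "w - x ?t = - (x ?s - xs N j) - (x ?t - x ?s) - (z ?t - zs N (Suc j)) + (z ?t - z ?s) + (z ?s - zs N j)"
        by (simp add: w_def)
      also have "norm \<dots> \<le> norm (x ?s - xs N j) + norm (x ?t - x ?s) + norm (z ?t - zs N (Suc j)) + norm (z ?t - z ?s) + norm (z ?s - zs N j)"
      proof -
        have "norm (- p - q - u + v + y) \<le> norm p + norm q + norm u + norm v + norm y" for p q u v y :: "real^'n"
          using norm_triangle_ineq[of "- p - q - u + v" y] norm_triangle_ineq[of "- p - q - u" v]
            norm_triangle_ineq4[of "- p - q" u] norm_triangle_ineq4[of "- p" q] by simp
        then show ?thesis by blast
      qed
      also have "\<dots> \<le> b j + \<omega> + a (Suc j) + \<omega> + a j"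
        unfolding a_def b_def using cl by (intro add_mono) auto
      finally have wx: "norm (w - x ?t) \<le> b j + \<omega> + a (Suc j) + \<omega> + a j" .
      have Ex: "E ?t (x ?t) = z ?t" unfolding x_def using st t0 zS by (intro E_\<xi>) auto
      have "b (Suc j) = norm (w - matrix_inv (jacobian (E ?t) (at w)) *v (E ?t w - zs N (Suc j)) - x ?t)"
        unfolding b_def newton[OF j] Let_def w_def[symmetric] by (simp add: norm_minus_commute)
      also have "\<dots> \<le> 1/2 * norm (w - x ?t) + M * norm (E ?t (x ?t) - zs N (Suc j))"
        using st r[OF st(2)] wx b3 aj bj aj' \<delta> by (intro nt[rule_format]) auto
      also have "\<dots> \<le> 1/2 * (b j + \<omega> + a (Suc j) + \<omega> + a j) + M * a (Suc j)"
        unfolding Ex using wx by (simp add: a_def)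
      also have "\<dots> \<le> b j / 2 + D * (a j + a (Suc j)) + \<omega>"
      proof -
        have "0 \<le> M * a j" using M by (simp add: a_def)
        then show ?thesis by (simp add: D_def algebra_simps add_divide_distrib)
      qed
      finally show ?thesis .
    qed
    show ?thesis
      using euler_newton_error_recursion[of "h N" L D \<omega> a b N \<delta> \<kappa> i, OF _ L(1) D _ init0 step_a step_b _ _ _ i]
        h \<omega> b1 b2 by (simp add: a_def b_def \<kappa>_def)
  qed
  show ?thesis
    by (rule that[of "Suc N0"]) (use main b1 b2 in \<open>fastforce simp: x_def\<close>)+
qed

end

section \<open>Basis invertibility\<close>

lemma invertible_between_zero:
  assumes "invertible_between W Z M" "w \<in> W" "M *v w = 0"
  shows "w = 0"
  using assms unfolding invertible_between_def by (metis matrix_vector_mult_0_right)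

lemma dim_one_span:
  fixes V :: "'a::euclidean_space set"
  assumes "dim V = 1"
  obtains e where "V \<subseteq> span {e}"
proof -
  obtain B where B: "V \<subseteq> span B" "card B = dim V" by (rule basis_exists[of V])
  then have "card B = 1" using assms by simp
  then obtain e where "B = {e}" by (rule card_1_singletonE)
  then show ?thesis using that B(1) by blast
qed

lemma matrix_sum_vector_mult:
  fixes M :: "'k \<Rightarrow> real^'n^'m"
  shows "(\<Sum>k\<in>K. M k) *v x = (\<Sum>k\<in>K. M k *v x)"
  by (induction K rule: infinite_finite_induct) (auto simp: matrix_vector_mult_add_rdistrib)

text \<open>The mean value theorem fails for vector-valued maps, but it holds for each component
  \<open>\<Theta> k *v \<Psi>\<close>, which takes values in a line: there is a point \<open>p k\<close> on the segment at which the
  derivative of this component in the direction \<open>w - v\<close> vanishes. The points for different \<open>k\<close> are unrelated,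
  and basis invertibility allows exactly this freedom.\<close>
lemma basis_invertible_injective:
  fixes \<Psi> :: "real^'n \<Rightarrow> real^'m" and \<Psi>' \<Phi> :: "real^'n \<Rightarrow> real^'n^'m"
  assumes bi: "basis_invertible W Z \<Phi> v w" and W: "subspace W" "v \<in> W" "w \<in> W"
    and deriv: "\<And>y. (\<Psi> has_derivative (\<lambda>h. \<Psi>' y *v h)) (at y)"
    and \<Phi>: "\<And>y. \<Phi> y *v (w - v) = \<Psi>' y *v (w - v)" "\<And>y. \<Phi> y *v (w - v) \<in> Z"
    and eq: "\<Psi> v = \<Psi> w"
  shows "v = w"
proof -
  obtain \<Theta> where \<Theta>: "additive_resolution Z \<Theta>"
    and inv: "\<And>p. (\<forall>k\<in>{1..dim Z}. p k \<in> closed_segment v w) \<Longrightarrow>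
           invertible_between W Z (\<Sum>k\<in>{1..dim Z}. \<Theta> k ** \<Phi> (p k))"
    using bi unfolding basis_invertible_def by blast
  have "\<exists>p. p \<in> closed_segment v w \<and> \<Theta> k *v (\<Phi> p *v (w - v)) = 0" if k: "k \<in> {1..dim Z}" for k
  proof -
    obtain e where e: "(*v) (\<Theta> k) ` Z \<subseteq> span {e}"
      using dim_one_span[of "(*v) (\<Theta> k) ` Z"] \<Theta> k unfolding additive_resolution_def by metis
    define \<gamma> where "\<gamma> = (\<lambda>s::real. v + s *\<^sub>R (w - v))"
    define q where "q = (\<lambda>s. e \<bullet> (\<Theta> k *v \<Psi> (\<gamma> s)))"
    define q' where "q' = (\<lambda>s. e \<bullet> (\<Theta> k *v (\<Psi>' (\<gamma> s) *v (w - v))))"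
    have dq: "(q has_derivative (\<lambda>h. h * q' s)) (at s within {0..1})" for s
    proof -
      have d\<gamma>: "(\<gamma> has_derivative (\<lambda>h. h *\<^sub>R (w - v))) (at s within {0..1})"
        unfolding \<gamma>_def by (auto intro!: derivative_eq_intros)
      have "((\<lambda>s. \<Psi> (\<gamma> s)) has_derivative (\<lambda>h. \<Psi>' (\<gamma> s) *v (h *\<^sub>R (w - v)))) (at s within {0..1})"
        by (rule has_derivative_compose[OF d\<gamma> deriv])
      then have "((\<lambda>s. e \<bullet> (\<Theta> k *v \<Psi> (\<gamma> s))) has_derivative
          (\<lambda>h. e \<bullet> (\<Theta> k *v (\<Psi>' (\<gamma> s) *v (h *\<^sub>R (w - v)))))) (at s within {0..1})"
        by (intro bounded_linear.has_derivative[OF bounded_linear_inner_right]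
            bounded_linear.has_derivative[OF matrix_vector_mul_bounded_linear])
      then show ?thesis by (simp add: q_def q'_def matrix_vector_mult_scaleR)
    qed
    obtain s where s: "s \<in> {0<..<1}" "q 1 - q 0 = q' s"
      using mvt_simple[of 0 1 q "\<lambda>s h. h * q' s"] dq by auto
    have "q 1 = q 0" using eq by (simp add: q_def \<gamma>_def)
    then have z: "e \<bullet> (\<Theta> k *v (\<Phi> (\<gamma> s) *v (w - v))) = 0" using s by (simp add: q'_def \<Phi>(1))
    have "\<Theta> k *v (\<Phi> (\<gamma> s) *v (w - v)) \<in> span {e}" using e \<Phi>(2) by blast
    then obtain c where c: "\<Theta> k *v (\<Phi> (\<gamma> s) *v (w - v)) = c *\<^sub>R e" by (auto simp: span_singleton)
    with z have "\<Theta> k *v (\<Phi> (\<gamma> s) *v (w - v)) = 0" by auto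
    moreover have "\<gamma> s \<in> closed_segment v w"
      using s unfolding in_segment \<gamma>_def by (intro exI[of _ s]) (auto simp: algebra_simps)
    ultimately show ?thesis by blast
  qed
  then obtain p where p: "\<And>k. k \<in> {1..dim Z} \<Longrightarrow> p k \<in> closed_segment v w"
    "\<And>k. k \<in> {1..dim Z} \<Longrightarrow> \<Theta> k *v (\<Phi> (p k) *v (w - v)) = 0" by metis
  have "(\<Sum>k\<in>{1..dim Z}. \<Theta> k ** \<Phi> (p k)) *v (w - v) = 0"
    using p(2) by (simp add: matrix_sum_vector_mult flip: matrix_vector_mul_assoc)
  then have "w - v = 0"
    by (intro invertible_between_zero[OF inv]) (use p W in \<open>auto intro: subspace_diff\<close>)
  then show ?thesis by simp
qed

text \<open>On a degenerate segment the only choice of points gives \<open>\<Phi> v\<close> itself.\<close>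
lemma basis_invertible_point:
  assumes bi: "basis_invertible W Z \<Phi> v v" and h: "h \<in> W" "\<Phi> v *v h = 0"
  shows "h = 0"
proof -
  obtain \<Theta> where inv: "\<And>p. (\<forall>k\<in>{1..dim Z}. p k \<in> closed_segment v v) \<Longrightarrow>
           invertible_between W Z (\<Sum>k\<in>{1..dim Z}. \<Theta> k ** \<Phi> (p k))"
    using bi unfolding basis_invertible_def by blast
  have "(\<Sum>k\<in>{1..dim Z}. \<Theta> k ** \<Phi> v) *v h = 0"
    using h by (simp add: matrix_sum_vector_mult flip: matrix_vector_mul_assoc)
  then show ?thesis by (intro invertible_between_zero[OF inv[of "\<lambda>_. v"]] h) auto
qed

section \<open>Splitting the differential-algebraic equation\<close>

lemma matrix_vector_mult_minus_left:
  fixes M :: "real^'n^'m"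
  shows "(- M) *v x = - (M *v x)"
  by (simp add: matrix_vector_mult_def vec_eq_iff sum_negf)

text \<open>The locale parameters \<open>P\<close>, \<open>Q\<close> are the projectors \<open>P\<^sub>1\<close>, \<open>Q\<^sub>1\<close>.\<close>
locale dae_splitting =
  fixes A B P Q G :: "real^'n^'n" and f :: "real \<Rightarrow> real^'n \<Rightarrow> real^'n"
  assumes PP: "P ** P = P" and QQ: "Q ** Q = Q" and AP: "A ** P = A" and QA: "Q ** A = A"
    and BP: "B ** P = Q ** B" and invG: "invertible G" and G: "G = A + B ** (mat 1 - P)"
    and GP: "G ** P = A" and QG: "Q ** G = A" and f: "continuous_with_dx f"
begin

abbreviation "P' \<equiv> mat 1 - P"
abbreviation "Q' \<equiv> mat 1 - Q"
abbreviation "Gi \<equiv> matrix_inv G"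

lemma P_P [simp]: "P *v (P *v x) = P *v x" by (simp add: matrix_vector_mul_assoc PP)
lemma Q_Q [simp]: "Q *v (Q *v x) = Q *v x" by (simp add: matrix_vector_mul_assoc QQ)
lemma A_P [simp]: "A *v (P *v x) = A *v x" by (simp add: matrix_vector_mul_assoc AP)
lemma Q_A [simp]: "Q *v (A *v x) = A *v x" by (simp add: matrix_vector_mul_assoc QA)
lemma Q_B: "Q *v (B *v x) = B *v (P *v x)" by (simp add: matrix_vector_mul_assoc BP)
lemma P'_eq: "P' *v x = x - P *v x" by (simp add: matrix_vector_mult_diff_rdistrib)
lemma Q'_eq: "Q' *v x = x - Q *v x" by (simp add: matrix_vector_mult_diff_rdistrib)
lemma G_Gi [simp]: "G *v (Gi *v x) = x" by (simp add: matrix_vector_mul_assoc matrix_inv_right[OF invG])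
lemma Gi_G [simp]: "Gi *v (G *v x) = x" by (simp add: matrix_vector_mul_assoc matrix_inv_left[OF invG])
lemma G_P: "G *v (P *v x) = A *v x" by (simp add: matrix_vector_mul_assoc GP)
lemma Gi_A [simp]: "Gi *v (A *v x) = P *v x" by (metis G_P Gi_G)
lemma A_Gi [simp]: "A *v (Gi *v x) = Q *v x" by (metis QG G_Gi matrix_vector_mul_assoc)
lemma Gi_Q: "Gi *v (Q *v x) = P *v (Gi *v x)" by (metis A_Gi Gi_A)
lemma G_P': "G *v (P' *v x) = B *v (P' *v x)"
proof -
  have "A *v (P' *v x) = 0" "P' *v (P' *v x) = P' *v x"
    by (simp_all add: P'_eq matrix_vector_mult_diff_distrib)
  then show ?thesis by (simp add: G matrix_vector_mult_add_rdistrib flip: matrix_vector_mul_assoc)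
qed
lemma P_Gi_Q' [simp]: "P *v (Gi *v (Q' *v x)) = 0"
  by (simp add: Gi_Q[symmetric] Q'_eq matrix_vector_mult_diff_distrib)
lemma P'_fix_iff: "P' *v x = x \<longleftrightarrow> P *v x = 0" by (simp add: P'_eq)

lemma range_P: "x \<in> range ((*v) P) \<longleftrightarrow> P *v x = x" by (metis P_P rangeE rangeI)
lemma range_P': "x \<in> range ((*v) P') \<longleftrightarrow> P *v x = 0"
  by (auto simp: P'_eq matrix_vector_mult_diff_distrib image_iff intro!: exI[of _ x])
lemma range_Q': "x \<in> range ((*v) Q') \<longleftrightarrow> Q *v x = 0"
  by (auto simp: Q'_eq matrix_vector_mult_diff_distrib image_iff intro!: exI[of _ x])

text \<open>The map \<open>E t\<close> is defined on the whole space, not only on \<open>X\<^sub>2\<close>: the \<open>X\<^sub>1\<close> component of its argument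
  passes through unchanged. Constraint and splitting thus become the single equation \<open>E t x = z\<close>,
  and no coordinates on the subspaces are needed.\<close>
definition E :: "real \<Rightarrow> real^'n \<Rightarrow> real^'n" where "E t x = x - Gi *v (Q' *v f t x)"
definition \<Phi> :: "real \<Rightarrow> real^'n \<Rightarrow> real^'n" where "\<Phi> t x = Gi *v (Q *v (f t x - B *v x))"

lemma f_derivative: "t \<ge> 0 \<Longrightarrow> (f t has_derivative (\<lambda>v. jacobian (f t) (at x) *v v)) (at x)"
  by (rule continuous_with_dx_derivative[OF f])

lemma matrix_f_derivative:
  fixes M :: "real^'n^'n"
  assumes "t \<ge> 0"
  shows "((\<lambda>x. M *v f t x) has_derivative (\<lambda>v. (M ** jacobian (f t) (at x)) *v v)) (at x)"
  using bounded_linear.has_derivative[OF matrix_vector_mul_bounded_linear f_derivative[OF assms], of M x]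
  by (simp add: matrix_vector_mul_assoc)

lemma jacobian_matrix_f: "t \<ge> 0 \<Longrightarrow> jacobian (\<lambda>x. M *v f t x) (at x) = M ** jacobian (f t) (at x)"
  for M :: "real^'n^'n"
  by (rule jacobian_eqI[OF matrix_f_derivative])

lemma affine_in_f_dx:
  fixes M N :: "real^'n^'n"
  shows "t \<ge> 0 \<Longrightarrow> jacobian (\<lambda>x. N *v x + M *v f t x) (at x) = N + M ** jacobian (f t) (at x)"
    and "continuous_with_dx (\<lambda>t x. N *v x + M *v f t x)"
proof -
  have d: "((\<lambda>x. N *v x + M *v f t x) has_derivative (\<lambda>v. (N + M ** jacobian (f t) (at x)) *v v)) (at x)"
    if "t \<ge> 0" for t x
    using has_derivative_add[OF bounded_linear_imp_has_derivative[OF matrix_vector_mul_bounded_linear] matrix_f_derivative[OF that]]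
    by (simp add: matrix_vector_mult_add_rdistrib)
  then show j: "jacobian (\<lambda>x. N *v x + M *v f t x) (at x) = N + M ** jacobian (f t) (at x)" if "t \<ge> 0" for t x
    using that by (intro jacobian_eqI)
  have cf: "continuous_on ({0..} \<times> UNIV) (\<lambda>p. f (fst p) (snd p))"
    "continuous_on ({0..} \<times> UNIV) (\<lambda>p. jacobian (f (fst p)) (at (snd p)))"
    using f by (auto simp: continuous_with_dx_def split_def)
  show "continuous_with_dx (\<lambda>t x. N *v x + M *v f t x)"
    unfolding continuous_with_dx_def split_def
  proof (intro conjI allI impI)
    show "continuous_on ({0..} \<times> UNIV) (\<lambda>p. N *v snd p + M *v f (fst p) (snd p))"
      by (intro continuous_intros bounded_linear.continuous_on[OF matrix_vector_mul_bounded_linear] cf)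
    show "(\<lambda>x. N *v x + M *v f t x) differentiable at x" if "0 \<le> t" for t x
      by (rule jacobian_eqI(2)[OF d[OF that]])
    have "continuous_on ({0..} \<times> UNIV) (\<lambda>p. N + M ** jacobian (f (fst p)) (at (snd p)))"
      by (intro continuous_intros bounded_linear.continuous_on[OF bounded_linear_matrix_mult(1)] cf)
    then show "continuous_on ({0..} \<times> UNIV) (\<lambda>p. jacobian (\<lambda>x. N *v x + M *v f (fst p) x) (at (snd p)))"
      by (rule continuous_on_eq) (use j in auto)
  qed
qed

lemma E_alt: "E t x = mat 1 *v x + (- (Gi ** Q')) *v f t x"
  by (simp add: E_def matrix_vector_mul_assoc matrix_vector_mult_minus_left)

lemma continuous_with_dx_E: "continuous_with_dx E"
proof -
  have eq: "E = (\<lambda>t x. mat 1 *v x + (- (Gi ** Q')) *v f t x)" by (intro ext) (rule E_alt)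
  show ?thesis unfolding eq by (rule affine_in_f_dx(2))
qed

lemma jacobian_E: "t \<ge> 0 \<Longrightarrow>
    jacobian (E t) (at x) = mat 1 - Gi ** jacobian (\<lambda>x. Q' *v f t x) (at x)"
proof -
  assume t: "t \<ge> 0"
  have eq: "E t = (\<lambda>x. mat 1 *v x + (- (Gi ** Q')) *v f t x)" by (intro ext) (rule E_alt)
  show ?thesis unfolding eq
    using affine_in_f_dx(1)[OF t, of "mat 1" "- (Gi ** Q')" x]
      linear_neg[OF bounded_linear.linear[OF bounded_linear_matrix_mult(2)], of "Gi ** Q'" "jacobian (f t) (at x)"]
    by (simp add: jacobian_matrix_f[OF t] matrix_mul_assoc)
qed

lemma continuous_with_dx_\<Phi>: "continuous_with_dx \<Phi>"
proof -
  have eq: "\<Phi> = (\<lambda>t x. (- (Gi ** Q ** B)) *v x + (Gi ** Q) *v f t x)"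
    by (intro ext) (simp add: \<Phi>_def matrix_vector_mult_diff_distrib matrix_vector_mult_minus_left
        flip: matrix_vector_mul_assoc)
  show ?thesis unfolding eq by (rule affine_in_f_dx(2))
qed

lemma P_E: "P *v E t x = P *v x"
  by (simp add: E_def matrix_vector_mult_diff_distrib)

lemma P_\<Phi>: "P *v \<Phi> t x = \<Phi> t x" by (simp add: \<Phi>_def Gi_Q)

text \<open>Since \<open>Q' B = B P' = G P'\<close>, the constraint is \<open>G\<close> applied to \<open>E t x - P x\<close>.\<close>
lemma constraint_iff: "Q' *v (B *v x - f t x) = 0 \<longleftrightarrow> E t x = P *v x"
proof -
  have "Q' *v (B *v x) = G *v (P' *v x)"
    unfolding G_P' by (simp add: Q'_eq Q_B P'_eq matrix_vector_mult_diff_distrib)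
  then have "Q' *v (B *v x - f t x) = G *v (P' *v x) - Q' *v f t x"
    by (simp add: matrix_vector_mult_diff_distrib)
  also have "\<dots> = G *v (P' *v x - Gi *v (Q' *v f t x))" by (simp add: matrix_vector_mult_diff_distrib)
  also have "\<dots> = G *v (E t x - P *v x)" by (simp add: E_def P'_eq algebra_simps)
  finally have eq: "Q' *v (B *v x - f t x) = G *v (E t x - P *v x)" .
  show ?thesis
  proof
    assume "Q' *v (B *v x - f t x) = 0"
    then have "Gi *v (G *v (E t x - P *v x)) = 0" using eq by simp
    then show "E t x = P *v x" by simp
  next
    assume "E t x = P *v x"
    then show "Q' *v (B *v x - f t x) = 0" using eq by simp
  qed
qed

lemma E_in_range: "E t x \<in> range ((*v) P) \<longleftrightarrow> E t x = P *v x"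
  unfolding range_P P_E by auto

lemma in_L0_set: "(t, x) \<in> L0_set B Q' f \<longleftrightarrow> t \<ge> 0 \<and> E t x = P *v x"
  by (simp add: L0_set_def constraint_iff)

text \<open>A kernel vector of the Jacobian of \<open>E t\<close> lies in \<open>X\<^sub>2\<close>, because the second term of the Jacobian maps into
  \<open>X\<^sub>2\<close>; there the Jacobian is \<open>- G\<inverse>\<close> times the derivative of the constraint.\<close>
lemma jacobian_E_invertible:
  assumes t: "t \<ge> 0"
    and ker: "\<And>h. P *v h = 0 \<Longrightarrow> ((jacobian (\<lambda>x. Q' *v f t x) (at x) - B) ** P') *v h = 0 \<Longrightarrow> h = 0"
  shows "invertible (jacobian (E t) (at x))"
  unfolding invertible_left_inverse matrix_left_invertible_ker
proof (intro allI impI)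
  fix h assume h0: "jacobian (E t) (at x) *v h = 0"
  let ?J = "jacobian (f t) (at x)"
  have h: "h = Gi *v (Q' *v (?J *v h))"
    using h0 unfolding jacobian_E[OF t] jacobian_matrix_f[OF t]
      matrix_vector_mult_diff_rdistrib[of "mat 1" "Gi ** _"] matrix_vector_mul_assoc[symmetric] by simp
  then have Ph: "P *v h = 0" by (metis P_Gi_Q')
  then have P'h: "P' *v h = h" by (simp add: P'_eq)
  have "B *v h = G *v h" using G_P'[of h] P'h by simp
  also have "\<dots> = Q' *v (?J *v h)" by (subst h) simp
  finally have "((jacobian (\<lambda>x. Q' *v f t x) (at x) - B) ** P') *v h = 0"
    unfolding jacobian_matrix_f[OF t] matrix_vector_mul_assoc[symmetric] P'h
      matrix_vector_mult_diff_rdistrib[of _ B] by simp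
  then show "h = 0" by (rule ker[OF Ph])
qed

lemma P_jacobian_E: "t \<ge> 0 \<Longrightarrow> P *v (jacobian (E t) (at x) *v h) = P *v h"
  by (simp only: jacobian_E jacobian_matrix_f matrix_vector_mult_diff_rdistrib[of "mat 1" "Gi ** _"]
      matrix_vector_mul_assoc[symmetric] matrix_vector_mult_diff_distrib[of P] P_Gi_Q'
      matrix_vector_mul_lid diff_zero)

lemma constraint_unique:
  assumes t: "t \<ge> 0" and x: "E t x = P *v x" and y: "E t y = P *v y" and P: "P *v x = P *v y"
    and bi: "basis_invertible (range ((*v) P')) (range ((*v) Q'))
       (\<lambda>u. (jacobian (\<lambda>x. Q' *v f t x) (at (P *v x + u)) - B) ** P') (P' *v x) (P' *v y)"
  shows "x = y"
proof -
  let ?\<Psi> = "\<lambda>u. Q' *v f t (P *v x + u) - B *v u"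
  have dec: "x = P *v x + P' *v x" "y = P *v x + P' *v y" using P by (auto simp: P'_eq)
  have \<Psi>0: "Q' *v f t w - B *v (P' *v w) = 0" if "E t w = P *v w" for w
    using that constraint_iff[of w t]
    by (simp add: Q'_eq[of "B *v w"] Q_B P'_eq matrix_vector_mult_diff_distrib)
  have d: "(?\<Psi> has_derivative (\<lambda>h. (jacobian (\<lambda>x. Q' *v f t x) (at (P *v x + u)) - B) *v h)) (at u)" for u
  proof -
    have "((\<lambda>x. Q' *v f t x) has_derivative (\<lambda>h. jacobian (\<lambda>x. Q' *v f t x) (at (P *v x + u)) *v h)) (at (P *v x + u))"
      using matrix_f_derivative[OF t, of Q' "P *v x + u"] by (simp add: jacobian_matrix_f[OF t])
    then have 1: "((\<lambda>u. Q' *v f t (P *v x + u)) has_derivative (\<lambda>h. jacobian (\<lambda>x. Q' *v f t x) (at (P *v x + u)) *v h)) (at u)"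
      by (rule has_derivative_compose[rotated]) (auto intro!: derivative_eq_intros)
    show ?thesis
      using has_derivative_diff[OF 1 bounded_linear_imp_has_derivative[OF matrix_vector_mul_bounded_linear[of B]]]
      by (simp add: matrix_vector_mult_diff_rdistrib)
  qed
  have "P' *v x = P' *v y"
  proof (rule basis_invertible_injective[OF bi _ _ _ d])
    let ?h = "P' *v y - P' *v x"
    have Ph: "P *v ?h = 0" by (simp add: P'_eq matrix_vector_mult_diff_distrib)
    then have P'h: "P' *v ?h = ?h" by (simp add: P'_fix_iff)
    show "((jacobian (\<lambda>x. Q' *v f t x) (at (P *v x + u)) - B) ** P') *v ?h =
        (jacobian (\<lambda>x. Q' *v f t x) (at (P *v x + u)) - B) *v ?h" for u
      unfolding matrix_vector_mul_assoc[symmetric] P'h ..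
    show "((jacobian (\<lambda>x. Q' *v f t x) (at (P *v x + u)) - B) ** P') *v ?h \<in> range ((*v) Q')" for u
      unfolding range_Q' matrix_vector_mul_assoc[symmetric] P'h jacobian_matrix_f[OF t] matrix_vector_mult_diff_rdistrib[of _ B]
      by (simp add: matrix_vector_mult_diff_distrib[of Q] Q_B Ph) (simp add: Q'_eq matrix_vector_mult_diff_distrib)
    show "?\<Psi> (P' *v x) = ?\<Psi> (P' *v y)"
      using \<Psi>0[OF x] \<Psi>0[OF y] unfolding dec[symmetric] by simp
    show "subspace (range ((*v) P'))"
      by (intro linear_subspace_image matrix_vector_mul_linear subspace_UNIV)
  qed auto
  then show ?thesis using dec by metis
qed

end

section \<open>Convergence\<close>

lemma Max_norm_tendsto_zero:
  fixes c :: "nat \<Rightarrow> nat \<Rightarrow> real"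
  assumes nonneg: "\<And>N i. c N i \<ge> 0"
    and small: "\<And>e. e > 0 \<Longrightarrow> \<exists>N0. \<forall>N\<ge>N0. \<forall>i\<le>N. c N i \<le> e"
  shows "(\<lambda>N. Max (c N ` {0..N})) \<longlonglongrightarrow> 0"
proof (rule LIMSEQ_I)
  fix r :: real assume "r > 0"
  then obtain N0 where N0: "\<forall>N\<ge>N0. \<forall>i\<le>N. c N i \<le> r/2" using small[of "r/2"] by auto
  have "norm (Max (c N ` {0..N}) - 0) < r" if "N \<ge> N0" for N
  proof -
    have "Max (c N ` {0..N}) \<le> r/2" using N0 that by (subst Max_le_iff) auto
    moreover have "0 \<le> c N 0" by (rule nonneg)
    then have "0 \<le> Max (c N ` {0..N})" by (rule order_trans) (auto intro!: Max_ge)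
    ultimately show ?thesis unfolding real_norm_def diff_0_right using \<open>r > 0\<close> by linarith
  qed
  then show "\<exists>no. \<forall>n\<ge>no. norm (Max (c n ` {0..n}) - 0) < r" by blast
qed

theorem mainTheorem3:
  fixes A B P1 P2 Q1 Q2 G :: "real^'n^'n"
    and X1 X2 Y1 Y2 :: "(real^'n) set"
    and C1 C2 t0 T :: real
    and f :: "real \<Rightarrow> real^'n \<Rightarrow> real^'n"
    and L0 :: "(real \<times> (real^'n)) set"
    and x0 :: "real^'n"
  assumes regular: "regular_pencil A B"
    and index: "index_at_most_1 A B C1 C2"
    and P1: "P1 = spectral_P A B C2" and P2: "P2 = mat 1 - P1"
    and Q1: "Q1 = spectral_Q A B C2" and Q2: "Q2 = mat 1 - Q1"
    and X1: "X1 = range ((*v) P1)" and X2: "X2 = range ((*v) P2)"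
    and Y1: "Y1 = range ((*v) Q1)" and Y2: "Y2 = range ((*v) Q2)"
    and G: "G = A + B ** P2"
    and f: "continuous_with_dx f"
    and L0: "L0 = L0_set B Q2 f"
    and cond_i: "\<forall>t\<ge>0. \<forall>xp1\<in>X1. \<exists>xp2\<in>X2. (t, xp1 + xp2) \<in> L0"
    and cond_ii: "\<forall>t\<ge>0. \<forall>xp1\<in>X1. \<forall>v\<in>X2. \<forall>w\<in>X2.
          (t, xp1 + v) \<in> L0 \<and> (t, xp1 + w) \<in> L0 \<longrightarrow>
          basis_invertible X2 Y2
            (\<lambda>xp2. (jacobian (\<lambda>x. Q2 *v f t x) (at (xp1 + xp2)) - B) ** P2) v w"
    and cond_iii:
      "(\<exists>H. positive_selfadjoint_on X1 H \<and>
          (\<forall>T'>0. \<exists>R>0. \<forall>t x. (t, x) \<in> L0 \<and> t \<le> T' \<and> norm (P1 *v x) \<ge> R \<longrightarrow>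
             (H *v (P1 *v x)) \<bullet> (matrix_inv G *v (Q1 *v f t x)) \<le> 0))
       \<or>
       (\<exists>(S1 :: real \<Rightarrow> real^'n^'n) (\<psi> :: real \<Rightarrow> real^'n \<Rightarrow> real^'n)
          (e :: real \<Rightarrow> real^'n) (Pi :: real^'n \<Rightarrow> real^'n^'n).
          (\<forall>t\<ge>0. \<forall>x. Q1 *v f t x = S1 t *v (P1 *v x) + \<psi> t x + Pi x *v e t) \<and>
          continuous_on {0..} S1 \<and> (\<forall>t\<ge>0. S1 t \<in> Lop X1 Y1) \<and>
          continuous_with_dx \<psi> \<and> (\<forall>t\<ge>0. \<forall>x. \<psi> t x \<in> Y1) \<and>
          continuous_on {0..} e \<and>
          C1_map Pi \<and> (\<forall>x. Pi x \<in> Lop UNIV Y1) \<and>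
          (\<exists>C>0. \<exists>r>0. \<forall>x. norm (P1 *v x) \<ge> r \<longrightarrow> onorm ((*v) (Pi x)) \<le> C) \<and>
          (\<exists>H. positive_selfadjoint_on X1 H \<and>
             (\<forall>T'>0. \<exists>R>0. \<forall>t x. (t, x) \<in> L0 \<and> t \<le> T' \<and> norm (P1 *v x) \<ge> R \<longrightarrow>
                (H *v (P1 *v x)) \<bullet> (matrix_inv G *v \<psi> t x) \<le> 0)))
       \<or>
       (\<exists>H. positive_selfadjoint_on X1 H \<and>
          (\<exists>R>0. \<exists>(k :: real \<Rightarrow> real) (U :: real \<Rightarrow> real).
             continuous_on {0..} k \<and> continuous_on {0<..} U \<and> (\<forall>v>0. U v > 0) \<and>
             (\<exists>c>0. filterlim (\<lambda>b. integral {c..b} (\<lambda>v. 1 / U v)) at_top at_top) \<and>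
             (\<forall>t x. (t, x) \<in> L0 \<and> norm (P1 *v x) \<ge> R \<longrightarrow>
                (H *v (P1 *v x)) \<bullet> (matrix_inv G *v (Q1 *v f t x - B *v (P1 *v x)))
                  \<le> k t * U (((H *v (P1 *v x)) \<bullet> (P1 *v x)) / 2))))"
    and init: "(t0, x0) \<in> L0"
    and T: "T > t0"
    and invertible_dx: "\<forall>t\<in>{t0..T}. \<forall>z\<in>X1. \<forall>u\<in>X2.
          invertible_between X2 Y2 ((jacobian (\<lambda>x. Q2 *v f t x) (at (z + u)) - B) ** P2)"
  shows "\<exists>x. global_dae_solution A B f t0 x0 x \<and>
           (\<forall>y. global_dae_solution A B f t0 x0 y \<longrightarrow> (\<forall>t\<ge>t0. y t = x t)) \<and>
           (let h = (\<lambda>N. (T - t0) / real N);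
                z = (\<lambda>N i. fst (scheme B G Q1 Q2 f t0 (P1 *v x0) (P2 *v x0) (h N) i));
                u = (\<lambda>N i. snd (scheme B G Q1 Q2 f t0 (P1 *v x0) (P2 *v x0) (h N) i))
            in (\<lambda>N. Max ((\<lambda>i. norm (P1 *v x (t0 + real i * h N) - z N i)) ` {0..N}))
                 \<longlonglongrightarrow> 0 \<and>
               (\<lambda>N. Max ((\<lambda>i. norm (P2 *v x (t0 + real i * h N) - u N i)) ` {0..N}))
                 \<longlonglongrightarrow> 0)"
proof -
  note sp = spectral_projectors[OF index P1 Q1, of G, folded P2, OF G]
  interpret dae_splitting A B P1 Q1 G f
    by unfold_locales (use sp f G in \<open>auto simp: P2\<close>)
  have P2': "P2 = mat 1 - P1" "Q2 = mat 1 - Q1" by (fact P2, fact Q2)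
  have X1_iff: "v \<in> X1 \<longleftrightarrow> P1 *v v = v" for v unfolding X1 by (rule range_P)
  have X2_iff: "v \<in> X2 \<longleftrightarrow> P1 *v v = 0" for v unfolding X2 P2 by (rule range_P')
  have PX1: "P1 *v v \<in> X1" and PX2: "P2 *v v \<in> X2" for v by (simp_all add: X1 X2)
  have subX1: "subspace X1" unfolding X1
    by (intro linear_subspace_image matrix_vector_mul_linear subspace_UNIV)
  have L0_iff: "(t, x) \<in> L0 \<longleftrightarrow> t \<ge> 0 \<and> E t x = P1 *v x" for t x
    unfolding L0 Q2 by (rule in_L0_set)
  have E_X1: "E t x \<in> X1 \<longleftrightarrow> E t x = P1 *v x" for t x
    unfolding X1 by (rule E_in_range)
  have dec: "P1 *v x + P2 *v x = x" for x by (simp add: P2 P'_eq)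

  interpret semi_explicit_dae E X1 \<Phi>
  proof
    show "continuous_with_dx E" by (rule continuous_with_dx_E)
    show "continuous_with_dx \<Phi>" by (rule continuous_with_dx_\<Phi>)
    show "closed X1" by (rule closed_subspace[OF subX1])
    show "\<exists>!x. E t x = z" if t: "t \<ge> 0" and z: "z \<in> X1" for t z
    proof (rule ex_ex1I)
      obtain v where v: "v \<in> X2" "(t, z + v) \<in> L0" using cond_i t z by blast
      have "P1 *v (z + v) = z" using z v by (simp add: X1_iff X2_iff matrix_vector_right_distrib)
      then show "\<exists>x. E t x = z" using v(2) L0_iff by auto
      fix x y assume xy: "E t x = z" "E t y = z"
      then have x: "E t x = P1 *v x" and y: "E t y = P1 *v y" unfolding E_X1[symmetric] using z by simp_all
      have eq: "P1 *v x = P1 *v y" using x y xy by simp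
      have "(t, P1 *v x + P2 *v x) \<in> L0" "(t, P1 *v x + P2 *v y) \<in> L0"
        unfolding dec unfolding eq dec by (auto simp: L0_iff t x y)
      then have "basis_invertible X2 Y2
            (\<lambda>xp2. (jacobian (\<lambda>x. Q2 *v f t x) (at (P1 *v x + xp2)) - B) ** P2) (P2 *v x) (P2 *v y)"
        using cond_ii t PX1 PX2 by blast
      then show "x = y"
        unfolding X2 Y2 P2' by (rule constraint_unique[OF t x y eq])
    qed
    show "invertible (jacobian (E t) (at x))" if t: "t \<ge> 0" and E: "E t x \<in> X1" for t x
    proof (rule jacobian_E_invertible[OF t])
      fix h assume h: "P1 *v h = 0" "((jacobian (\<lambda>x. (mat 1 - Q1) *v f t x) (at x) - B) ** (mat 1 - P1)) *v h = 0"
      have "(t, P1 *v x + P2 *v x) \<in> L0" unfolding dec using E t by (simp add: L0_iff E_X1)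
      then have "basis_invertible X2 Y2
            (\<lambda>xp2. (jacobian (\<lambda>x. Q2 *v f t x) (at (P1 *v x + xp2)) - B) ** P2) (P2 *v x) (P2 *v x)"
        using cond_ii t PX1 PX2 by blast
      then show "h = 0"
        by (rule basis_invertible_point) (use h in \<open>simp_all add: X2_iff dec[unfolded P2] P2'\<close>)
    qed
  qed

  have t0: "t0 \<ge> 0" and Ex0: "E t0 x0 = P1 *v x0" using init by (auto simp: L0_iff)
  define z0 where "z0 = P1 *v x0"
  have z0: "z0 \<in> X1" by (simp add: z0_def PX1)
  have \<xi>x0: "\<xi> t0 z0 = x0" using \<xi>_eqI[OF t0 Ex0] z0 by (simp add: z0_def)
  have P_\<xi>: "P1 *v \<xi> t z = z" if "t \<ge> 0" "z \<in> X1" for t z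
    using E_X1[of t "\<xi> t z"] E_\<xi>[OF that] that by simp
  have \<xi>_L0: "(t, \<xi> t z) \<in> L0" if "t \<ge> 0" "z \<in> X1" for t z
    using that by (simp add: L0_iff E_\<xi> P_\<xi>)

  define F where "F = (\<lambda>t z. \<Phi> t (\<xi> t z))"
  have F_eq: "F t z = matrix_inv G *v (Q1 *v f t (\<xi> t z)) - matrix_inv G *v (B *v z)"
    and F_eq': "F t z = matrix_inv G *v (Q1 *v f t (\<xi> t z) - B *v z)"
    if "t \<ge> 0" "z \<in> X1" for t z
    using that by (simp_all add: F_def \<Phi>_def matrix_vector_mult_diff_distrib Q_B P_\<xi>)
  have F_cont: "continuous_on ({t0..} \<times> X1) (\<lambda>(t, z). F t z)"
    unfolding F_def split_def
  proof (rule continuous_with_dx_compose(1)[OF \<Phi>])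
    show "continuous_on ({t0..} \<times> X1) (\<lambda>p. \<xi> (fst p) (snd p))"
      by (rule continuous_on_subset[OF continuous_on_\<xi>[unfolded split_def]]) (use t0 in auto)
  qed (use t0 in \<open>auto intro!: continuous_intros\<close>)
  have F_lip: "\<exists>L. \<forall>t\<in>{t0..b}. \<forall>z\<in>X1. \<forall>z'\<in>X1. norm z \<le> r \<longrightarrow> norm z' \<le> r \<longrightarrow>
        norm (F t z - F t z') \<le> L * norm (z - z')" for b r
  proof -
    obtain L1 where L1: "L1 \<ge> 0" "\<And>t z z'. \<lbrakk>0 \<le> t; t \<le> b; z \<in> X1; z' \<in> X1; norm z \<le> r; norm z' \<le> r\<rbrakk>
        \<Longrightarrow> norm (\<xi> t z - \<xi> t z') \<le> L1 * norm (z - z')"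
      by (rule \<xi>_Lipschitz[of b r]) blast
    have c: "continuous_on ({t0..b} \<times> (X1 \<inter> cball 0 r)) (\<lambda>(t, z). \<xi> t z)"
      by (rule continuous_on_subset[OF continuous_on_\<xi>]) (use t0 in auto)
    have "compact ({t0..b} \<times> (X1 \<inter> cball 0 r))"
      by (intro compact_Times closed_Int_compact closed_subspace subX1) auto
    then have "bounded ((\<lambda>(t, z). \<xi> t z) ` ({t0..b} \<times> (X1 \<inter> cball 0 r)))"
      by (intro compact_imp_bounded compact_continuous_image c)
    then obtain \<rho> where "\<forall>y \<in> (\<lambda>(t, z). \<xi> t z) ` ({t0..b} \<times> (X1 \<inter> cball 0 r)). norm y \<le> \<rho>"
      unfolding bounded_iff by blast
    then have \<rho>: "norm (\<xi> t z) \<le> \<rho>" if "t \<in> {t0..b}" "z \<in> X1" "norm z \<le> r" for t z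
      using that by force
    obtain L2 where L2: "L2 \<ge> 0" "\<And>t x y. \<lbrakk>0 \<le> t; t \<le> b; norm x \<le> \<rho>; norm y \<le> \<rho>\<rbrakk>
        \<Longrightarrow> norm (\<Phi> t x - \<Phi> t y) \<le> L2 * norm (x - y)"
      by (rule continuous_with_dx_Lipschitz[OF \<Phi>, of b \<rho>]) blast
    show ?thesis
    proof (intro exI[of _ "L2 * L1"] ballI impI)
      fix t z z' assume A: "t \<in> {t0..b}" "z \<in> X1" "z' \<in> X1" "norm z \<le> r" "norm z' \<le> r"
      have "norm (F t z - F t z') \<le> L2 * norm (\<xi> t z - \<xi> t z')"
        unfolding F_def using A \<rho> t0 by (intro L2) auto
      also have "\<dots> \<le> L2 * (L1 * norm (z - z'))"
        using A t0 L2(1) by (intro mult_left_mono L1) auto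
      finally show "norm (F t z - F t z') \<le> L2 * L1 * norm (z - z')" by simp
    qed
  qed
  have FX1: "F t z \<in> X1" for t z by (simp add: X1_iff F_def P_\<Phi>)

  have confined: "\<exists>\<rho>\<ge>0. \<forall>z D. z t0 = z0 \<longrightarrow>
        (\<forall>t\<in>{t0..b}. z t \<in> X1 \<and> D t \<in> X1 \<and> (z has_vector_derivative D t) (at t within {t0..b}) \<and>
            (norm (z t) \<le> \<rho> \<longrightarrow> D t = F t (z t))) \<longrightarrow>
        (\<forall>t\<in>{t0..b}. norm (z t) \<le> \<rho>)" if b: "b > t0" for b
  proof -
    have b0: "b > 0" using b t0 by simp
    obtain cB where cB: "cB > 0" "\<And>v. norm ((matrix_inv G ** B) *v v) \<le> cB * norm v"
      by (rule matrix_norm_bound[of "matrix_inv G ** B"]) blast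
    obtain cG where cG: "cG > 0" "\<And>v. norm (matrix_inv G *v v) \<le> cG * norm v"
      by (rule matrix_norm_bound[of "matrix_inv G"]) blast
    show ?thesis using cond_iii
    proof (elim disjE)
      assume "\<exists>H. positive_selfadjoint_on X1 H \<and>
          (\<forall>T'>0. \<exists>R>0. \<forall>t x. (t, x) \<in> L0 \<and> t \<le> T' \<and> norm (P1 *v x) \<ge> R \<longrightarrow>
             (H *v (P1 *v x)) \<bullet> (matrix_inv G *v (Q1 *v f t x)) \<le> 0)"
      then obtain H R where H: "positive_selfadjoint_on X1 H" and R: "R > 0" and
        neg: "\<forall>t x. (t, x) \<in> L0 \<and> t \<le> b \<and> norm (P1 *v x) \<ge> R \<longrightarrow>
             (H *v (P1 *v x)) \<bullet> (matrix_inv G *v (Q1 *v f t x)) \<le> 0" using b0 by blast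
      show ?thesis
      proof (rule quadratic_confinement[OF subX1 H z0 b R less_imp_le[OF cB(1)]])
        fix t z assume tz: "t \<in> {t0..b}" "z \<in> X1" "norm z \<ge> R"
        then have t: "t \<ge> 0" using t0 by simp
        show "\<exists>p y. F t z = p + y \<and> (H *v z) \<bullet> p \<le> 0 \<and> norm y \<le> cB * norm z"
        proof (intro exI conjI)
          show "F t z = matrix_inv G *v (Q1 *v f t (\<xi> t z)) + - (matrix_inv G *v (B *v z))"
            using F_eq[OF t tz(2)] by simp
          show "(H *v z) \<bullet> (matrix_inv G *v (Q1 *v f t (\<xi> t z))) \<le> 0"
            using neg[rule_format, of t "\<xi> t z"] tz t by (simp add: \<xi>_L0 P_\<xi>)
          show "norm (- (matrix_inv G *v (B *v z))) \<le> cB * norm z"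
            using cB(2)[of z] by (simp add: matrix_vector_mul_assoc)
        qed
      qed
    next
      assume "\<exists>(S1 :: real \<Rightarrow> real^'n^'n) (\<psi> :: real \<Rightarrow> real^'n \<Rightarrow> real^'n)
          (e :: real \<Rightarrow> real^'n) (Pi :: real^'n \<Rightarrow> real^'n^'n).
          (\<forall>t\<ge>0. \<forall>x. Q1 *v f t x = S1 t *v (P1 *v x) + \<psi> t x + Pi x *v e t) \<and>
          continuous_on {0..} S1 \<and> (\<forall>t\<ge>0. S1 t \<in> Lop X1 Y1) \<and>
          continuous_with_dx \<psi> \<and> (\<forall>t\<ge>0. \<forall>x. \<psi> t x \<in> Y1) \<and>
          continuous_on {0..} e \<and>
          C1_map Pi \<and> (\<forall>x. Pi x \<in> Lop UNIV Y1) \<and>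
          (\<exists>C>0. \<exists>r>0. \<forall>x. norm (P1 *v x) \<ge> r \<longrightarrow> onorm ((*v) (Pi x)) \<le> C) \<and>
          (\<exists>H. positive_selfadjoint_on X1 H \<and>
             (\<forall>T'>0. \<exists>R>0. \<forall>t x. (t, x) \<in> L0 \<and> t \<le> T' \<and> norm (P1 *v x) \<ge> R \<longrightarrow>
                (H *v (P1 *v x)) \<bullet> (matrix_inv G *v \<psi> t x) \<le> 0))"
      then show ?thesis
      proof (elim exE conjE)
        fix S1 :: "real \<Rightarrow> real^'n^'n" and \<psi> :: "real \<Rightarrow> real^'n \<Rightarrow> real^'n" and e :: "real \<Rightarrow> real^'n"
          and Pi :: "real^'n \<Rightarrow> real^'n^'n" and H :: "real^'n^'n" and C r :: real
        assume split: "\<forall>t\<ge>0. \<forall>x. Q1 *v f t x = S1 t *v (P1 *v x) + \<psi> t x + Pi x *v e t"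
          and S1: "continuous_on {0..} S1" and e: "continuous_on {0..} e"
          and C: "C > 0" "r > 0" "\<forall>x. norm (P1 *v x) \<ge> r \<longrightarrow> onorm ((*v) (Pi x)) \<le> C"
          and H: "positive_selfadjoint_on X1 H"
          and negs: "\<forall>T'>0. \<exists>R>0. \<forall>t x. (t, x) \<in> L0 \<and> t \<le> T' \<and> norm (P1 *v x) \<ge> R \<longrightarrow>
                (H *v (P1 *v x)) \<bullet> (matrix_inv G *v \<psi> t x) \<le> 0"
        obtain R where R: "R > 0" and neg: "\<forall>t x. (t, x) \<in> L0 \<and> t \<le> b \<and> norm (P1 *v x) \<ge> R \<longrightarrow>
                  (H *v (P1 *v x)) \<bullet> (matrix_inv G *v \<psi> t x) \<le> 0"
          using negs b0 by blast
        obtain K where K: "K > 0" "\<And>(M::real^'n^'n) v. norm (M *v v) \<le> norm M * norm v * K"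
          using bounded_bilinear.pos_bounded[OF bounded_bilinear_matrix_vector_mult] by blast
        have sub: "{t0..b} \<subseteq> {0..}" using t0 by auto
        have "bounded (S1 ` {t0..b})" "bounded (e ` {t0..b})"
          by (intro compact_imp_bounded compact_continuous_image continuous_on_subset[OF S1 sub]
              continuous_on_subset[OF e sub] compact_Icc)+
        then obtain bS be where "\<forall>y\<in>S1 ` {t0..b}. norm y \<le> bS" "\<forall>y\<in>e ` {t0..b}. norm y \<le> be"
          unfolding bounded_iff by blast
        then have bS: "norm (S1 t) \<le> bS" and be: "norm (e t) \<le> be" if "t \<in> {t0..b}" for t
          using that by auto
        have nn: "bS \<ge> 0" "be \<ge> 0"
          by (rule order_trans[OF norm_ge_zero bS[of t0]], use b in simp)
            (rule order_trans[OF norm_ge_zero be[of t0]], use b in simp)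
        (* For norm z >= 1 bounded terms are dominated by multiples of norm z. *)
      define R' where "R' = max 1 (max R r)"
        define c where "c = cG * (bS * K + C * be) + cB"
        have R': "R' > 0" "R' \<ge> 1" "R' \<ge> R" "R' \<ge> r" by (auto simp: R'_def)
        have c: "c \<ge> 0" using cG cB C nn K by (auto simp: c_def)
        show ?thesis
        proof (rule quadratic_confinement[OF subX1 H z0 b R'(1) c])
          fix t z assume tz: "t \<in> {t0..b}" "z \<in> X1" "norm z \<ge> R'"
          then have t: "t \<ge> 0" "t \<le> b" using t0 by auto
          have z1: "1 \<le> norm z" "norm z \<ge> R" "norm z \<ge> r" using tz(3) R' by auto
          let ?x = "\<xi> t z"
          have Px: "P1 *v ?x = z" by (rule P_\<xi>[OF t(1) tz(2)])
          let ?y = "matrix_inv G *v (S1 t *v z + Pi ?x *v e t) - matrix_inv G *v (B *v z)"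
          show "\<exists>p y. F t z = p + y \<and> (H *v z) \<bullet> p \<le> 0 \<and> norm y \<le> c * norm z"
          proof (intro exI conjI)
            show "F t z = matrix_inv G *v \<psi> t ?x + ?y"
              using split[rule_format, OF t(1), of ?x] unfolding F_eq[OF t(1) tz(2)] Px
              by (simp add: matrix_vector_right_distrib)
            show "(H *v z) \<bullet> (matrix_inv G *v \<psi> t ?x) \<le> 0"
              using neg[rule_format, of t ?x] tz t z1 by (simp add: \<xi>_L0 Px)
            have "norm (Pi ?x *v e t) \<le> onorm ((*v) (Pi ?x)) * norm (e t)"
              by (rule onorm) simp
            also have "\<dots> \<le> C * be" using C(3)[rule_format, of ?x] z1 Px be[OF tz(1)] C(1)
              by (intro mult_mono) auto
            also have "\<dots> \<le> C * be * norm z" using z1(1) C(1) nn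
              mult_left_mono[of 1 "norm z" "C * be"] by simp
            finally have n1: "norm (Pi ?x *v e t) \<le> C * be * norm z" .
            have "norm (S1 t *v z) \<le> norm (S1 t) * norm z * K" by (rule K)
            also have "\<dots> \<le> bS * norm z * K" using bS[OF tz(1)] K(1) by (intro mult_right_mono) auto
            finally have n2: "norm (S1 t *v z) \<le> bS * K * norm z" by (simp add: mult_ac)
            have n3: "norm (S1 t *v z + Pi ?x *v e t) \<le> (bS * K + C * be) * norm z"
              using norm_triangle_ineq[of "S1 t *v z" "Pi ?x *v e t"] n1 n2 by (simp add: distrib_right)
            have "norm ?y \<le> norm (matrix_inv G *v (S1 t *v z + Pi ?x *v e t)) + norm (matrix_inv G *v (B *v z))"
              by (rule norm_triangle_ineq4)
            also have "\<dots> \<le> cG * ((bS * K + C * be) * norm z) + cB * norm z"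
            proof (rule add_mono)
              show "norm (matrix_inv G *v (S1 t *v z + Pi ?x *v e t)) \<le> cG * ((bS * K + C * be) * norm z)"
                by (rule order_trans[OF cG(2) mult_left_mono[OF n3]]) (use cG(1) in simp)
              show "norm (matrix_inv G *v (B *v z)) \<le> cB * norm z"
                using cB(2)[of z] by (simp add: matrix_vector_mul_assoc)
            qed
            finally show "norm ?y \<le> c * norm z" by (simp add: c_def algebra_simps)
          qed
        qed
      qed
    next
      assume "\<exists>H. positive_selfadjoint_on X1 H \<and>
          (\<exists>R>0. \<exists>(k :: real \<Rightarrow> real) (U :: real \<Rightarrow> real).
             continuous_on {0..} k \<and> continuous_on {0<..} U \<and> (\<forall>v>0. U v > 0) \<and>
             (\<exists>c>0. filterlim (\<lambda>b. integral {c..b} (\<lambda>v. 1 / U v)) at_top at_top) \<and>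
             (\<forall>t x. (t, x) \<in> L0 \<and> norm (P1 *v x) \<ge> R \<longrightarrow>
                (H *v (P1 *v x)) \<bullet> (matrix_inv G *v (Q1 *v f t x - B *v (P1 *v x)))
                  \<le> k t * U (((H *v (P1 *v x)) \<bullet> (P1 *v x)) / 2)))"
      then obtain H R k U c where H: "positive_selfadjoint_on X1 H" and R: "R > 0"
        and k: "continuous_on {0..} k" and U: "continuous_on {0<..} U" "\<forall>v>0. U v > 0"
        and c: "c > 0" "filterlim (\<lambda>b. integral {c..b} (\<lambda>v. 1 / U v)) at_top at_top"
        and gr: "\<forall>t x. (t, x) \<in> L0 \<and> norm (P1 *v x) \<ge> R \<longrightarrow>
                (H *v (P1 *v x)) \<bullet> (matrix_inv G *v (Q1 *v f t x - B *v (P1 *v x)))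
                  \<le> k t * U (((H *v (P1 *v x)) \<bullet> (P1 *v x)) / 2)"
        by (elim exE conjE)
      have "bounded (k ` {t0..b})"
        by (intro compact_imp_bounded compact_continuous_image continuous_on_subset[OF k]) (use t0 in auto)
      then obtain K where "\<forall>y\<in>k ` {t0..b}. norm y \<le> K" unfolding bounded_iff by blast
      then have K: "\<bar>k t\<bar> \<le> K" if "t \<in> {t0..b}" for t using that by auto
      have K0: "K \<ge> 0" using K[of t0] b by auto
      show ?thesis
      proof (rule energy_confinement[OF subX1 H z0 b U(1) _ c K0 R])
        show "U v > 0" if "v > 0" for v using U(2) that by blast
        fix t z assume tz: "t \<in> {t0..b}" "z \<in> X1" "norm z \<ge> R"
        then have t: "t \<ge> 0" using t0 by simp
        have Hz: "(H *v z) \<bullet> z > 0"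
          using H tz R by (auto simp: positive_selfadjoint_on_def)
        have "(H *v z) \<bullet> F t z \<le> k t * U (((H *v z) \<bullet> z) / 2)"
          using gr[rule_format, of t "\<xi> t z"] tz t by (simp add: \<xi>_L0 P_\<xi> F_eq')
        also have "\<dots> \<le> K * U (((H *v z) \<bullet> z) / 2)"
          using K[OF tz(1)] U(2)[rule_format, of "((H *v z) \<bullet> z) / 2"] Hz
          by (intro mult_right_mono) auto
        finally show "(H *v z) \<bullet> F t z \<le> K * U (((H *v z) \<bullet> z) / 2)" .
      qed
    qed
  qed

  obtain z where z_init: "z t0 = z0" and zX1: "\<And>t. t \<ge> t0 \<Longrightarrow> z t \<in> X1"
    and z_ode: "\<And>t. t \<ge> t0 \<Longrightarrow> (z has_vector_derivative F t (z t)) (at t within {t0..})"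
  proof (rule global_solution_in_subspace[OF subX1 z0 F_cont FX1 F_lip confined])
    fix z
    assume "z t0 = z0" "\<And>t. t \<ge> t0 \<Longrightarrow> z t \<in> X1"
      "\<And>t. t \<ge> t0 \<Longrightarrow> (z has_vector_derivative F t (z t)) (at t within {t0..})"
    then show thesis by (rule that)
  qed
  define x where "x = (\<lambda>t. \<xi> t (z t))"
  have Px: "P1 *v x t = z t" if "t \<ge> t0" for t using that t0 zX1 by (simp add: x_def P_\<xi>)
  have cz: "continuous_on {t0..} z" by (rule continuous_on_vector_derivative[OF z_ode]) simp
  have cx: "continuous_on {t0..} x"
  proof -
    have c: "continuous_on {t0..} (\<lambda>t. (t, z t))" by (intro continuous_intros cz)
    have i: "(\<lambda>t. (t, z t)) ` {t0..} \<subseteq> {0..} \<times> X1" using zX1 t0 by auto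
    show ?thesis using continuous_on_compose2[OF continuous_on_\<xi> c i] by (simp add: x_def)
  qed
  have J: "{t. t0 \<le> t \<and> ereal t < \<infinity>} = {t0..}" by auto
  have sol: "global_dae_solution A B f t0 x0 x"
    unfolding global_dae_solution_def dae_solution_def Let_def J
  proof (intro conjI exI[of _ "\<lambda>t. f t (x t) - B *v x t"] ballI)
    show "continuous_on {t0..} x" by (rule cx)
    show "x t0 = x0" by (simp add: x_def z_init \<xi>x0)
    show "continuous_on {t0..} (\<lambda>t. f t (x t) - B *v x t)"
      by (intro continuous_on_diff continuous_with_dx_compose(1)[OF f cx]
          bounded_linear.continuous_on[OF matrix_vector_mul_bounded_linear cx] continuous_on_id) (use t0 in auto)
    fix t assume t: "t \<in> {t0..}"
    then have t': "t \<ge> 0" "t \<ge> t0" using t0 by auto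
    show "f t (x t) - B *v x t + B *v x t = f t (x t)" by simp
    have "((\<lambda>s. A *v z s) has_vector_derivative A *v F t (z t)) (at t within {t0..})"
      by (rule bounded_linear.has_vector_derivative[OF matrix_vector_mul_bounded_linear z_ode[OF t'(2)]])
    then have "((\<lambda>s. A *v x s) has_vector_derivative A *v F t (z t)) (at t within {t0..})"
    proof (rule has_vector_derivative_transform[rotated 2])
      fix s assume "s \<in> {t0..}"
      then show "A *v x s = A *v z s" using Px[of s] A_P[of "x s"] by simp
    qed (rule t)
    moreover have "A *v F t (z t) = f t (x t) - B *v x t"
    proof -
      have "(mat 1 - Q1) *v (B *v x t - f t (x t)) = 0"
        using \<xi>_L0[OF t'(1) zX1[OF t'(2)]] unfolding L0 L0_set_def Q2 by (simp add: x_def)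
      then have "f t (x t) - B *v x t = Q1 *v (f t (x t) - B *v x t)"
        unfolding Q'_eq by (simp add: matrix_vector_mult_diff_distrib algebra_simps)
      then show ?thesis by (simp add: F_def \<Phi>_def x_def)
    qed
    ultimately show "((\<lambda>s. A *v x s) has_vector_derivative f t (x t) - B *v x t) (at t within {t0..})" by simp
  qed
  have uniq: "y t = x t" if y: "global_dae_solution A B f t0 x0 y" and t: "t \<ge> t0" for y t
  proof -
    obtain D where y0: "y t0 = x0"
      and D: "\<And>s. s \<ge> t0 \<Longrightarrow> ((\<lambda>s. A *v y s) has_vector_derivative D s) (at s within {t0..})"
      "\<And>s. s \<ge> t0 \<Longrightarrow> D s + B *v y s = f s (y s)"
      using y unfolding global_dae_solution_def dae_solution_def Let_def J by auto
    have D_eq: "D s = f s (y s) - B *v y s" if "s \<ge> t0" for s using D(2)[OF that] by (simp add: algebra_simps)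
    (* Q1 A = A, so the derivative of A y takes values in Y1; this is the constraint for y. *)
    have QD: "Q1 *v D s = D s" if s: "s \<ge> t0" for s
    proof -
      have "((\<lambda>s. Q1 *v (A *v y s)) has_vector_derivative Q1 *v D s) (at s within {t0..})"
        by (rule bounded_linear.has_vector_derivative[OF matrix_vector_mul_bounded_linear D(1)[OF s]])
      then have "((\<lambda>s. A *v y s) has_vector_derivative Q1 *v D s) (at s within {t0..})" by simp
      moreover have "at s within {t0..} \<noteq> bot"
      proof
        assume "at s within {t0..} = bot"
        moreover have "at_right s \<le> at s within {t0..}" by (rule at_le) (use s in auto)
        ultimately have "at_right s = bot" by (simp add: bot_unique)
        then show False by simp
      qed
      ultimately show ?thesis using D(1)[OF s] vector_derivative_unique_within by blast
    qed
    have Ey: "E s (y s) = P1 *v y s" if s: "s \<ge> t0" for s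
    proof -
      have "(mat 1 - Q1) *v (B *v y s - f s (y s)) = - ((mat 1 - Q1) *v D s)"
        unfolding D_eq[OF s] by (simp add: matrix_vector_mult_diff_distrib)
      also have "\<dots> = 0" unfolding Q'_eq QD[OF s] by simp
      finally show ?thesis unfolding constraint_iff .
    qed
    define zy where "zy = (\<lambda>s. P1 *v y s)"
    have y\<xi>: "y s = \<xi> s (zy s)" if s: "s \<ge> t0" for s
      using \<xi>_eqI[OF _ Ey[OF s]] s t0 PX1 by (simp add: zy_def)
    have zy_ode: "(zy has_vector_derivative F s (zy s)) (at s within {t0..})" if s: "s \<ge> t0" for s
    proof -
      have "((\<lambda>s. matrix_inv G *v (A *v y s)) has_vector_derivative matrix_inv G *v D s) (at s within {t0..})"
        by (rule bounded_linear.has_vector_derivative[OF matrix_vector_mul_bounded_linear D(1)[OF s]])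
      moreover have "matrix_inv G *v D s = F s (zy s)"
        unfolding F_def \<Phi>_def y\<xi>[OF s, symmetric] using QD[OF s] unfolding D_eq[OF s] by simp
      ultimately show ?thesis by (simp add: zy_def)
    qed
    have "zy t = z t"
    proof (rule subspace_solution_unique[where ?z1.0=zy and ?z2.0=z and a=t0 and b=t, OF F_lip])
      fix s assume s: "s \<in> {t0..t}"
      show "(zy has_vector_derivative F s (zy s)) (at s within {t0..t})"
        by (rule has_vector_derivative_within_subset[OF zy_ode]) (use s in auto)
      show "(z has_vector_derivative F s (z s)) (at s within {t0..t})"
        by (rule has_vector_derivative_within_subset[OF z_ode]) (use s in auto)
      show "zy s \<in> X1" by (simp add: zy_def PX1)
      show "z s \<in> X1" using s by (intro zX1) auto
    next
      show "zy t0 = z t0" by (simp add: zy_def y0 z_init z0_def)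
    qed (use t in auto)
    then show ?thesis using y\<xi>[OF t] by (simp add: x_def)
  qed

  have inv: "invertible (jacobian (E t) (at y))" if t: "t0 \<le> t" "t \<le> T" for t y
  proof -
    have t': "t \<ge> 0" using t t0 by simp
    have "invertible_between X2 Y2 ((jacobian (\<lambda>x. Q2 *v f t x) (at (P1 *v y + P2 *v y)) - B) ** P2)"
      using invertible_dx t PX1 PX2 by auto
    then have "invertible_between X2 Y2 ((jacobian (\<lambda>x. Q2 *v f t x) (at y) - B) ** P2)" unfolding dec .
    then show ?thesis
      by (intro jacobian_E_invertible[OF t']) (auto simp: X2_iff P2' intro: invertible_between_zero)
  qed

  define h where "h = (\<lambda>N. (T - t0) / real N)"
  define \<tau> where "\<tau> = (\<lambda>N i. t0 + real i * h N)"
  define zs where "zs = (\<lambda>N i. fst (scheme B G Q1 Q2 f t0 (P1 *v x0) (P2 *v x0) (h N) i))"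
  define us where "us = (\<lambda>N i. snd (scheme B G Q1 Q2 f t0 (P1 *v x0) (P2 *v x0) (h N) i))"
  define xs where "xs = (\<lambda>N i. zs N i + us N i)"
  have zs_Suc: "zs N (Suc i) = (mat 1 - h N *\<^sub>R (matrix_inv G ** B)) *v zs N i
      + h N *\<^sub>R (matrix_inv G *v (Q1 *v f (\<tau> N i) (xs N i)))" for N i
    by (simp add: zs_def us_def xs_def \<tau>_def Let_def split_def)
  have us_Suc: "us N (Suc i) = us N i - matrix_inv (mat 1 - matrix_inv G **
        jacobian (\<lambda>x. Q2 *v f (\<tau> N (Suc i)) x) (at (zs N (Suc i) + us N i)))
      *v (us N i - matrix_inv G *v (Q2 *v f (\<tau> N (Suc i)) (zs N (Suc i) + us N i)))" for N i
    by (simp add: zs_def us_def \<tau>_def Let_def split_def)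
  have \<tau>_range: "t0 \<le> \<tau> N i \<and> \<tau> N i \<le> T" if "i \<le> N" for N i
  proof (cases "N = 0")
    case True then show ?thesis using that T by (simp add: \<tau>_def)
  next
    case False
    then have "real i * h N \<le> real N * h N" using that T by (intro mult_right_mono) (auto simp: h_def)
    then show ?thesis using False T by (auto simp: \<tau>_def h_def)
  qed
  (* The scheme respects the splitting. Beyond i = N the Newton matrix may be singular,
     hence the restriction. *)
  have zsus: "P1 *v zs N i = zs N i \<and> P1 *v us N i = 0" if "i \<le> N" for N i
    using that
  proof (induction i)
    case 0
    then show ?case by (simp add: zs_def us_def P2 P'_eq matrix_vector_mult_diff_distrib)
  next
    case (Suc i)
    then have IH: "P1 *v zs N i = zs N i" "P1 *v us N i = 0" by auto
    have "matrix_inv G *v (B *v zs N i) = P1 *v (matrix_inv G *v (B *v zs N i))"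
      using Q_B[of "zs N i"] Gi_Q[of "B *v zs N i"] IH(1) by simp
    then have z: "P1 *v zs N (Suc i) = zs N (Suc i)"
      unfolding zs_Suc using IH(1)
      by (simp add: matrix_vector_right_distrib matrix_vector_mult_diff_rdistrib matrix_vector_mult_diff_distrib
          matrix_vector_mult_scaleR Gi_Q scaleR_matrix_vector_assoc[symmetric] flip: matrix_vector_mul_assoc)
    let ?t = "\<tau> N (Suc i)" and ?w = "zs N (Suc i) + us N i"
    let ?J = "jacobian (E ?t) (at ?w)"
    have t: "t0 \<le> ?t" "?t \<le> T" "0 \<le> ?t" using \<tau>_range[OF Suc.prems] t0 by auto
    let ?r = "us N i - matrix_inv G *v (Q2 *v f ?t ?w)"
    have J: "?J = mat 1 - matrix_inv G ** jacobian (\<lambda>x. Q2 *v f ?t x) (at ?w)"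
      unfolding Q2 by (rule jacobian_E[OF t(3)])
    let ?v = "matrix_inv ?J *v ?r"
    have "?J *v ?v = ?r" by (simp add: matrix_vector_mul_assoc matrix_inv_right[OF inv[OF t(1,2)]])
    moreover have "P1 *v (?J *v ?v) = P1 *v ?v"
      by (rule P_jacobian_E[OF t(3)])
    moreover have "P1 *v ?r = 0" unfolding Q2 by (simp add: matrix_vector_mult_diff_distrib IH)
    ultimately have "P1 *v ?v = 0" by simp
    then have "P1 *v us N (Suc i) = 0"
      unfolding us_Suc J[symmetric] by (simp add: matrix_vector_mult_diff_distrib[of P1] IH)
    with z show ?case by simp
  qed
  have init_zx: "zs N 0 = z t0" "xs N 0 = \<xi> t0 (z t0)" for N
    by (simp_all add: zs_def us_def xs_def z_init z0_def[symmetric] \<xi>x0) (simp add: z0_def dec)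
  have euler: "zs N (Suc i) = zs N i + h N *\<^sub>R \<Phi> (\<tau> N i) (xs N i)" if i: "i < N" for N i
  proof -
    have P: "P1 *v xs N i = zs N i"
      using zsus[of i N] i by (simp add: xs_def matrix_vector_right_distrib)
    have eq: "\<Phi> (\<tau> N i) (xs N i) = matrix_inv G *v (Q1 *v f (\<tau> N i) (xs N i)) - matrix_inv G *v (B *v zs N i)"
      by (simp add: \<Phi>_def matrix_vector_mult_diff_distrib Q_B P)
    show ?thesis unfolding zs_Suc eq
      by (simp add: matrix_vector_mult_diff_rdistrib scaleR_matrix_vector_assoc[symmetric] algebra_simps
          flip: matrix_vector_mul_assoc)
  qed
  (* With w = zs N (Suc i) + us N i the residual E t w - zs N (Suc i) is the bracket in the scheme. *)
  have newton: "xs N (Suc i) =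
        (let w = xs N i + (zs N (Suc i) - zs N i); t = \<tau> N (Suc i)
         in w - matrix_inv (jacobian (E t) (at w)) *v (E t w - zs N (Suc i)))" if i: "i < N" for N i
  proof -
    have w: "xs N i + (zs N (Suc i) - zs N i) = zs N (Suc i) + us N i" by (simp add: xs_def)
    have t: "0 \<le> \<tau> N (Suc i)" using \<tau>_range[of "Suc i" N] i t0 by auto
    have Ew: "E t w - zs N (Suc i) = us N i - matrix_inv G *v (Q2 *v f t w)"
      if "w = zs N (Suc i) + us N i" for t w
      using that by (simp add: E_def Q2)
    show ?thesis unfolding Let_def w Ew[OF refl]
      unfolding jacobian_E[OF t] Q2[symmetric] xs_def[of] us_Suc by (simp add: xs_def us_Suc)
  qed
  have ode_T: "(z has_vector_derivative \<Phi> t (\<xi> t (z t))) (at t within {t0..T})" if "t \<in> {t0..T}" for t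
    using has_vector_derivative_within_subset[OF z_ode[of t], of "{t0..T}"] that by (auto simp: F_def)
  have conv: "\<exists>N0. \<forall>N\<ge>N0. \<forall>i\<le>N. norm (z (\<tau> N i) - zs N i) \<le> e \<and> norm (x (\<tau> N i) - xs N i) \<le> e"
    if e: "e > 0" for e
  proof (rule euler_newton_converges[where z=z and zs=zs and xs=xs and e=e, OF t0 T inv _ ode_T init_zx])
    show "z t \<in> X1" if "t \<in> {t0..T}" for t using that zX1 by auto
    show "zs N (Suc i) = zs N i + ((T - t0) / real N) *\<^sub>R \<Phi> (t0 + real i * ((T - t0) / real N)) (xs N i)"
      if "i < N" for N i using euler[OF that] by (simp add: h_def \<tau>_def)
    show "xs N (Suc i) =
        (let w = xs N i + (zs N (Suc i) - zs N i); t = t0 + real (Suc i) * ((T - t0) / real N)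
         in w - matrix_inv (jacobian (E t) (at w)) *v (E t w - zs N (Suc i)))" if "i < N" for N i
      using newton[OF that] unfolding h_def \<tau>_def .
    show "e > 0" by (rule e)
    fix N0
    assume "\<And>N i. N \<ge> N0 \<Longrightarrow> i \<le> N \<Longrightarrow> norm (z (t0 + real i * ((T - t0) / real N)) - zs N i) \<le> e"
      "\<And>N i. N \<ge> N0 \<Longrightarrow> i \<le> N \<Longrightarrow> norm (\<xi> (t0 + real i * ((T - t0) / real N)) (z (t0 + real i * ((T - t0) / real N))) - xs N i) \<le> e"
    then show ?thesis by (intro exI[of _ N0]) (simp add: \<tau>_def h_def x_def)
  qed
  have lim_z: "(\<lambda>N. Max ((\<lambda>i. norm (P1 *v x (\<tau> N i) - zs N i)) ` {0..N})) \<longlonglongrightarrow> 0"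
  proof (rule Max_norm_tendsto_zero)
    fix e :: real assume "e > 0"
    then obtain N0 where N0: "\<forall>N\<ge>N0. \<forall>i\<le>N. norm (z (\<tau> N i) - zs N i) \<le> e \<and> norm (x (\<tau> N i) - xs N i) \<le> e"
      using conv by blast
    then show "\<exists>N0. \<forall>N\<ge>N0. \<forall>i\<le>N. norm (P1 *v x (\<tau> N i) - zs N i) \<le> e"
      by (intro exI[of _ N0]) (auto simp: Px \<tau>_range)
  qed simp
  have lim_u: "(\<lambda>N. Max ((\<lambda>i. norm (P2 *v x (\<tau> N i) - us N i)) ` {0..N})) \<longlonglongrightarrow> 0"
  proof (rule Max_norm_tendsto_zero)
    fix e :: real assume "e > 0"
    then obtain N0 where N0: "\<forall>N\<ge>N0. \<forall>i\<le>N. norm (z (\<tau> N i) - zs N i) \<le> e/2 \<and> norm (x (\<tau> N i) - xs N i) \<le> e/2"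
      using conv[of "e/2"] by auto
    have "norm (P2 *v x (\<tau> N i) - us N i) \<le> e" if N: "N \<ge> N0" "i \<le> N" for N i
    proof -
      have "P2 *v x (\<tau> N i) - us N i = (x (\<tau> N i) - xs N i) - (z (\<tau> N i) - zs N i)"
        using \<tau>_range[OF N(2)] by (simp add: P2 P'_eq Px xs_def)
      then have "norm (P2 *v x (\<tau> N i) - us N i) \<le> norm (x (\<tau> N i) - xs N i) + norm (z (\<tau> N i) - zs N i)"
        by (simp only: norm_triangle_ineq4)
      then show ?thesis using N0 N by force
    qed
    then show "\<exists>N0. \<forall>N\<ge>N0. \<forall>i\<le>N. norm (P2 *v x (\<tau> N i) - us N i) \<le> e" by blast
  qed simp
  show ?thesis
    by (rule exI[of _ x]) (use sol uniq lim_z lim_u in \<open>simp add: Let_def zs_def us_def \<tau>_def h_def\<close>)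
qed

end
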